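(* Let $n \ge 0$ be an integer and let $k$ be a field. The varieties $\mathfrak{B}_{n,k}^1$ and $\mathfrak{B}_{n,k}$ are connected.
   Context: All rings and algebras are commutative, associative, and with $1$. $\mathfrak{B}_n$ is the affine finite-type $\mathbb{Z}$-scheme representing the functor that sends a scheme $S$ to the set of isomorphism classes of pairs $(\mathcal{A},\phi)$ with $\mathcal{A}$ an $\mathcal{O}_S$-algebra and $\phi\colon \mathcal{A} \to \mathcal{O}_S^{\oplus n}$ an $\mathcal{O}_S$-module isomorphism (two pairs $(\mathcal{A},\phi)$, $(\mathcal{A}',\phi')$ are identified if there is an $\mathcal{O}_S$-algebra isomorphism $\alpha\colon\mathcal{A}\to\mathcal{A}'$ with $\phi'\circ\alpha=\phi$), and sends a morphism to pullback along it. For $n\ge1$, $\mathfrak{B}_n^1$ is the closed subscheme of $\mathfrak{B}_n$ parameterizing based algebras whose first basis vector equals $1$, i.e. those $(\mathcal{A},\phi)$ with $\phi(1)=(1,0,\dots,0)$; by convention $\mathfrak{B}_0^1:=\mathfrak{B}_0$. For a $\mathbb{Z}$-scheme $V$, $V_k=V\times_{\mathrm{Spec}\,\mathbb{Z}}\mathrm{Spec}\,k$; $\mathfrak{B}_{n,k}$ and $\mathfrak{B}_{n,k}^1$ denote these base changes ("variety" does not imply irreducible). *)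

theory Defs
  imports
    "HOL-Algebra.QuotRing"
    "HOL-Algebra.Module"
    "HOL-Library.Poly_Mapping"
    "HOL-Analysis.Abstract_Topology"
begin

section \<open>The prime spectrum with the Zariski topology\<close>

definition Spec :: "('a, 'm) ring_scheme \<Rightarrow> 'a set topology" where
  "Spec R = topology (\<lambda>U. \<exists>J \<subseteq> carrier R. U = {P. primeideal P R \<and> \<not> J \<subseteq> P})"

lemma istopology_Zariski:
  "istopology (\<lambda>U. \<exists>J \<subseteq> carrier R. U = {P. primeideal P R \<and> \<not> J \<subseteq> P})"
  unfolding istopology_def
proof (intro conjI allI impI)
  fix U V
  assume "\<exists>J \<subseteq> carrier R. U = {P. primeideal P R \<and> \<not> J \<subseteq> P}"
    and "\<exists>J \<subseteq> carrier R. V = {P. primeideal P R \<and> \<not> J \<subseteq> P}"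
  then obtain J K where J: "J \<subseteq> carrier R" "U = {P. primeideal P R \<and> \<not> J \<subseteq> P}"
    and K: "K \<subseteq> carrier R" "V = {P. primeideal P R \<and> \<not> K \<subseteq> P}" by blast
  define L where "L = {a \<otimes>\<^bsub>R\<^esub> b | a b. a \<in> J \<and> b \<in> K} \<inter> carrier R"
  have "(\<not> L \<subseteq> P) = (\<not> J \<subseteq> P \<and> \<not> K \<subseteq> P)" if P: "primeideal P R" for P
  proof -
    interpret primeideal P R by (rule P)
    have "a \<otimes>\<^bsub>R\<^esub> b \<in> L" if "a \<in> J" "b \<in> K" for a b
      using that J K by (auto simp: L_def)
    moreover have "a \<otimes>\<^bsub>R\<^esub> b \<in> P \<longleftrightarrow> a \<in> P \<or> b \<in> P" if "a \<in> J" "b \<in> K" for a b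
      using that J K I_prime[of a b] I_l_closed[of b a] I_r_closed[of a b] by blast
    moreover have "\<exists>a\<in>J. \<exists>b\<in>K. l = a \<otimes>\<^bsub>R\<^esub> b" if "l \<in> L" for l
      using that by (auto simp: L_def)
    ultimately show ?thesis by blast
  qed
  then have "U \<inter> V = {P. primeideal P R \<and> \<not> L \<subseteq> P}" using J K by blast
  moreover have "L \<subseteq> carrier R" by (simp add: L_def)
  ultimately show "\<exists>J \<subseteq> carrier R. U \<inter> V = {P. primeideal P R \<and> \<not> J \<subseteq> P}" by blast
next
  fix \<K>
  assume "\<forall>U\<in>\<K>. \<exists>J \<subseteq> carrier R. U = {P. primeideal P R \<and> \<not> J \<subseteq> P}"
  then obtain J where J: "\<And>U. U \<in> \<K> \<Longrightarrow> J U \<subseteq> carrier R \<and> U = {P. primeideal P R \<and> \<not> J U \<subseteq> P}"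
    by metis
  have "P \<in> \<Union>\<K> \<longleftrightarrow> primeideal P R \<and> \<not> (\<Union>U\<in>\<K>. J U) \<subseteq> P" for P
  proof -
    have "P \<in> U \<longleftrightarrow> primeideal P R \<and> \<not> J U \<subseteq> P" if "U \<in> \<K>" for U
      using J[OF that] by blast
    then show ?thesis by blast
  qed
  then have "\<Union>\<K> = {P. primeideal P R \<and> \<not> (\<Union>U\<in>\<K>. J U) \<subseteq> P}" by blast
  moreover have "(\<Union>U\<in>\<K>. J U) \<subseteq> carrier R" using J by blast
  ultimately show "\<exists>J \<subseteq> carrier R. \<Union>\<K> = {P. primeideal P R \<and> \<not> J \<subseteq> P}" by blast
qed

lemma openin_Spec:
  "openin (Spec R) U \<longleftrightarrow> (\<exists>J \<subseteq> carrier R. U = {P. primeideal P R \<and> \<not> J \<subseteq> P})"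
  unfolding Spec_def using istopology_Zariski[of R] by (simp add: topology_inverse')

lemma topspace_Spec: "topspace (Spec R) = {P. primeideal P R}"
proof -
  have "openin (Spec R) {P. primeideal P R}"
  proof (cases "\<exists>P. primeideal P R")
    case True
    then have "cring R" by (auto simp: primeideal_def)
    then interpret cring R .
    have "\<not> carrier R \<subseteq> P" if "primeideal P R" for P
      using that primeideal.I_notcarr[OF that] additive_subgroup.a_subset[of P R]
      by (auto simp: primeideal_def ideal_def)
    then show ?thesis unfolding openin_Spec by (intro exI[of _ "carrier R"]) blast
  next
    case False
    then have "{P. primeideal P R} = {P. primeideal P R \<and> \<not> {} \<subseteq> P}" by simp
    then show ?thesis unfolding openin_Spec by blast
  qed
  moreover have "U \<subseteq> {P. primeideal P R}" if "openin (Spec R) U" for U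
    using that by (auto simp: openin_Spec)
  ultimately show ?thesis by (metis openin_subset openin_topspace subset_antisym)
qed


section \<open>Closed subschemes of affine space and their base change\<close>

text \<open>Polynomials in the variables \<open>V\<close> over \<open>k\<close>; \<open>coord_ring V E\<close> is \<open>k[V]/(E)\<close>.\<close>

type_synonym ('v, 'k) mpoly = "('v \<Rightarrow>\<^sub>0 nat) \<Rightarrow>\<^sub>0 'k"

definition mpoly_ring :: "'v set \<Rightarrow> ('v, 'k::comm_ring_1) mpoly ring" where
  "mpoly_ring V = \<lparr>carrier = {p. \<forall>m \<in> Poly_Mapping.keys p. Poly_Mapping.keys m \<subseteq> V},
     mult = (*), one = 1, zero = 0, add = (+)\<rparr>"

definition Const :: "'k \<Rightarrow> ('v, 'k::comm_ring_1) mpoly" where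
  "Const c = Poly_Mapping.single 0 c"

definition Var :: "'v \<Rightarrow> ('v, 'k::comm_ring_1) mpoly" where
  "Var v = Poly_Mapping.single (Poly_Mapping.single v 1) 1"

definition coord_ring :: "'v set \<Rightarrow> ('v, 'k::comm_ring_1) mpoly set \<Rightarrow> ('v, 'k) mpoly set ring" where
  "coord_ring V E = mpoly_ring V Quot genideal (mpoly_ring V) E"

definition cls :: "'v set \<Rightarrow> ('v, 'k::comm_ring_1) mpoly set \<Rightarrow> ('v, 'k) mpoly \<Rightarrow> ('v, 'k) mpoly set" where
  "cls V E p = genideal (mpoly_ring V) E +>\<^bsub>mpoly_ring V\<^esub> p"

text \<open>The base change to \<open>k\<close> of the \<open>\<int>\<close>-scheme \<open>Spec \<int>[V]/(E)\<close> is \<open>Spec k[V]/(E)\<close>, the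
  equations being read in \<open>k[V]\<close>; see \<open>base_change_pushout\<close> below.\<close>

definition base_change :: "('v, int) mpoly set \<Rightarrow> ('v, 'k::comm_ring_1) mpoly set" where
  "base_change E = Poly_Mapping.map of_int ` E"


lemma mpoly_sum_singles: "(\<Sum>m\<in>Poly_Mapping.keys p. Poly_Mapping.single m (Poly_Mapping.lookup p m)) = p"
  by (rule poly_mapping_eqI)
    (auto simp: lookup_sum lookup_single when_def sum.delta' in_keys_iff cong: if_cong)

lemma mpoly_carrier_iff:
  "p \<in> carrier (mpoly_ring V) \<longleftrightarrow> (\<forall>m \<in> Poly_Mapping.keys p. Poly_Mapping.keys m \<subseteq> V)"
  by (simp add: mpoly_ring_def)

lemma mpoly_ops [simp]:
  "p \<otimes>\<^bsub>mpoly_ring V\<^esub> q = p * q" "p \<oplus>\<^bsub>mpoly_ring V\<^esub> q = p + q"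
  "\<one>\<^bsub>mpoly_ring V\<^esub> = 1" "\<zero>\<^bsub>mpoly_ring V\<^esub> = 0"
  by (simp_all add: mpoly_ring_def)

lemma mpoly_add_closed: "p \<in> carrier (mpoly_ring V) \<Longrightarrow> q \<in> carrier (mpoly_ring V) \<Longrightarrow> p + q \<in> carrier (mpoly_ring V)"
  using Poly_Mapping.keys_add[of p q] by (fastforce simp: mpoly_carrier_iff)

lemma mpoly_uminus_closed: "p \<in> carrier (mpoly_ring V) \<Longrightarrow> - p \<in> carrier (mpoly_ring V)"
  by (simp add: mpoly_carrier_iff in_keys_iff)

lemma mpoly_diff_closed: "p \<in> carrier (mpoly_ring V) \<Longrightarrow> q \<in> carrier (mpoly_ring V) \<Longrightarrow> p - q \<in> carrier (mpoly_ring V)"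
  using mpoly_add_closed[of p V "- q"] mpoly_uminus_closed[of q V] by simp

lemma mpoly_mult_closed:
  assumes "p \<in> carrier (mpoly_ring V)" "q \<in> carrier (mpoly_ring V)"
  shows "p * q \<in> carrier (mpoly_ring V)"
proof -
  have "Poly_Mapping.keys m \<subseteq> V" if "m \<in> Poly_Mapping.keys (p * q)" for m
  proof -
    from that keys_mult[of p q] obtain a b
      where "m = a + b" "a \<in> Poly_Mapping.keys p" "b \<in> Poly_Mapping.keys q" by blast
    then show ?thesis using assms Poly_Mapping.keys_add[of a b] by (fastforce simp: mpoly_carrier_iff)
  qed
  then show ?thesis by (simp add: mpoly_carrier_iff)
qed

lemma Const_closed: "Const c \<in> carrier (mpoly_ring V)"
  by (simp add: mpoly_carrier_iff Const_def)

lemma Var_closed: "v \<in> V \<Longrightarrow> Var v \<in> carrier (mpoly_ring V)"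
  by (simp add: mpoly_carrier_iff Var_def)

lemma one_closed': "(1::('v,'k::comm_ring_1) mpoly) \<in> carrier (mpoly_ring V)"
  using Const_closed[of 1] by (simp add: Const_def)

lemma zero_closed': "(0::('v,'k::comm_ring_1) mpoly) \<in> carrier (mpoly_ring V)"
  using Const_closed[of 0] by (simp add: Const_def)

lemma mpoly_sum_closed: "(\<And>i. i \<in> I \<Longrightarrow> f i \<in> carrier (mpoly_ring V)) \<Longrightarrow> sum f I \<in> carrier (mpoly_ring V)"
  by (induction I rule: infinite_finite_induct) (auto intro: mpoly_add_closed zero_closed')

lemma cring_mpoly_ring: "cring (mpoly_ring V :: ('v, 'k::comm_ring_1) mpoly ring)"
proof (rule cringI)
  show "abelian_group (mpoly_ring V :: ('v, 'k::comm_ring_1) mpoly ring)"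
  proof (rule abelian_groupI, goal_cases)
    case (6 x)
    then show ?case by (intro bexI[of _ "- x"]) (auto intro: mpoly_uminus_closed)
  qed (auto intro: mpoly_add_closed zero_closed' simp: algebra_simps)
  show "Group.comm_monoid (mpoly_ring V :: ('v, 'k::comm_ring_1) mpoly ring)"
    by (rule comm_monoidI) (auto intro: mpoly_mult_closed one_closed' simp: algebra_simps)
qed (simp add: algebra_simps)

text \<open>Induction over the polynomials in the variables \<open>V\<close>.\<close>

lemma mpoly_induct [consumes 1, case_names Const add Var]:
  fixes p :: "('v, 'k::comm_ring_1) mpoly"
  assumes p: "p \<in> carrier (mpoly_ring V)"
    and C: "\<And>c. P (Const c)"
    and A: "\<And>p q. p \<in> carrier (mpoly_ring V) \<Longrightarrow> q \<in> carrier (mpoly_ring V) \<Longrightarrow> P p \<Longrightarrow> P q \<Longrightarrow> P (p + q)"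
    and V: "\<And>p v. p \<in> carrier (mpoly_ring V) \<Longrightarrow> v \<in> V \<Longrightarrow> P p \<Longrightarrow> P (p * Var v)"
  shows "P p"
proof -
  have single_closed: "Poly_Mapping.single m c \<in> carrier (mpoly_ring V)"
    if "Poly_Mapping.keys m \<subseteq> V" for m and c :: 'k
    using that by (auto simp: mpoly_carrier_iff)
  have single: "P (Poly_Mapping.single m c)" if "Poly_Mapping.keys m \<subseteq> V" for m c
    using that
  proof (induction "\<Sum>v\<in>Poly_Mapping.keys m. Poly_Mapping.lookup m v" arbitrary: m rule: less_induct)
    case less
    show ?case
    proof (cases "m = 0")
      case True
      then show ?thesis using C[of c] by (simp add: Const_def)
    next
      case False
      then obtain v where v: "v \<in> Poly_Mapping.keys m"
        using keys_eq_empty by (metis keys_zero poly_mapping_eqI equals0I in_keys_iff lookup_zero)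
      define m' where "m' = m - Poly_Mapping.single v 1"
      have m: "m = m' + Poly_Mapping.single v 1"
        using v by (intro poly_mapping_eqI) (auto simp: m'_def lookup_add lookup_minus lookup_single when_def in_keys_iff)
      have keys: "Poly_Mapping.keys m' \<subseteq> Poly_Mapping.keys m"
        by (auto simp: m'_def in_keys_iff lookup_minus)
      have "(\<Sum>v\<in>Poly_Mapping.keys m'. Poly_Mapping.lookup m' v) = (\<Sum>v\<in>Poly_Mapping.keys m. Poly_Mapping.lookup m' v)"
        using keys by (intro sum.mono_neutral_left) (auto simp: in_keys_iff)
      also have "\<dots> < (\<Sum>v\<in>Poly_Mapping.keys m. Poly_Mapping.lookup m v)"
        using v by (intro sum_strict_mono_ex1) (auto simp: m lookup_add lookup_single when_def intro!: bexI[of _ v])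
      finally have "P (Poly_Mapping.single m' c)"
        using less keys by blast
      moreover have "Poly_Mapping.single m c = Poly_Mapping.single m' c * Var v"
        by (simp add: Var_def mult_single m)
      ultimately show ?thesis
        using V[of "Poly_Mapping.single m' c" v] single_closed[of m' c] keys less.prems v by auto
    qed
  qed
  have "finite S \<Longrightarrow> (\<And>m. m \<in> S \<Longrightarrow> Poly_Mapping.keys m \<subseteq> V) \<Longrightarrow> P (\<Sum>m\<in>S. Poly_Mapping.single m (Poly_Mapping.lookup p m))" for S
  proof (induction S rule: finite_induct)
    case empty
    then show ?case using C[of 0] by (simp add: Const_def)
  next
    case (insert m S)
    then show ?case by (auto intro!: A single single_closed mpoly_sum_closed)
  qed
  from this[of "Poly_Mapping.keys p"] p show ?thesis
    by (simp add: mpoly_sum_singles mpoly_carrier_iff)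
qed


definition type_ring :: "'k::comm_ring_1 ring" where
  "type_ring = \<lparr>carrier = UNIV, mult = (*), one = 1, zero = 0, add = (+)\<rparr>"

lemma type_ring_simps [simp]:
  "carrier type_ring = UNIV" "x \<otimes>\<^bsub>type_ring\<^esub> y = x * y" "x \<oplus>\<^bsub>type_ring\<^esub> y = x + y"
  "\<one>\<^bsub>type_ring\<^esub> = 1" "\<zero>\<^bsub>type_ring\<^esub> = 0"
  by (simp_all add: type_ring_def)

lemma cring_type_ring: "cring (type_ring :: 'k::comm_ring_1 ring)"
proof (rule cringI)
  show "abelian_group (type_ring :: 'k ring)"
  proof (rule abelian_groupI, goal_cases)
    case (6 x)
    then show ?case by (intro bexI[of _ "- x"]) auto
  qed (auto simp: algebra_simps)
  show "Group.comm_monoid (type_ring :: 'k ring)"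
    by (rule comm_monoidI) (auto simp: algebra_simps)
qed (simp add: algebra_simps)


locale evaluation = cring T for T (structure) +
  fixes h :: "'k::comm_ring_1 \<Rightarrow> 'a" and a :: "'v \<Rightarrow> 'a"
  assumes h: "h \<in> ring_hom type_ring T" and a: "a v \<in> carrier T"
begin

lemma h_simps [simp]: "h c \<in> carrier T" "h (c + d) = h c \<oplus> h d" "h (c * d) = h c \<otimes> h d"
  "h 1 = \<one>" "h 0 = \<zero>"
proof -
  interpret H: ring_hom_cring type_ring T h
    using h cring_type_ring cring_axioms by (simp add: ring_hom_cring_def ring_hom_cring_axioms_def)
  show "h c \<in> carrier T" "h (c + d) = h c \<oplus> h d" "h (c * d) = h c \<otimes> h d" "h 1 = \<one>" "h 0 = \<zero>"
    using H.hom_closed[of c] H.hom_add[of c d] H.hom_mult[of c d] H.hom_one H.hom_zero by auto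
qed

definition mon :: "('v \<Rightarrow>\<^sub>0 nat) \<Rightarrow> 'a" where
  "mon m = (\<Otimes>v\<in>Poly_Mapping.keys m. a v [^] Poly_Mapping.lookup m v)"

definition ev :: "('v, 'k) mpoly \<Rightarrow> 'a" where
  "ev p = (\<Oplus>m\<in>Poly_Mapping.keys p. h (Poly_Mapping.lookup p m) \<otimes> mon m)"

lemma mon_superset:
  assumes "finite S" "Poly_Mapping.keys m \<subseteq> S"
  shows "mon m = (\<Otimes>v\<in>S. a v [^] Poly_Mapping.lookup m v)"
  unfolding mon_def using assms a
  by (intro finprod_mono_neutral_cong_left) (auto simp: in_keys_iff)

lemma mon_closed [simp]: "mon m \<in> carrier T"
  unfolding mon_def using a by (intro finprod_closed) auto

lemma mon_add: "mon (m + m') = mon m \<otimes> mon m'"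
proof -
  let ?S = "Poly_Mapping.keys m \<union> Poly_Mapping.keys m'"
  have "mon (m + m') = (\<Otimes>v\<in>?S. a v [^] Poly_Mapping.lookup m v \<otimes> a v [^] Poly_Mapping.lookup m' v)"
    using a by (subst mon_superset[of ?S]) (auto simp: keys_add lookup_add nat_pow_mult intro!: finprod_cong')
  also have "\<dots> = mon m \<otimes> mon m'"
    using a by (subst finprod_multf) (auto simp: mon_superset[of ?S])
  finally show ?thesis .
qed

lemma mon_0: "mon 0 = \<one>"
  by (simp add: mon_def)

lemma mon_single: "mon (Poly_Mapping.single v 1) = a v"
  using a by (simp add: mon_def)

lemma ev_superset:
  assumes "finite S" "Poly_Mapping.keys p \<subseteq> S"
  shows "ev p = (\<Oplus>m\<in>S. h (Poly_Mapping.lookup p m) \<otimes> mon m)"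
  unfolding ev_def using assms 
  by (intro add.finprod_mono_neutral_cong_left) (auto simp: in_keys_iff)

lemma ev_closed [simp]: "ev p \<in> carrier T"
  unfolding ev_def by (intro finsum_closed) auto

lemma ev_add: "ev (p + q) = ev p \<oplus> ev q"
proof -
  let ?S = "Poly_Mapping.keys p \<union> Poly_Mapping.keys q"
  have "ev (p + q) = (\<Oplus>m\<in>?S. h (Poly_Mapping.lookup p m) \<otimes> mon m \<oplus> h (Poly_Mapping.lookup q m) \<otimes> mon m)"
    by (subst ev_superset[of ?S]) (auto simp: keys_add lookup_add l_distr intro!: finsum_cong')
  also have "\<dots> = ev p \<oplus> ev q"
    by (subst finsum_addf) (auto simp: ev_superset[of ?S])
  finally show ?thesis .
qed

lemma ev_single: "ev (Poly_Mapping.single m c) = h c \<otimes> mon m"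
  by (subst ev_superset[of "{m}"]) auto

lemma ev_Const: "ev (Const c) = h c"
  by (simp add: Const_def ev_single mon_0)

lemma ev_Var: "ev (Var v) = a v"
  using a by (simp add: Var_def ev_single mon_single[simplified])

lemma ev_1: "ev 1 = \<one>"
  using ev_Const[of 1] by (simp add: Const_def)

lemma ev_0: "ev 0 = \<zero>"
  using ev_Const[of 0] by (simp add: Const_def)

lemma singles_induct:
  fixes p :: "('v, 'k) mpoly"
  assumes "\<And>m c. P (Poly_Mapping.single m c)" "\<And>p q. P p \<Longrightarrow> P q \<Longrightarrow> P (p + q)"
  shows "P p"
proof -
  have P0: "P 0" using assms(1)[of 0 0] by simp
  have "finite S \<Longrightarrow> P (\<Sum>m\<in>S. Poly_Mapping.single m (Poly_Mapping.lookup p m))" for S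
    by (induction S rule: finite_induct) (auto intro: assms P0)
  from this[of "Poly_Mapping.keys p"] show ?thesis by (simp add: mpoly_sum_singles)
qed

lemma ev_mult: "ev (p * q) = ev p \<otimes> ev q"
proof (induction p rule: singles_induct)
  case (1 m c)
  show ?case
  proof (induction q rule: singles_induct)
    case (1 m' c')
    then show ?case by (simp add: mult_single ev_single mon_add m_ac)
  next
    case (2 p q)
    then show ?case by (simp add: ev_add distrib_left r_distr)
  qed
next
  case (2 p q)
  then show ?case by (simp add: ev_add distrib_right l_distr)
qed

lemma ev_uminus: "ev (- p) = \<ominus> ev p"
  using ev_add[of "- p" p] by (simp add: ev_0 minus_equality)

lemma ev_diff: "ev (p - q) = ev p \<ominus> ev q"
  using ev_add[of p "- q"] by (simp add: ev_uminus a_minus_def)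

lemma ev_sum: "ev (sum f I) = (\<Oplus>i\<in>I. ev (f i))"
  by (induction I rule: infinite_finite_induct) (auto simp: ev_0 ev_add)

lemma ev_ring_hom: "ev \<in> ring_hom (mpoly_ring V) T"
  by (rule ring_hom_memI) (auto simp: ev_mult ev_add ev_1)

lemma ev_unique:
  assumes g: "g \<in> ring_hom (mpoly_ring V) T" and C: "\<And>c. g (Const c) = h c"
    and V: "\<And>v. v \<in> V \<Longrightarrow> g (Var v) = a v" and p: "p \<in> carrier (mpoly_ring V)"
  shows "g p = ev p"
  using p
proof (induction p rule: mpoly_induct)
  case (Const c)
  then show ?case by (simp add: C ev_Const)
next
  case (add p q)
  then show ?case using ring_hom_add[OF g, of p q] by (simp add: ev_add)
next
  case (Var p v)
  then show ?case using ring_hom_mult[OF g, of p "Var v"] by (simp add: ev_mult Var_closed V ev_Var)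
qed

end

lemma ideal_genideal_mpoly:
  assumes "E \<subseteq> carrier (mpoly_ring V)"
  shows "ideal (genideal (mpoly_ring V) E) (mpoly_ring V)"
  using assms cring.axioms(1)[OF cring_mpoly_ring] ring.genideal_ideal by blast

lemma cring_coord_ring:
  assumes "E \<subseteq> carrier (mpoly_ring V)"
  shows "cring (coord_ring V E)"
  unfolding coord_ring_def
  using ideal.quotient_is_cring[OF ideal_genideal_mpoly[OF assms] cring_mpoly_ring] .

lemma cls_ring_hom:
  assumes "E \<subseteq> carrier (mpoly_ring V)"
  shows "cls V E \<in> ring_hom (mpoly_ring V) (coord_ring V E)"
proof -
  have "cls V E = (+>\<^bsub>mpoly_ring V\<^esub>) (genideal (mpoly_ring V) E)"
    by (simp add: cls_def fun_eq_iff)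
  then show ?thesis
    using ideal.rcos_ring_hom[OF ideal_genideal_mpoly[OF assms]] by (simp add: coord_ring_def)
qed

lemma coord_ring_cases:
  assumes "X \<in> carrier (coord_ring V E)"
  obtains p where "p \<in> carrier (mpoly_ring V)" "X = cls V E p"
  using assms by (auto simp: coord_ring_def cls_def FactRing_def A_RCOSETS_def')

lemma cls_closed: "p \<in> carrier (mpoly_ring V) \<Longrightarrow> cls V E p \<in> carrier (coord_ring V E)"
  by (auto simp: coord_ring_def cls_def FactRing_def A_RCOSETS_def')

lemma cls_eq_zero:
  assumes "E \<subseteq> carrier (mpoly_ring V)" "e \<in> E"
  shows "cls V E e = \<zero>\<^bsub>coord_ring V E\<^esub>"
proof -
  interpret I: ideal "genideal (mpoly_ring V) E" "mpoly_ring V"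
    by (rule ideal_genideal_mpoly[OF assms(1)])
  have "e \<in> genideal (mpoly_ring V) E"
    using I.genideal_self[OF assms(1)] assms(2) by blast
  then show ?thesis
    by (simp add: cls_def coord_ring_def FactRing_def I.a_rcos_const)
qed

lemma cls_Const_ring_hom:
  fixes E :: "('v, 'k::comm_ring_1) mpoly set"
  assumes "E \<subseteq> carrier (mpoly_ring V)"
  shows "(\<lambda>c. cls V E (Const c)) \<in> ring_hom type_ring (coord_ring V E)"
proof -
  have "Const (c + d) = (Const c :: ('v,'k) mpoly) + Const d" "Const (c * d) = (Const c :: ('v,'k) mpoly) * Const d" "Const 1 = (1 :: ('v,'k) mpoly)" for c d :: 'k
    by (simp_all add: Const_def single_add mult_single)
  moreover note ring_hom_add[OF cls_ring_hom[OF assms] Const_closed Const_closed]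
    ring_hom_mult[OF cls_ring_hom[OF assms] Const_closed Const_closed]
    ring_hom_one[OF cls_ring_hom[OF assms]]
  ultimately show ?thesis
    by (intro ring_hom_memI) (auto intro!: cls_closed Const_closed)
qed

context evaluation
begin

lemma factor_ex:
  assumes E: "E \<subseteq> carrier (mpoly_ring V)" and van: "\<And>e. e \<in> E \<Longrightarrow> ev e = \<zero>"
  shows "\<exists>f \<in> ring_hom (coord_ring V E) T. \<forall>p \<in> carrier (mpoly_ring V). f (cls V E p) = ev p"
proof -
  let ?M = "mpoly_ring V :: ('v, 'k) mpoly ring"
  interpret M: cring ?M by (rule cring_mpoly_ring)
  interpret H: ring_hom_ring ?M T ev
    by (rule ring_hom_ringI2[OF M.ring_axioms ring_axioms ev_ring_hom])
  define I where "I = genideal ?M E"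
  interpret I: ideal I ?M unfolding I_def by (rule ideal_genideal_mpoly[OF E])
  have ker_iff: "x \<in> a_kernel ?M T ev \<longleftrightarrow> x \<in> carrier ?M \<and> ev x = \<zero>" for x
    unfolding a_kernel_def' by blast
  have "E \<subseteq> a_kernel ?M T ev"
    using E van ker_iff by blast
  then have "I \<subseteq> a_kernel ?M T ev"
    unfolding I_def by (rule M.genideal_minimal[OF H.kernel_is_ideal])
  then have ker: "ev x = \<zero>" if "x \<in> I" for x
    using that ker_iff by blast
  define f where "f X = ev (SOME x. x \<in> X)" for X
  have f: "f (cls V E p) = ev p" if p: "p \<in> carrier ?M" for p
  proof -
    have "p \<in> cls V E p" using I.a_rcos_self[OF p] by (simp add: cls_def I_def)
    then have "(SOME x. x \<in> cls V E p) \<in> cls V E p" by (rule someI)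
    then obtain i where i: "i \<in> I" "(SOME x. x \<in> cls V E p) = i + p"
      by (auto simp: cls_def I_def a_r_coset_def')
    then show ?thesis by (simp add: f_def ev_add ker)
  qed
  note c = cls_ring_hom[OF E]
  have "f \<in> ring_hom (coord_ring V E) T"
  proof (rule ring_hom_memI)
    fix X assume "X \<in> carrier (coord_ring V E)"
    then obtain p where p: "p \<in> carrier ?M" "X = cls V E p" by (rule coord_ring_cases)
    then show "f X \<in> carrier T" by (simp add: f)
    fix Y assume "Y \<in> carrier (coord_ring V E)"
    then obtain q where q: "q \<in> carrier ?M" "Y = cls V E q" by (rule coord_ring_cases)
    show "f (X \<otimes>\<^bsub>coord_ring V E\<^esub> Y) = f X \<otimes> f Y"
      using f[OF mpoly_mult_closed[OF p(1) q(1)]] ring_hom_mult[OF c p(1) q(1)] p q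
      by (simp add: f ev_mult)
    show "f (X \<oplus>\<^bsub>coord_ring V E\<^esub> Y) = f X \<oplus> f Y"
      using f[OF mpoly_add_closed[OF p(1) q(1)]] ring_hom_add[OF c p(1) q(1)] p q
      by (simp add: f ev_add)
  next
    show "f \<one>\<^bsub>coord_ring V E\<^esub> = \<one>"
      using f[OF one_closed'] ring_hom_one[OF c] by (simp add: ev_1)
  qed
  with f show ?thesis by blast
qed

lemma factor_ev:
  assumes E: "E \<subseteq> carrier (mpoly_ring V)"
    and f: "f \<in> ring_hom (coord_ring V E) T"
    and C: "\<And>c. f (cls V E (Const c)) = h c" and V: "\<And>v. v \<in> V \<Longrightarrow> f (cls V E (Var v)) = a v"
    and p: "p \<in> carrier (mpoly_ring V)"
  shows "f (cls V E p) = ev p"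
proof -
  have "f \<circ> cls V E \<in> ring_hom (mpoly_ring V) T"
    by (rule ring_hom_trans[OF cls_ring_hom[OF E] f])
  from ev_unique[OF this _ _ p] C V show ?thesis by simp
qed

lemma factor_zero:
  assumes E: "E \<subseteq> carrier (mpoly_ring V)"
    and f: "f \<in> ring_hom (coord_ring V E) T"
    and C: "\<And>c. f (cls V E (Const c)) = h c" and V: "\<And>v. v \<in> V \<Longrightarrow> f (cls V E (Var v)) = a v"
    and e: "e \<in> E"
  shows "ev e = \<zero>"
proof -
  have "ev e = f (cls V E e)" using factor_ev[OF E f C V] E e by auto
  also have "\<dots> = f \<zero>\<^bsub>coord_ring V E\<^esub>" by (simp add: cls_eq_zero[OF E e])
  also have "\<dots> = \<zero>"
    using ring_hom_zero[OF f] cring.axioms(1)[OF cring_coord_ring[OF E]] ring_axioms by blast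
  finally show ?thesis .
qed

lemma ring_hom_of_int: "(\<lambda>z. h (of_int z)) \<in> ring_hom (type_ring :: int ring) T"
  by (rule ring_hom_memI) simp_all

lemma evaluation_int: "evaluation T (\<lambda>z::int. h (of_int z)) a"
  by (intro evaluation.intro evaluation_axioms.intro ring_hom_of_int a cring_axioms)

lemma ev_of_int: "ev (Poly_Mapping.map of_int p) = evaluation.ev T (\<lambda>z::int. h (of_int z)) a p"
proof -
  interpret Z: evaluation T "\<lambda>z::int. h (of_int z)" a by (rule evaluation_int)
  have "Poly_Mapping.keys (Poly_Mapping.map of_int p :: ('v, 'k) mpoly) \<subseteq> Poly_Mapping.keys p"
    by (auto simp: in_keys_iff Poly_Mapping.map.rep_eq when_def)
  then have "ev (Poly_Mapping.map of_int p)
    = (\<Oplus>m\<in>Poly_Mapping.keys p. h (Poly_Mapping.lookup (Poly_Mapping.map of_int p) m) \<otimes> mon m)"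
    by (rule ev_superset[OF Poly_Mapping.finite_keys])
  also have "\<dots> = (\<Oplus>m\<in>Poly_Mapping.keys p. h (of_int (Poly_Mapping.lookup p m)) \<otimes> mon m)"
    by (simp add: Poly_Mapping.map.rep_eq when_def in_keys_iff cong: finsum_cong)
  finally show ?thesis by (simp add: Z.ev_def)
qed

end

lemma base_change_closed:
  fixes E :: "('v, int) mpoly set"
  assumes "E \<subseteq> carrier (mpoly_ring V)"
  shows "base_change E \<subseteq> carrier (mpoly_ring V :: ('v, 'k::comm_ring_1) mpoly ring)"
proof -
  have "Poly_Mapping.keys (Poly_Mapping.map of_int p :: ('v, 'k) mpoly) \<subseteq> Poly_Mapping.keys p"
    for p :: "('v, int) mpoly"
    by (auto simp: in_keys_iff Poly_Mapping.map.rep_eq when_def)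
  then have "Poly_Mapping.map of_int p \<in> carrier (mpoly_ring V :: ('v, 'k) mpoly ring)"
    if "p \<in> carrier (mpoly_ring V)" for p :: "('v, int) mpoly"
    using that unfolding mpoly_carrier_iff by blast
  then show ?thesis using assms unfolding base_change_def by blast
qed

lemma base_change_int: "base_change E = (E :: ('v, int) mpoly set)"
proof -
  have "Poly_Mapping.map of_int p = p" for p :: "('v, int) mpoly"
    by (rule poly_mapping_eqI) (auto simp: Poly_Mapping.map.rep_eq when_def)
  then show ?thesis by (simp add: base_change_def)
qed

lemma base_change_ring_hom:
  fixes E :: "('v, int) mpoly set"
  assumes E: "E \<subseteq> carrier (mpoly_ring V)"
  shows "\<exists>j \<in> ring_hom (coord_ring V E) (coord_ring V (base_change E :: ('v, 'k::comm_ring_1) mpoly set)).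
    \<forall>p \<in> carrier (mpoly_ring V). j (cls V E p) = cls V (base_change E) (Poly_Mapping.map of_int p)"
proof -
  let ?R = "coord_ring V (base_change E :: ('v, 'k) mpoly set)"
  note E' = base_change_closed[OF E]
  define a :: "'v \<Rightarrow> ('v,'k) mpoly set" where
    "a v = (if v \<in> V then cls V (base_change E) (Var v) else \<one>\<^bsub>?R\<^esub>)" for v
  interpret R: cring ?R by (rule cring_coord_ring[OF E'])
  interpret K: evaluation ?R "\<lambda>c. cls V (base_change E) (Const c)" a
    by standard (auto simp: a_def cls_Const_ring_hom[OF E'] intro!: cls_closed Var_closed)
  interpret Z: evaluation ?R "\<lambda>z::int. cls V (base_change E) (Const (of_int z))" a
    by (rule K.evaluation_int)
  have K: "cls V (base_change E) p = K.ev p" if "p \<in> carrier (mpoly_ring V)" for p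
    using that by (intro K.ev_unique[OF cls_ring_hom[OF E']]) (auto simp: a_def)
  have "Poly_Mapping.map of_int p \<in> carrier (mpoly_ring V :: ('v, 'k) mpoly ring)" 
    if "p \<in> carrier (mpoly_ring V)" for p
    using base_change_closed[of "{p}" V] that by (auto simp: base_change_def)
  then have KZ: "cls V (base_change E) (Poly_Mapping.map of_int p) = Z.ev p" if "p \<in> carrier (mpoly_ring V)" for p
    using that K K.ev_of_int by simp
  have "Z.ev e = \<zero>\<^bsub>?R\<^esub>" if e: "e \<in> E" for e
  proof -
    have e': "Poly_Mapping.map of_int e \<in> base_change E" using e by (simp add: base_change_def)
    then show ?thesis using KZ[of e] cls_eq_zero[OF E' e'] E e by auto
  qed
  from Z.factor_ex[OF E this] KZ show ?thesis by auto
qed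

text \<open>Ring homomorphisms out of \<open>\<int>[V]/(E)\<close> and out of \<open>k\<close> into a common ring correspond to
  ring homomorphisms out of \<open>k[V]/(E)\<close>, that is, \<open>k[V]/(E)\<close> is \<open>k \<otimes> \<int>[V]/(E)\<close>.\<close>

theorem base_change_pushout:
  fixes E :: "('v, int) mpoly set" and h :: "'k::comm_ring_1 \<Rightarrow> 'a" and T :: "('a, 'm) ring_scheme" and V :: "'v set"
  defines "R \<equiv> coord_ring V (base_change E :: ('v, 'k) mpoly set)"
  assumes E: "E \<subseteq> carrier (mpoly_ring V)" and T: "cring T"
    and g: "g \<in> ring_hom (coord_ring V E) T" and h: "h \<in> ring_hom type_ring T"
  shows "\<exists>!f. f \<in> ring_hom R T \<inter> extensional (carrier R)
    \<and> (\<forall>c. f (cls V (base_change E) (Const c)) = h c)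
    \<and> (\<forall>p \<in> carrier (mpoly_ring V). f (cls V (base_change E) (Poly_Mapping.map of_int p)) = g (cls V E p))"
proof -
  interpret T: cring T by (rule T)
  note E' = base_change_closed[OF E]
  define a where "a v = (if v \<in> V then g (cls V E (Var v)) else \<one>\<^bsub>T\<^esub>)" for v
  interpret K: evaluation T h a
    using ring_hom_closed[OF g] by unfold_locales (auto simp: h a_def cls_closed Var_closed)
  interpret Z: evaluation T "\<lambda>z::int. h (of_int z)" a
    by (rule K.evaluation_int)
  have gC: "g (cls V E (Const z)) = h (of_int z)" for z
  proof -
    interpret G: ring_hom_cring "type_ring :: int ring" T "\<lambda>z. g (cls V E (Const z))"
      using ring_hom_trans[OF cls_Const_ring_hom[OF E] g] cring_type_ring T
      by (simp add: ring_hom_cring_def ring_hom_cring_axioms_def comp_def)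
    interpret H: ring_hom_cring "type_ring :: int ring" T "\<lambda>z. h (of_int z)"
      using cring_type_ring T Z.h by (simp add: ring_hom_cring_def ring_hom_cring_axioms_def)
    show ?thesis
    proof (induction z rule: int_induct[of _ 0])
      case base
      then show ?case using G.hom_zero H.hom_zero by simp
    next
      case (step1 i)
      then show ?case using G.hom_add[of i 1] H.hom_add[of i 1] G.hom_one H.hom_one by simp
    next
      case (step2 i)
      have eq: "i = (i - 1) + 1" by simp
      have "g (cls V E (Const i)) = g (cls V E (Const (i - 1))) \<oplus>\<^bsub>T\<^esub> \<one>\<^bsub>T\<^esub>"
        using G.hom_add[of "i - 1" 1] G.hom_one by simp
      moreover have "h (of_int i) = h (of_int (i - 1)) \<oplus>\<^bsub>T\<^esub> \<one>\<^bsub>T\<^esub>"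
        using H.hom_add[of "i - 1" 1] H.hom_one by simp
      ultimately show ?case using step2 G.hom_closed[of "i - 1"] H.hom_closed[of "i - 1"]
        by (metis T.add.right_cancel T.one_closed UNIV_I type_ring_simps(1))
    qed
  qed
  have gZ: "g (cls V E p) = Z.ev p" if "p \<in> carrier (mpoly_ring V)" for p
    using that by (intro Z.factor_ev[OF E g]) (auto simp: gC a_def)
  have van: "K.ev e = \<zero>\<^bsub>T\<^esub>" if "e \<in> base_change E" for e
  proof -
    from that obtain e0 where e0: "e0 \<in> E" "e = Poly_Mapping.map of_int e0" by (auto simp: base_change_def)
    have "Z.ev e0 = \<zero>\<^bsub>T\<^esub>" using e0 by (intro Z.factor_zero[OF E g]) (auto simp: gC a_def)
    then show ?thesis using e0 K.ev_of_int[of e0] by simp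
  qed
  have map_closed: "Poly_Mapping.map of_int p \<in> carrier (mpoly_ring V :: ('v, 'k) mpoly ring)" 
    if "p \<in> carrier (mpoly_ring V)" for p
    using base_change_closed[of "{p}" V] that by (auto simp: base_change_def)
  have mapVar: "Poly_Mapping.map of_int (Var v) = (Var v :: ('v, 'k) mpoly)" for v
    by (simp add: Var_def)
  show ?thesis
  proof (rule ex_ex1I)
    from K.factor_ex[OF E' van] obtain f where f: "f \<in> ring_hom R T"
      "\<And>p. p \<in> carrier (mpoly_ring V) \<Longrightarrow> f (cls V (base_change E) p) = K.ev p"
      unfolding R_def by blast
    have R: "ring R" unfolding R_def by (rule cring.axioms(1)[OF cring_coord_ring[OF E']])
    have r: "restrict f (carrier R) \<in> ring_hom R T"
      using ring.ring_hom_restrict[OF R f(1), of "restrict f (carrier R)"] by simp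
    have cl: "cls V (base_change E) p \<in> carrier R" if "p \<in> carrier (mpoly_ring V)" for p
      unfolding R_def by (rule cls_closed[OF that])
    show "\<exists>f. f \<in> ring_hom R T \<inter> extensional (carrier R)
      \<and> (\<forall>c. f (cls V (base_change E) (Const c)) = h c)
      \<and> (\<forall>p \<in> carrier (mpoly_ring V). f (cls V (base_change E) (Poly_Mapping.map of_int p)) = g (cls V E p))"
      using r cl f(2) map_closed
      by (intro exI[of _ "restrict f (carrier R)"]) (auto simp: Const_closed K.ev_Const gZ K.ev_of_int)
  next
    fix f1 f2
    assume f1: "f1 \<in> ring_hom R T \<inter> extensional (carrier R)
      \<and> (\<forall>c. f1 (cls V (base_change E) (Const c)) = h c)
      \<and> (\<forall>p \<in> carrier (mpoly_ring V). f1 (cls V (base_change E) (Poly_Mapping.map of_int p)) = g (cls V E p))"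
    assume f2: "f2 \<in> ring_hom R T \<inter> extensional (carrier R)
      \<and> (\<forall>c. f2 (cls V (base_change E) (Const c)) = h c)
      \<and> (\<forall>p \<in> carrier (mpoly_ring V). f2 (cls V (base_change E) (Poly_Mapping.map of_int p)) = g (cls V E p))"
    have V1: "f1 (cls V (base_change E) (Var v)) = a v" "f2 (cls V (base_change E) (Var v)) = a v" if "v \<in> V" for v
    proof -
      have "Var v \<in> carrier (mpoly_ring V :: ('v, int) mpoly ring)" using that by (rule Var_closed)
      then show "f1 (cls V (base_change E) (Var v)) = a v" "f2 (cls V (base_change E) (Var v)) = a v"
        using f1 f2 that by (metis mapVar a_def)+
    qed
    have "f1 (cls V (base_change E) p) = K.ev p" "f2 (cls V (base_change E) p) = K.ev p" if "p \<in> carrier (mpoly_ring V)" for p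
      using f1 f2 V1 that unfolding R_def by (auto intro!: K.factor_ev[OF E'])
    then have "f1 X = f2 X" if "X \<in> carrier R" for X
      using that unfolding R_def by (metis coord_ring_cases)
    then show "f1 = f2" using f1 f2 extensionalityI[of f1 "carrier R" f2] by blast
  qed
qed


section \<open>Based algebras\<close>

text \<open>The pair \<open>(A, \<phi>)\<close> is an algebra over \<open>T\<close> with a module isomorphism \<open>\<phi>\<close> onto \<open>T\<^sup>n\<close>.\<close>

definition based_algebra ::
  "nat \<Rightarrow> ('t, 'm) ring_scheme \<Rightarrow> ('t, 'a, 'p) module_scheme \<Rightarrow> ('a \<Rightarrow> nat \<Rightarrow> 't) \<Rightarrow> bool" where
  "based_algebra n T A \<phi> \<longleftrightarrow> algebra T A \<and> bij_betw \<phi> (carrier A) ({..<n} \<rightarrow>\<^sub>E carrier T)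
     \<and> (\<forall>x\<in>carrier A. \<forall>y\<in>carrier A. \<forall>i<n. \<phi> (x \<oplus>\<^bsub>A\<^esub> y) i = \<phi> x i \<oplus>\<^bsub>T\<^esub> \<phi> y i)
     \<and> (\<forall>t\<in>carrier T. \<forall>x\<in>carrier A. \<forall>i<n. \<phi> (t \<odot>\<^bsub>A\<^esub> x) i = t \<otimes>\<^bsub>T\<^esub> \<phi> x i)"

definition based_iso ::
  "('t, 'm) ring_scheme \<Rightarrow> ('t, 'a, 'p) module_scheme \<Rightarrow> ('a \<Rightarrow> nat \<Rightarrow> 't)
    \<Rightarrow> ('t, 'b, 'q) module_scheme \<Rightarrow> ('b \<Rightarrow> nat \<Rightarrow> 't) \<Rightarrow> bool" where
  "based_iso T A \<phi> A' \<phi>' \<longleftrightarrow> (\<exists>\<alpha> \<in> ring_iso A A'.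
     (\<forall>t\<in>carrier T. \<forall>x\<in>carrier A. \<alpha> (t \<odot>\<^bsub>A\<^esub> x) = t \<odot>\<^bsub>A'\<^esub> \<alpha> x)
     \<and> (\<forall>x\<in>carrier A. \<phi>' (\<alpha> x) = \<phi> x))"

text \<open>\<open>(A', \<phi>')\<close> over \<open>T'\<close> is the pullback of \<open>(A, \<phi>)\<close> along \<open>f : T \<rightarrow> T'\<close>: the map \<open>A \<rightarrow> A'\<close>
  below carries basis to basis, so that it induces an isomorphism \<open>T' \<otimes>\<^sub>T A \<rightarrow> A'\<close>.\<close>

definition is_pullback ::
  "nat \<Rightarrow> ('t \<Rightarrow> 's) \<Rightarrow> ('t, 'm) ring_scheme \<Rightarrow> ('t, 'a, 'p) module_scheme \<Rightarrow> ('a \<Rightarrow> nat \<Rightarrow> 't)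
    \<Rightarrow> ('s, 'b, 'q) module_scheme \<Rightarrow> ('b \<Rightarrow> nat \<Rightarrow> 's) \<Rightarrow> bool" where
  "is_pullback n f T A \<phi> A' \<phi>' \<longleftrightarrow> (\<exists>g \<in> ring_hom A A'.
     (\<forall>t\<in>carrier T. \<forall>x\<in>carrier A. g (t \<odot>\<^bsub>A\<^esub> x) = f t \<odot>\<^bsub>A'\<^esub> g x)
     \<and> (\<forall>x\<in>carrier A. \<forall>i<n. \<phi>' (g x) i = f (\<phi> x i)))"

definition unit_vec :: "nat \<Rightarrow> ('t, 'm) ring_scheme \<Rightarrow> nat \<Rightarrow> nat \<Rightarrow> 't" where
  "unit_vec n T i = (\<lambda>j\<in>{..<n}. if j = i then \<one>\<^bsub>T\<^esub> else \<zero>\<^bsub>T\<^esub>)"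

context cring begin

lemma S_closed: "(\<And>i. i < n \<Longrightarrow> F i \<in> carrier R) \<Longrightarrow> (\<Oplus>i\<in>{..<n::nat}. F i) \<in> carrier R"
  by (rule finsum_closed) auto

lemma S_cong: "(\<And>i. i < n \<Longrightarrow> F i = G i) \<Longrightarrow> (\<And>i. i < n \<Longrightarrow> G i \<in> carrier R) \<Longrightarrow>
   (\<Oplus>i\<in>{..<n::nat}. F i) = (\<Oplus>i\<in>{..<n}. G i)"
  by (rule finsum_cong') auto

lemma S_swap:
  assumes "\<And>i j. i < n \<Longrightarrow> j < k \<Longrightarrow> F i j \<in> carrier R"
  shows "(\<Oplus>i\<in>{..<n::nat}. \<Oplus>j\<in>{..<k::nat}. F i j) = (\<Oplus>j\<in>{..<k}. \<Oplus>i\<in>{..<n}. F i j)"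
  using assms
proof (induction n)
  case 0
  then show ?case by simp
next
  case (Suc n)
  have "(\<Oplus>j\<in>{..<k}. \<Oplus>i\<in>{..<Suc n}. F i j) = (\<Oplus>j\<in>{..<k}. F n j \<oplus> (\<Oplus>i\<in>{..<n}. F i j))"
    using Suc.prems by (intro S_cong) (auto simp: lessThan_Suc intro!: S_closed)
  also have "\<dots> = (\<Oplus>j\<in>{..<k}. F n j) \<oplus> (\<Oplus>j\<in>{..<k}. \<Oplus>i\<in>{..<n}. F i j)"
    using Suc.prems by (intro finsum_addf) (auto intro!: S_closed)
  also have "\<dots> = (\<Oplus>i\<in>{..<Suc n}. \<Oplus>j\<in>{..<k}. F i j)"
    using Suc by (auto simp: lessThan_Suc intro!: S_closed)
  finally show ?case ..
qed

lemma S_rdistr: "a \<in> carrier R \<Longrightarrow> (\<And>i. i < n \<Longrightarrow> F i \<in> carrier R) \<Longrightarrow>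
   a \<otimes> (\<Oplus>i\<in>{..<n::nat}. F i) = (\<Oplus>i\<in>{..<n}. a \<otimes> F i)"
  by (rule finsum_rdistr) auto

lemma S_ldistr: "a \<in> carrier R \<Longrightarrow> (\<And>i. i < n \<Longrightarrow> F i \<in> carrier R) \<Longrightarrow>
   (\<Oplus>i\<in>{..<n::nat}. F i) \<otimes> a = (\<Oplus>i\<in>{..<n}. F i \<otimes> a)"
  by (rule finsum_ldistr) auto

lemma S_add: "(\<And>i. i < n \<Longrightarrow> F i \<in> carrier R) \<Longrightarrow> (\<And>i. i < n \<Longrightarrow> G i \<in> carrier R) \<Longrightarrow>
   (\<Oplus>i\<in>{..<n::nat}. F i \<oplus> G i) = (\<Oplus>i\<in>{..<n}. F i) \<oplus> (\<Oplus>i\<in>{..<n}. G i)"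
  by (rule finsum_addf) auto

lemma S_delta:
  assumes "k < n" "\<And>i. i < n \<Longrightarrow> F i \<in> carrier R"
  shows "(\<Oplus>i\<in>{..<n::nat}. (if i = k then \<one> else \<zero>) \<otimes> F i) = F k"
proof -
  have "(\<Oplus>i\<in>{..<n}. (if i = k then \<one> else \<zero>) \<otimes> F i) = (\<Oplus>i\<in>{..<n}. if k = i then F i else \<zero>)"
    using assms by (intro S_cong) auto
  also have "\<dots> = F k" using assms by (intro finsum_singleton) auto
  finally show ?thesis .
qed

end


subsection \<open>Structure constants\<close>

definition basis_elt :: "nat \<Rightarrow> ('t, 'm) ring_scheme \<Rightarrow> ('t, 'a, 'p) module_scheme \<Rightarrow> ('a \<Rightarrow> nat \<Rightarrow> 't) \<Rightarrow> nat \<Rightarrow> 'a" where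
  "basis_elt n T A \<phi> i = inv_into (carrier A) \<phi> (unit_vec n T i)"

definition struct_const :: "nat \<Rightarrow> ('t, 'm) ring_scheme \<Rightarrow> ('t, 'a, 'p) module_scheme \<Rightarrow> ('a \<Rightarrow> nat \<Rightarrow> 't) \<Rightarrow> nat \<Rightarrow> nat \<Rightarrow> nat \<Rightarrow> 't" where
  "struct_const n T A \<phi> i j = \<phi> (basis_elt n T A \<phi> i \<otimes>\<^bsub>A\<^esub> basis_elt n T A \<phi> j)"

definition is_table :: "nat \<Rightarrow> ('t, 'm) ring_scheme \<Rightarrow> (nat \<Rightarrow> nat \<Rightarrow> nat \<Rightarrow> 't) \<Rightarrow> (nat \<Rightarrow> 't) \<Rightarrow> bool" where
  "is_table n T c u \<longleftrightarrow>
     (\<forall>i<n. \<forall>j<n. \<forall>l<n. c i j l \<in> carrier T) \<and> (\<forall>i<n. u i \<in> carrier T)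
     \<and> (\<forall>i<n. \<forall>j<n. \<forall>l<n. c i j l = c j i l)
     \<and> (\<forall>i<n. \<forall>j<n. \<forall>l<n. \<forall>p<n.
         (\<Oplus>\<^bsub>T\<^esub>m\<in>{..<n}. c i j m \<otimes>\<^bsub>T\<^esub> c m l p) = (\<Oplus>\<^bsub>T\<^esub>m\<in>{..<n}. c j l m \<otimes>\<^bsub>T\<^esub> c i m p))
     \<and> (\<forall>j<n. \<forall>l<n. (\<Oplus>\<^bsub>T\<^esub>i\<in>{..<n}. u i \<otimes>\<^bsub>T\<^esub> c i j l) = (if j = l then \<one>\<^bsub>T\<^esub> else \<zero>\<^bsub>T\<^esub>))"

lemma is_tableD:
  assumes "is_table n T c u"
  shows "\<And>i j l. i < n \<Longrightarrow> j < n \<Longrightarrow> l < n \<Longrightarrow> c i j l \<in> carrier T"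
    and "\<And>i. i < n \<Longrightarrow> u i \<in> carrier T"
    and "\<And>i j l. i < n \<Longrightarrow> j < n \<Longrightarrow> l < n \<Longrightarrow> c i j l = c j i l"
    and "\<And>i j l p. i < n \<Longrightarrow> j < n \<Longrightarrow> l < n \<Longrightarrow> p < n \<Longrightarrow>
         (\<Oplus>\<^bsub>T\<^esub>m\<in>{..<n}. c i j m \<otimes>\<^bsub>T\<^esub> c m l p) = (\<Oplus>\<^bsub>T\<^esub>m\<in>{..<n}. c j l m \<otimes>\<^bsub>T\<^esub> c i m p)"
    and "\<And>j l. j < n \<Longrightarrow> l < n \<Longrightarrow> (\<Oplus>\<^bsub>T\<^esub>i\<in>{..<n}. u i \<otimes>\<^bsub>T\<^esub> c i j l) = (if j = l then \<one>\<^bsub>T\<^esub> else \<zero>\<^bsub>T\<^esub>)"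
proof -
  note t = assms[unfolded is_table_def]
  show "\<And>i j l. i < n \<Longrightarrow> j < n \<Longrightarrow> l < n \<Longrightarrow> c i j l \<in> carrier T"
    using t[THEN conjunct1] by blast
  show "\<And>i. i < n \<Longrightarrow> u i \<in> carrier T"
    using t[THEN conjunct2, THEN conjunct1] by blast
  show "\<And>i j l. i < n \<Longrightarrow> j < n \<Longrightarrow> l < n \<Longrightarrow> c i j l = c j i l"
    using t[THEN conjunct2, THEN conjunct2, THEN conjunct1] by blast
  show "\<And>i j l p. i < n \<Longrightarrow> j < n \<Longrightarrow> l < n \<Longrightarrow> p < n \<Longrightarrow>
         (\<Oplus>\<^bsub>T\<^esub>m\<in>{..<n}. c i j m \<otimes>\<^bsub>T\<^esub> c m l p) = (\<Oplus>\<^bsub>T\<^esub>m\<in>{..<n}. c j l m \<otimes>\<^bsub>T\<^esub> c i m p)"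
    using t[THEN conjunct2, THEN conjunct2, THEN conjunct2, THEN conjunct1] by simp
  show "\<And>j l. j < n \<Longrightarrow> l < n \<Longrightarrow> (\<Oplus>\<^bsub>T\<^esub>i\<in>{..<n}. u i \<otimes>\<^bsub>T\<^esub> c i j l) = (if j = l then \<one>\<^bsub>T\<^esub> else \<zero>\<^bsub>T\<^esub>)"
    using t[THEN conjunct2, THEN conjunct2, THEN conjunct2, THEN conjunct2] by simp
qed

locale based =
  fixes n :: nat and T :: "('t, 'm) ring_scheme" and A :: "('t, 'a, 'p) module_scheme" and \<phi>
  assumes based: "based_algebra n T A \<phi>"
begin

sublocale alg: algebra T A
  using based by (simp add: based_algebra_def)

lemma bij: "bij_betw \<phi> (carrier A) ({..<n} \<rightarrow>\<^sub>E carrier T)"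
  using based by (simp add: based_algebra_def)

lemma phi_closed: "x \<in> carrier A \<Longrightarrow> i < n \<Longrightarrow> \<phi> x i \<in> carrier T"
  using bij by (auto simp: bij_betw_def PiE_iff)

lemma phi_add: "x \<in> carrier A \<Longrightarrow> y \<in> carrier A \<Longrightarrow> i < n \<Longrightarrow> \<phi> (x \<oplus>\<^bsub>A\<^esub> y) i = \<phi> x i \<oplus>\<^bsub>T\<^esub> \<phi> y i"
  using based by (simp add: based_algebra_def)

lemma phi_smult: "t \<in> carrier T \<Longrightarrow> x \<in> carrier A \<Longrightarrow> i < n \<Longrightarrow> \<phi> (t \<odot>\<^bsub>A\<^esub> x) i = t \<otimes>\<^bsub>T\<^esub> \<phi> x i"
  using based by (simp add: based_algebra_def)

lemma phi_zero: "i < n \<Longrightarrow> \<phi> \<zero>\<^bsub>A\<^esub> i = \<zero>\<^bsub>T\<^esub>"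
  using phi_smult[of "\<zero>\<^bsub>T\<^esub>" "\<zero>\<^bsub>A\<^esub>" i] phi_closed[of "\<zero>\<^bsub>A\<^esub>" i] by simp

lemma phi_eqI:
  assumes "x \<in> carrier A" "y \<in> carrier A" "\<And>i. i < n \<Longrightarrow> \<phi> x i = \<phi> y i"
  shows "x = y"
proof -
  have "\<phi> x \<in> {..<n} \<rightarrow>\<^sub>E carrier T" "\<phi> y \<in> {..<n} \<rightarrow>\<^sub>E carrier T"
    using bij assms by (auto simp: bij_betw_def)
  then have "\<phi> x = \<phi> y" using assms(3) by (intro PiE_ext) auto
  then show ?thesis using bij assms by (auto simp: bij_betw_def inj_on_def)
qed

definition unphi :: "(nat \<Rightarrow> 't) \<Rightarrow> 'a" where
  "unphi v = inv_into (carrier A) \<phi> (restrict v {..<n})"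

lemma unphi:
  assumes "\<And>i. i < n \<Longrightarrow> v i \<in> carrier T"
  shows "unphi v \<in> carrier A" "\<And>i. i < n \<Longrightarrow> \<phi> (unphi v) i = v i"
proof -
  have "restrict v {..<n} \<in> \<phi> ` carrier A" using assms bij by (auto simp: bij_betw_def)
  then show "unphi v \<in> carrier A" "\<And>i. i < n \<Longrightarrow> \<phi> (unphi v) i = v i"
    unfolding unphi_def by (simp_all add: inv_into_into f_inv_into_f)
qed

abbreviation "b \<equiv> basis_elt n T A \<phi>"
abbreviation "c \<equiv> struct_const n T A \<phi>"

lemma b_closed: "b i \<in> carrier A" and phi_b: "j < n \<Longrightarrow> \<phi> (b i) j = (if j = i then \<one>\<^bsub>T\<^esub> else \<zero>\<^bsub>T\<^esub>)"
proof -
  have "b i = unphi (\<lambda>j. if j = i then \<one>\<^bsub>T\<^esub> else \<zero>\<^bsub>T\<^esub>)"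
    by (simp add: basis_elt_def unphi_def unit_vec_def)
  then show "b i \<in> carrier A" "j < n \<Longrightarrow> \<phi> (b i) j = (if j = i then \<one>\<^bsub>T\<^esub> else \<zero>\<^bsub>T\<^esub>)"
    using unphi[of "\<lambda>j. if j = i then \<one>\<^bsub>T\<^esub> else \<zero>\<^bsub>T\<^esub>"] by auto
qed

lemma phi_finsum:
  assumes "finite I" "\<And>i. i \<in> I \<Longrightarrow> F i \<in> carrier A" "l < n"
  shows "\<phi> (finsum A F I) l = finsum T (\<lambda>i. \<phi> (F i) l) I"
  using assms(1,2)
proof (induction I rule: finite_induct)
  case empty
  then show ?case by (simp add: phi_zero assms(3))
next
  case (insert i I)
  have "finsum A F (insert i I) = F i \<oplus>\<^bsub>A\<^esub> finsum A F I"
    using insert by (intro alg.M.finsum_insert) auto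
  moreover have "finsum T (\<lambda>i. \<phi> (F i) l) (insert i I) = \<phi> (F i) l \<oplus>\<^bsub>T\<^esub> finsum T (\<lambda>i. \<phi> (F i) l) I"
    using insert assms(3) phi_closed by (intro alg.R.finsum_insert) auto
  moreover have "finsum A F I \<in> carrier A" using insert by (intro alg.M.finsum_closed) auto
  ultimately show ?case using insert assms(3) by (simp add: phi_add)
qed

lemma expand:
  assumes x: "x \<in> carrier A"
  shows "x = (\<Oplus>\<^bsub>A\<^esub>i\<in>{..<n}. \<phi> x i \<odot>\<^bsub>A\<^esub> b i)"
proof (rule phi_eqI[OF x])
  have cl: "\<phi> x i \<odot>\<^bsub>A\<^esub> b i \<in> carrier A" if "i < n" for i
    using that x by (simp add: phi_closed b_closed)
  then show "(\<Oplus>\<^bsub>A\<^esub>i\<in>{..<n}. \<phi> x i \<odot>\<^bsub>A\<^esub> b i) \<in> carrier A" by (intro alg.M.finsum_closed) auto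
  fix l assume l: "l < n"
  have "\<phi> (\<Oplus>\<^bsub>A\<^esub>i\<in>{..<n}. \<phi> x i \<odot>\<^bsub>A\<^esub> b i) l = (\<Oplus>\<^bsub>T\<^esub>i\<in>{..<n}. (if i = l then \<one>\<^bsub>T\<^esub> else \<zero>\<^bsub>T\<^esub>) \<otimes>\<^bsub>T\<^esub> \<phi> x i)"
    using cl l x by (subst phi_finsum)
      (auto intro!: alg.R.S_cong simp: phi_smult phi_closed b_closed phi_b)
  also have "\<dots> = \<phi> x l" using l x phi_closed by (intro alg.R.S_delta) auto
  finally show "\<phi> x l = \<phi> (\<Oplus>\<^bsub>A\<^esub>i\<in>{..<n}. \<phi> x i \<odot>\<^bsub>A\<^esub> b i) l" ..
qed

lemma phi_mult_left:
  assumes x: "x \<in> carrier A" and y: "y \<in> carrier A" and l: "l < n"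
  shows "\<phi> (x \<otimes>\<^bsub>A\<^esub> y) l = (\<Oplus>\<^bsub>T\<^esub>i\<in>{..<n}. \<phi> x i \<otimes>\<^bsub>T\<^esub> \<phi> (b i \<otimes>\<^bsub>A\<^esub> y) l)"
proof -
  have cl: "\<phi> x i \<odot>\<^bsub>A\<^esub> b i \<in> carrier A" if "i < n" for i
    using that x by (simp add: phi_closed b_closed)
  have "x \<otimes>\<^bsub>A\<^esub> y = (\<Oplus>\<^bsub>A\<^esub>i\<in>{..<n}. \<phi> x i \<odot>\<^bsub>A\<^esub> b i) \<otimes>\<^bsub>A\<^esub> y" using expand[OF x] by simp
  also have "\<dots> = (\<Oplus>\<^bsub>A\<^esub>i\<in>{..<n}. (\<phi> x i \<odot>\<^bsub>A\<^esub> b i) \<otimes>\<^bsub>A\<^esub> y)" using cl y by (intro alg.S_ldistr) auto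
  finally have "\<phi> (x \<otimes>\<^bsub>A\<^esub> y) l = \<phi> (\<Oplus>\<^bsub>A\<^esub>i\<in>{..<n}. (\<phi> x i \<odot>\<^bsub>A\<^esub> b i) \<otimes>\<^bsub>A\<^esub> y) l" by simp
  also have "\<dots> = (\<Oplus>\<^bsub>T\<^esub>i\<in>{..<n}. \<phi> ((\<phi> x i \<odot>\<^bsub>A\<^esub> b i) \<otimes>\<^bsub>A\<^esub> y) l)"
    using cl y l by (intro phi_finsum) auto
  also have "\<dots> = (\<Oplus>\<^bsub>T\<^esub>i\<in>{..<n}. \<phi> x i \<otimes>\<^bsub>T\<^esub> \<phi> (b i \<otimes>\<^bsub>A\<^esub> y) l)"
    using x y l by (intro alg.R.S_cong) (auto simp: alg.smult_assoc2 phi_smult phi_closed b_closed)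
  finally show ?thesis .
qed

lemma c_closed: "l < n \<Longrightarrow> c i j l \<in> carrier T"
  unfolding struct_const_def by (intro phi_closed alg.m_closed b_closed)

lemma c_comm: "c i j = c j i"
  unfolding struct_const_def using alg.m_comm[OF b_closed b_closed] by simp

lemma phi_mult:
  assumes x: "x \<in> carrier A" and y: "y \<in> carrier A" and l: "l < n"
  shows "\<phi> (x \<otimes>\<^bsub>A\<^esub> y) l = (\<Oplus>\<^bsub>T\<^esub>i\<in>{..<n}. \<Oplus>\<^bsub>T\<^esub>j\<in>{..<n}. \<phi> x i \<otimes>\<^bsub>T\<^esub> \<phi> y j \<otimes>\<^bsub>T\<^esub> c i j l)"
proof -
  have 1: "\<phi> (b i \<otimes>\<^bsub>A\<^esub> y) l = (\<Oplus>\<^bsub>T\<^esub>j\<in>{..<n}. \<phi> y j \<otimes>\<^bsub>T\<^esub> c i j l)" for i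
    using phi_mult_left[OF y b_closed l, of i] alg.m_comm[OF b_closed y, of i] c_comm[of i]
      alg.m_comm[OF b_closed b_closed] by (simp add: struct_const_def)
  have "\<phi> (x \<otimes>\<^bsub>A\<^esub> y) l = (\<Oplus>\<^bsub>T\<^esub>i\<in>{..<n}. \<phi> x i \<otimes>\<^bsub>T\<^esub> \<phi> (b i \<otimes>\<^bsub>A\<^esub> y) l)"
    by (rule phi_mult_left[OF x y l])
  also have "\<dots> = (\<Oplus>\<^bsub>T\<^esub>i\<in>{..<n}. \<Oplus>\<^bsub>T\<^esub>j\<in>{..<n}. \<phi> x i \<otimes>\<^bsub>T\<^esub> \<phi> y j \<otimes>\<^bsub>T\<^esub> c i j l)"
  proof (rule alg.R.S_cong)
    fix i assume i: "i < n"
    show "\<phi> x i \<otimes>\<^bsub>T\<^esub> \<phi> (b i \<otimes>\<^bsub>A\<^esub> y) l = (\<Oplus>\<^bsub>T\<^esub>j\<in>{..<n}. \<phi> x i \<otimes>\<^bsub>T\<^esub> \<phi> y j \<otimes>\<^bsub>T\<^esub> c i j l)"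
      unfolding 1 using i x y l
      by (subst alg.R.S_rdistr) (auto intro!: alg.R.S_cong simp: alg.R.m_assoc phi_closed c_closed)
    show "(\<Oplus>\<^bsub>T\<^esub>j\<in>{..<n}. \<phi> x i \<otimes>\<^bsub>T\<^esub> \<phi> y j \<otimes>\<^bsub>T\<^esub> c i j l) \<in> carrier T"
      using i x y l by (auto intro!: alg.R.S_closed simp: phi_closed c_closed)
  qed
  finally show ?thesis .
qed

lemma is_table: "is_table n T c (\<phi> \<one>\<^bsub>A\<^esub>)"
  unfolding is_table_def
proof (intro conjI allI impI)
  fix i j l p assume "i < n" "j < n" "l < n" "p < n"
  have "(\<Oplus>\<^bsub>T\<^esub>m\<in>{..<n}. c i j m \<otimes>\<^bsub>T\<^esub> c m l p) = \<phi> ((b i \<otimes>\<^bsub>A\<^esub> b j) \<otimes>\<^bsub>A\<^esub> b l) p"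
    using phi_mult_left[of "b i \<otimes>\<^bsub>A\<^esub> b j" "b l" p] \<open>p < n\<close> by (simp add: b_closed struct_const_def)
  also have "(b i \<otimes>\<^bsub>A\<^esub> b j) \<otimes>\<^bsub>A\<^esub> b l = (b j \<otimes>\<^bsub>A\<^esub> b l) \<otimes>\<^bsub>A\<^esub> b i"
    using b_closed[of i] b_closed[of j] b_closed[of l] by (simp add: alg.m_ac)
  also have "\<phi> ((b j \<otimes>\<^bsub>A\<^esub> b l) \<otimes>\<^bsub>A\<^esub> b i) p = (\<Oplus>\<^bsub>T\<^esub>m\<in>{..<n}. c j l m \<otimes>\<^bsub>T\<^esub> c m i p)"
    using phi_mult_left[of "b j \<otimes>\<^bsub>A\<^esub> b l" "b i" p] \<open>p < n\<close> by (simp add: b_closed struct_const_def)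
  finally show "(\<Oplus>\<^bsub>T\<^esub>m\<in>{..<n}. c i j m \<otimes>\<^bsub>T\<^esub> c m l p) = (\<Oplus>\<^bsub>T\<^esub>m\<in>{..<n}. c j l m \<otimes>\<^bsub>T\<^esub> c i m p)"
    by (simp add: c_comm[of i])
next
  fix j l assume "j < n" "l < n"
  have "(\<Oplus>\<^bsub>T\<^esub>i\<in>{..<n}. \<phi> \<one>\<^bsub>A\<^esub> i \<otimes>\<^bsub>T\<^esub> c i j l) = \<phi> (\<one>\<^bsub>A\<^esub> \<otimes>\<^bsub>A\<^esub> b j) l"
    using phi_mult_left[of "\<one>\<^bsub>A\<^esub>" "b j" l] \<open>l < n\<close> by (simp add: b_closed struct_const_def)
  then show "(\<Oplus>\<^bsub>T\<^esub>i\<in>{..<n}. \<phi> \<one>\<^bsub>A\<^esub> i \<otimes>\<^bsub>T\<^esub> c i j l) = (if j = l then \<one>\<^bsub>T\<^esub> else \<zero>\<^bsub>T\<^esub>)"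
    using \<open>l < n\<close> by (simp add: b_closed phi_b)
qed (auto simp: c_closed phi_closed c_comm)

end

lemma pullback_iff:
  assumes "based_algebra n T A \<phi>" "based_algebra n T' A' \<phi>'" and f: "f \<in> ring_hom T T'"
  shows "is_pullback n f T A \<phi> A' \<phi>' \<longleftrightarrow>
    (\<forall>i<n. \<forall>j<n. \<forall>l<n. struct_const n T' A' \<phi>' i j l = f (struct_const n T A \<phi> i j l))
    \<and> (\<forall>i<n. \<phi>' \<one>\<^bsub>A'\<^esub> i = f (\<phi> \<one>\<^bsub>A\<^esub> i))" (is "_ \<longleftrightarrow> ?R")
proof -
  interpret X: based n T A \<phi> by (rule based.intro) fact
  interpret Y: based n T' A' \<phi>' by (rule based.intro) fact
  interpret F: ring_hom_cring T T' f
    using f X.alg.R.cring_axioms Y.alg.R.cring_axioms by (simp add: ring_hom_cring_def ring_hom_cring_axioms_def)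
  show ?thesis
  proof
    assume "is_pullback n f T A \<phi> A' \<phi>'"
    then obtain g where g: "g \<in> ring_hom A A'"
      and gphi: "\<And>x i. x \<in> carrier A \<Longrightarrow> i < n \<Longrightarrow> \<phi>' (g x) i = f (\<phi> x i)"
      unfolding is_pullback_def by blast
    have gb: "g (X.b i) = Y.b i" for i
      using ring_hom_closed[OF g X.b_closed]
      by (intro Y.phi_eqI) (auto simp: X.b_closed Y.b_closed gphi X.phi_b Y.phi_b)
    have "Y.c i j l = f (X.c i j l)" if "l < n" for i j l
      using ring_hom_mult[OF g X.b_closed X.b_closed, of i j] gphi[of "X.b i \<otimes>\<^bsub>A\<^esub> X.b j" l] that
      by (simp add: struct_const_def gb X.b_closed)
    moreover have "\<phi>' \<one>\<^bsub>A'\<^esub> i = f (\<phi> \<one>\<^bsub>A\<^esub> i)" if "i < n" for i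
      using ring_hom_one[OF g] gphi[of "\<one>\<^bsub>A\<^esub>" i] that by simp
    ultimately show ?R by blast
  next
    assume R: ?R
    define g where "g x = Y.unphi (\<lambda>i. f (\<phi> x i))" for x
    have g_closed: "g x \<in> carrier A'" if "x \<in> carrier A" for x
      unfolding g_def using that by (intro Y.unphi) (simp add: X.phi_closed)
    have gphi: "\<phi>' (g x) i = f (\<phi> x i)" if "x \<in> carrier A" "i < n" for x i
      unfolding g_def using that by (intro Y.unphi) (simp_all add: X.phi_closed)
    have gmult: "g (x \<otimes>\<^bsub>A\<^esub> y) = g x \<otimes>\<^bsub>A'\<^esub> g y" if xy: "x \<in> carrier A" "y \<in> carrier A" for x y
    proof (rule Y.phi_eqI)
      fix l assume l: "l < n"
      have "\<phi>' (g (x \<otimes>\<^bsub>A\<^esub> y)) l = f (\<Oplus>\<^bsub>T\<^esub>i\<in>{..<n}. \<Oplus>\<^bsub>T\<^esub>j\<in>{..<n}. \<phi> x i \<otimes>\<^bsub>T\<^esub> \<phi> y j \<otimes>\<^bsub>T\<^esub> X.c i j l)"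
        using xy l by (simp add: gphi X.phi_mult)
      also have "\<dots> = (\<Oplus>\<^bsub>T'\<^esub>i\<in>{..<n}. f (\<Oplus>\<^bsub>T\<^esub>j\<in>{..<n}. \<phi> x i \<otimes>\<^bsub>T\<^esub> \<phi> y j \<otimes>\<^bsub>T\<^esub> X.c i j l))"
        using xy l by (subst F.hom_finsum) (auto simp: comp_def X.phi_closed X.c_closed intro!: X.alg.R.S_closed)
      also have "\<dots> = (\<Oplus>\<^bsub>T'\<^esub>i\<in>{..<n}. \<Oplus>\<^bsub>T'\<^esub>j\<in>{..<n}. f (\<phi> x i) \<otimes>\<^bsub>T'\<^esub> f (\<phi> y j) \<otimes>\<^bsub>T'\<^esub> Y.c i j l)"
      proof (rule Y.alg.R.S_cong)
        fix i assume i: "i < n"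
        have "f (\<Oplus>\<^bsub>T\<^esub>j\<in>{..<n}. \<phi> x i \<otimes>\<^bsub>T\<^esub> \<phi> y j \<otimes>\<^bsub>T\<^esub> X.c i j l)
          = (\<Oplus>\<^bsub>T'\<^esub>j\<in>{..<n}. f (\<phi> x i \<otimes>\<^bsub>T\<^esub> \<phi> y j \<otimes>\<^bsub>T\<^esub> X.c i j l))"
          using xy l i by (subst F.hom_finsum) (auto simp: comp_def X.phi_closed X.c_closed)
        also have "\<dots> = (\<Oplus>\<^bsub>T'\<^esub>j\<in>{..<n}. f (\<phi> x i) \<otimes>\<^bsub>T'\<^esub> f (\<phi> y j) \<otimes>\<^bsub>T'\<^esub> Y.c i j l)"
          using xy l i R by (intro Y.alg.R.S_cong) (auto simp: X.phi_closed X.c_closed)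
        finally show "f (\<Oplus>\<^bsub>T\<^esub>j\<in>{..<n}. \<phi> x i \<otimes>\<^bsub>T\<^esub> \<phi> y j \<otimes>\<^bsub>T\<^esub> X.c i j l)
          = (\<Oplus>\<^bsub>T'\<^esub>j\<in>{..<n}. f (\<phi> x i) \<otimes>\<^bsub>T'\<^esub> f (\<phi> y j) \<otimes>\<^bsub>T'\<^esub> Y.c i j l)" .
        show "(\<Oplus>\<^bsub>T'\<^esub>j\<in>{..<n}. f (\<phi> x i) \<otimes>\<^bsub>T'\<^esub> f (\<phi> y j) \<otimes>\<^bsub>T'\<^esub> Y.c i j l) \<in> carrier T'"
          using xy l i by (intro Y.alg.R.S_closed) (auto simp: X.phi_closed Y.c_closed)
      qed
      also have "\<dots> = (\<Oplus>\<^bsub>T'\<^esub>i\<in>{..<n}. \<Oplus>\<^bsub>T'\<^esub>j\<in>{..<n}. \<phi>' (g x) i \<otimes>\<^bsub>T'\<^esub> \<phi>' (g y) j \<otimes>\<^bsub>T'\<^esub> Y.c i j l)"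
        using xy l by (auto intro!: Y.alg.R.S_cong Y.alg.R.S_closed simp: gphi X.phi_closed Y.c_closed)
      also have "\<dots> = \<phi>' (g x \<otimes>\<^bsub>A'\<^esub> g y) l"
        using xy l by (simp add: Y.phi_mult g_closed)
      finally show "\<phi>' (g (x \<otimes>\<^bsub>A\<^esub> y)) l = \<phi>' (g x \<otimes>\<^bsub>A'\<^esub> g y) l" .
    qed (use xy in \<open>auto simp: g_closed\<close>)
    have "g \<in> ring_hom A A'"
    proof (rule ring_hom_memI)
      fix x y assume xy: "x \<in> carrier A" "y \<in> carrier A"
      show "g (x \<oplus>\<^bsub>A\<^esub> y) = g x \<oplus>\<^bsub>A'\<^esub> g y"
        using xy by (intro Y.phi_eqI) (auto simp: g_closed gphi Y.phi_add X.phi_add X.phi_closed)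
      show "g (x \<otimes>\<^bsub>A\<^esub> y) = g x \<otimes>\<^bsub>A'\<^esub> g y" by (rule gmult[OF xy])
    next
      show "g \<one>\<^bsub>A\<^esub> = \<one>\<^bsub>A'\<^esub>"
        using R by (intro Y.phi_eqI) (auto simp: g_closed gphi)
    qed (auto simp: g_closed)
    moreover have "g (t \<odot>\<^bsub>A\<^esub> x) = f t \<odot>\<^bsub>A'\<^esub> g x" if "t \<in> carrier T" "x \<in> carrier A" for t x
      using that by (intro Y.phi_eqI) (auto simp: g_closed gphi Y.phi_smult X.phi_smult X.phi_closed)
    ultimately show "is_pullback n f T A \<phi> A' \<phi>'"
      unfolding is_pullback_def using gphi by blast
  qed
qed

lemma based_iso_iff:
  assumes X: "based_algebra n T A \<phi>" and Y: "based_algebra n T A' \<phi>'"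
  shows "based_iso T A \<phi> A' \<phi>' \<longleftrightarrow> is_pullback n (\<lambda>t. t) T A \<phi> A' \<phi>'"
proof -
  interpret X: based n T A \<phi> by (rule based.intro) fact
  interpret Y: based n T A' \<phi>' by (rule based.intro) fact
  show ?thesis
  proof
    assume "based_iso T A \<phi> A' \<phi>'"
    then show "is_pullback n (\<lambda>t. t) T A \<phi> A' \<phi>'"
      unfolding based_iso_def is_pullback_def ring_iso_def by fastforce
  next
    assume "is_pullback n (\<lambda>t. t) T A \<phi> A' \<phi>'"
    then obtain g where g: "g \<in> ring_hom A A'" 
      and sm: "\<And>t x. t \<in> carrier T \<Longrightarrow> x \<in> carrier A \<Longrightarrow> g (t \<odot>\<^bsub>A\<^esub> x) = t \<odot>\<^bsub>A'\<^esub> g x"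
      and gi: "\<And>x i. x \<in> carrier A \<Longrightarrow> i < n \<Longrightarrow> \<phi>' (g x) i = \<phi> x i"
      unfolding is_pullback_def by blast
    have g': "\<phi>' (g x) = \<phi> x" if x: "x \<in> carrier A" for x
    proof (rule PiE_ext)
      show "\<phi>' (g x) \<in> {..<n} \<rightarrow>\<^sub>E carrier T" "\<phi> x \<in> {..<n} \<rightarrow>\<^sub>E carrier T"
        using X.bij Y.bij x ring_hom_closed[OF g x] by (auto simp: bij_betw_def)
    qed (use gi x in auto)
    have "inj_on g (carrier A)"
      using X.bij g' by (metis bij_betw_def inj_on_def)
    moreover have "g ` carrier A = carrier A'"
    proof
      show "g ` carrier A \<subseteq> carrier A'" using ring_hom_closed[OF g] by auto
      show "carrier A' \<subseteq> g ` carrier A"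
      proof
        fix y assume y: "y \<in> carrier A'"
        then have "\<phi>' y \<in> \<phi> ` carrier A" using X.bij Y.bij by (auto simp: bij_betw_def)
        then obtain x where x: "x \<in> carrier A" "\<phi>' y = \<phi> x" by blast
        have "y = g x" using y x g' ring_hom_closed[OF g x(1)] by (intro Y.phi_eqI) auto
        then show "y \<in> g ` carrier A" using x by blast
      qed
    qed
    ultimately have "g \<in> ring_iso A A'" using g by (simp add: ring_iso_def bij_betw_def)
    then show "based_iso T A \<phi> A' \<phi>'"
      unfolding based_iso_def using sm g' by blast
  qed
qed


subsection \<open>The based algebra with given structure constants\<close>

definition table_alg :: "nat \<Rightarrow> ('t, 'm) ring_scheme \<Rightarrow> (nat \<Rightarrow> nat \<Rightarrow> nat \<Rightarrow> 't) \<Rightarrow> (nat \<Rightarrow> 't) \<Rightarrow> ('t, nat \<Rightarrow> 't) module" where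
  "table_alg n T c u = \<lparr>carrier = {..<n} \<rightarrow>\<^sub>E carrier T,
     mult = (\<lambda>x y. \<lambda>l\<in>{..<n}. \<Oplus>\<^bsub>T\<^esub>i\<in>{..<n}. \<Oplus>\<^bsub>T\<^esub>j\<in>{..<n}. x i \<otimes>\<^bsub>T\<^esub> y j \<otimes>\<^bsub>T\<^esub> c i j l),
     one = restrict u {..<n}, zero = (\<lambda>l\<in>{..<n}. \<zero>\<^bsub>T\<^esub>),
     add = (\<lambda>x y. \<lambda>l\<in>{..<n}. x l \<oplus>\<^bsub>T\<^esub> y l), smult = (\<lambda>t x. \<lambda>l\<in>{..<n}. t \<otimes>\<^bsub>T\<^esub> x l)\<rparr>"

lemma algebra_table_alg:
  assumes T: "cring T" and tab: "is_table n T c u"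
  shows "algebra T (table_alg n T c u)"
proof -
  interpret cring T by (rule T)
  let ?A = "table_alg n T c u"
  note defs = table_alg_def
  note c = is_tableD(1)[OF tab] and u = is_tableD(2)[OF tab] and comm = is_tableD(3)[OF tab]
    and assoc = is_tableD(4)[OF tab] and unit = is_tableD(5)[OF tab]
  have cl: "x \<in> carrier ?A \<Longrightarrow> i < n \<Longrightarrow> x i \<in> carrier T" for x i
    by (auto simp: defs)
  have ext: "x = y" if "x \<in> carrier ?A" "y \<in> carrier ?A" "\<And>i. i < n \<Longrightarrow> x i = y i" for x y
    using that by (auto simp: defs intro: PiE_ext)
  have mul: "(x \<otimes>\<^bsub>?A\<^esub> y) l = (\<Oplus>\<^bsub>T\<^esub>i\<in>{..<n}. \<Oplus>\<^bsub>T\<^esub>j\<in>{..<n}. x i \<otimes>\<^bsub>T\<^esub> y j \<otimes>\<^bsub>T\<^esub> c i j l)" if "l < n" for x y l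
    using that by (simp add: defs)
  have add: "(x \<oplus>\<^bsub>?A\<^esub> y) l = x l \<oplus>\<^bsub>T\<^esub> y l" if "l < n" for x y l using that by (simp add: defs)
  have sm: "(t \<odot>\<^bsub>?A\<^esub> x) l = t \<otimes>\<^bsub>T\<^esub> x l" if "l < n" for t x l using that by (simp add: defs)
  have zer: "\<zero>\<^bsub>?A\<^esub> l = \<zero>\<^bsub>T\<^esub>" if "l < n" for l using that by (simp add: defs)
  have one: "\<one>\<^bsub>?A\<^esub> l = u l" if "l < n" for l using that by (simp add: defs)
  have mem: "restrict F {..<n} \<in> carrier ?A" if "\<And>i. i < n \<Longrightarrow> F i \<in> carrier T" for F
    using that by (auto simp: defs)
  have mulc: "x \<otimes>\<^bsub>?A\<^esub> y \<in> carrier ?A" if "x \<in> carrier ?A" "y \<in> carrier ?A" for x y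
  proof -
    have "x \<otimes>\<^bsub>?A\<^esub> y = restrict (\<lambda>l. \<Oplus>\<^bsub>T\<^esub>i\<in>{..<n}. \<Oplus>\<^bsub>T\<^esub>j\<in>{..<n}. x i \<otimes>\<^bsub>T\<^esub> y j \<otimes>\<^bsub>T\<^esub> c i j l) {..<n}"
      by (simp add: defs)
    then show ?thesis using that c by (auto intro!: mem S_closed simp: cl)
  qed
  have addc: "x \<oplus>\<^bsub>?A\<^esub> y \<in> carrier ?A" if "x \<in> carrier ?A" "y \<in> carrier ?A" for x y
  proof -
    have "x \<oplus>\<^bsub>?A\<^esub> y = restrict (\<lambda>l. x l \<oplus>\<^bsub>T\<^esub> y l) {..<n}" by (simp add: defs)
    then show ?thesis using that by (auto intro!: mem simp: cl)
  qed
  have smc: "t \<odot>\<^bsub>?A\<^esub> x \<in> carrier ?A" if "t \<in> carrier T" "x \<in> carrier ?A" for t x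
  proof -
    have "t \<odot>\<^bsub>?A\<^esub> x = restrict (\<lambda>l. t \<otimes>\<^bsub>T\<^esub> x l) {..<n}" by (simp add: defs)
    then show ?thesis using that by (auto intro!: mem simp: cl)
  qed
  have zc: "\<zero>\<^bsub>?A\<^esub> \<in> carrier ?A" using mem[of "\<lambda>_. \<zero>\<^bsub>T\<^esub>"] by (simp add: defs)
  have oc: "\<one>\<^bsub>?A\<^esub> \<in> carrier ?A" using mem[of u] u by (simp add: defs)
  note cls = mulc addc smc zc oc cl c
  have comm': "x \<otimes>\<^bsub>?A\<^esub> y = y \<otimes>\<^bsub>?A\<^esub> x" if xy: "x \<in> carrier ?A" "y \<in> carrier ?A" for x y
  proof (rule ext)
    fix l assume l: "l < n"
    have "(\<Oplus>\<^bsub>T\<^esub>i\<in>{..<n}. \<Oplus>\<^bsub>T\<^esub>j\<in>{..<n}. x i \<otimes>\<^bsub>T\<^esub> y j \<otimes>\<^bsub>T\<^esub> c i j l) = (\<Oplus>\<^bsub>T\<^esub>j\<in>{..<n}. \<Oplus>\<^bsub>T\<^esub>i\<in>{..<n}. x i \<otimes>\<^bsub>T\<^esub> y j \<otimes>\<^bsub>T\<^esub> c i j l)"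
      using xy l by (intro S_swap) (auto simp: cls)
    also have "\<dots> = (\<Oplus>\<^bsub>T\<^esub>j\<in>{..<n}. \<Oplus>\<^bsub>T\<^esub>i\<in>{..<n}. y j \<otimes>\<^bsub>T\<^esub> x i \<otimes>\<^bsub>T\<^esub> c j i l)"
    proof (intro S_cong)
      fix i j assume "i < n" "j < n"
      then show "x i \<otimes>\<^bsub>T\<^esub> y j \<otimes>\<^bsub>T\<^esub> c i j l = y j \<otimes>\<^bsub>T\<^esub> x i \<otimes>\<^bsub>T\<^esub> c j i l"
        using xy l comm[of i j l] m_comm[of "x i" "y j"] by (simp add: cls)
    qed (use xy l in \<open>auto simp: cls intro!: S_closed\<close>)
    finally show "(x \<otimes>\<^bsub>?A\<^esub> y) l = (y \<otimes>\<^bsub>?A\<^esub> x) l" by (simp add: mul l)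
  qed (use xy in \<open>auto simp: cls\<close>)
  have assoc': "(x \<otimes>\<^bsub>?A\<^esub> y) \<otimes>\<^bsub>?A\<^esub> z = x \<otimes>\<^bsub>?A\<^esub> (y \<otimes>\<^bsub>?A\<^esub> z)"
    if xyz: "x \<in> carrier ?A" "y \<in> carrier ?A" "z \<in> carrier ?A" for x y z
  proof (rule ext)
    fix p assume p: "p < n"
    define w where "w i j l = x i \<otimes>\<^bsub>T\<^esub> y j \<otimes>\<^bsub>T\<^esub> z l" for i j l
    have w: "w i j l \<in> carrier T" if "i < n" "j < n" "l < n" for i j l
      using that xyz by (simp add: w_def cls)
    note cls' = cls w
    have "((x \<otimes>\<^bsub>?A\<^esub> y) \<otimes>\<^bsub>?A\<^esub> z) p
      = (\<Oplus>\<^bsub>T\<^esub>m\<in>{..<n}. \<Oplus>\<^bsub>T\<^esub>l\<in>{..<n}. (x \<otimes>\<^bsub>?A\<^esub> y) m \<otimes>\<^bsub>T\<^esub> z l \<otimes>\<^bsub>T\<^esub> c m l p)"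
      by (rule mul[OF p])
    also have "\<dots> = (\<Oplus>\<^bsub>T\<^esub>m\<in>{..<n}. \<Oplus>\<^bsub>T\<^esub>l\<in>{..<n}. \<Oplus>\<^bsub>T\<^esub>i\<in>{..<n}. \<Oplus>\<^bsub>T\<^esub>j\<in>{..<n}. w i j l \<otimes>\<^bsub>T\<^esub> (c i j m \<otimes>\<^bsub>T\<^esub> c m l p))"
    proof (intro S_cong)
      fix m l assume ml: "m < n" "l < n"
      have "(x \<otimes>\<^bsub>?A\<^esub> y) m \<otimes>\<^bsub>T\<^esub> z l \<otimes>\<^bsub>T\<^esub> c m l p = (\<Oplus>\<^bsub>T\<^esub>i\<in>{..<n}. \<Oplus>\<^bsub>T\<^esub>j\<in>{..<n}. x i \<otimes>\<^bsub>T\<^esub> y j \<otimes>\<^bsub>T\<^esub> c i j m) \<otimes>\<^bsub>T\<^esub> (z l \<otimes>\<^bsub>T\<^esub> c m l p)"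
        using ml xyz p by (simp add: mul[symmetric] cls m_assoc)
      also have "\<dots> = (\<Oplus>\<^bsub>T\<^esub>i\<in>{..<n}. (\<Oplus>\<^bsub>T\<^esub>j\<in>{..<n}. x i \<otimes>\<^bsub>T\<^esub> y j \<otimes>\<^bsub>T\<^esub> c i j m) \<otimes>\<^bsub>T\<^esub> (z l \<otimes>\<^bsub>T\<^esub> c m l p))"
        using ml xyz p by (intro S_ldistr) (auto intro!: S_closed simp: cls)
      also have "\<dots> = (\<Oplus>\<^bsub>T\<^esub>i\<in>{..<n}. \<Oplus>\<^bsub>T\<^esub>j\<in>{..<n}. w i j l \<otimes>\<^bsub>T\<^esub> (c i j m \<otimes>\<^bsub>T\<^esub> c m l p))"
      proof (rule S_cong)
        fix i assume i: "i < n"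
        show "(\<Oplus>\<^bsub>T\<^esub>j\<in>{..<n}. x i \<otimes>\<^bsub>T\<^esub> y j \<otimes>\<^bsub>T\<^esub> c i j m) \<otimes>\<^bsub>T\<^esub> (z l \<otimes>\<^bsub>T\<^esub> c m l p)
          = (\<Oplus>\<^bsub>T\<^esub>j\<in>{..<n}. w i j l \<otimes>\<^bsub>T\<^esub> (c i j m \<otimes>\<^bsub>T\<^esub> c m l p))"
          using i ml xyz p
          by (subst S_ldistr) (auto intro!: S_cong simp: cls' w_def m_ac)
      qed (use ml p in \<open>auto intro!: S_closed simp: cls'\<close>)
      finally show "(x \<otimes>\<^bsub>?A\<^esub> y) m \<otimes>\<^bsub>T\<^esub> z l \<otimes>\<^bsub>T\<^esub> c m l p
        = (\<Oplus>\<^bsub>T\<^esub>i\<in>{..<n}. \<Oplus>\<^bsub>T\<^esub>j\<in>{..<n}. w i j l \<otimes>\<^bsub>T\<^esub> (c i j m \<otimes>\<^bsub>T\<^esub> c m l p))" .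
    qed (use p in \<open>auto intro!: S_closed simp: cls'\<close>)
    also have "\<dots> = (\<Oplus>\<^bsub>T\<^esub>l\<in>{..<n}. \<Oplus>\<^bsub>T\<^esub>m\<in>{..<n}. \<Oplus>\<^bsub>T\<^esub>i\<in>{..<n}. \<Oplus>\<^bsub>T\<^esub>j\<in>{..<n}. w i j l \<otimes>\<^bsub>T\<^esub> (c i j m \<otimes>\<^bsub>T\<^esub> c m l p))"
      using p by (intro S_swap) (auto intro!: S_closed simp: cls')
    also have "\<dots> = (\<Oplus>\<^bsub>T\<^esub>l\<in>{..<n}. \<Oplus>\<^bsub>T\<^esub>i\<in>{..<n}. \<Oplus>\<^bsub>T\<^esub>j\<in>{..<n}. w i j l \<otimes>\<^bsub>T\<^esub> (\<Oplus>\<^bsub>T\<^esub>m\<in>{..<n}. c i j m \<otimes>\<^bsub>T\<^esub> c m l p))"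
    proof (rule S_cong)
      fix l assume l: "l < n"
      have "(\<Oplus>\<^bsub>T\<^esub>m\<in>{..<n}. \<Oplus>\<^bsub>T\<^esub>i\<in>{..<n}. \<Oplus>\<^bsub>T\<^esub>j\<in>{..<n}. w i j l \<otimes>\<^bsub>T\<^esub> (c i j m \<otimes>\<^bsub>T\<^esub> c m l p))
        = (\<Oplus>\<^bsub>T\<^esub>i\<in>{..<n}. \<Oplus>\<^bsub>T\<^esub>m\<in>{..<n}. \<Oplus>\<^bsub>T\<^esub>j\<in>{..<n}. w i j l \<otimes>\<^bsub>T\<^esub> (c i j m \<otimes>\<^bsub>T\<^esub> c m l p))"
        using p l by (intro S_swap) (auto intro!: S_closed simp: cls')
      also have "\<dots> = (\<Oplus>\<^bsub>T\<^esub>i\<in>{..<n}. \<Oplus>\<^bsub>T\<^esub>j\<in>{..<n}. \<Oplus>\<^bsub>T\<^esub>m\<in>{..<n}. w i j l \<otimes>\<^bsub>T\<^esub> (c i j m \<otimes>\<^bsub>T\<^esub> c m l p))"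
        using p l by (intro S_cong S_swap) (auto intro!: S_closed simp: cls')
      also have "\<dots> = (\<Oplus>\<^bsub>T\<^esub>i\<in>{..<n}. \<Oplus>\<^bsub>T\<^esub>j\<in>{..<n}. w i j l \<otimes>\<^bsub>T\<^esub> (\<Oplus>\<^bsub>T\<^esub>m\<in>{..<n}. c i j m \<otimes>\<^bsub>T\<^esub> c m l p))"
        using p l by (intro S_cong S_rdistr[symmetric]) (auto intro!: S_closed simp: cls')
      finally show "(\<Oplus>\<^bsub>T\<^esub>m\<in>{..<n}. \<Oplus>\<^bsub>T\<^esub>i\<in>{..<n}. \<Oplus>\<^bsub>T\<^esub>j\<in>{..<n}. w i j l \<otimes>\<^bsub>T\<^esub> (c i j m \<otimes>\<^bsub>T\<^esub> c m l p))
        = (\<Oplus>\<^bsub>T\<^esub>i\<in>{..<n}. \<Oplus>\<^bsub>T\<^esub>j\<in>{..<n}. w i j l \<otimes>\<^bsub>T\<^esub> (\<Oplus>\<^bsub>T\<^esub>m\<in>{..<n}. c i j m \<otimes>\<^bsub>T\<^esub> c m l p))" .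
    qed (use p in \<open>auto intro!: S_closed simp: cls'\<close>)
    also have "\<dots> = (\<Oplus>\<^bsub>T\<^esub>l\<in>{..<n}. \<Oplus>\<^bsub>T\<^esub>i\<in>{..<n}. \<Oplus>\<^bsub>T\<^esub>j\<in>{..<n}. w i j l \<otimes>\<^bsub>T\<^esub> (\<Oplus>\<^bsub>T\<^esub>m\<in>{..<n}. c j l m \<otimes>\<^bsub>T\<^esub> c i m p))"
      using p by (intro S_cong) (auto intro!: S_closed simp: cls' assoc)
    also have "\<dots> = (\<Oplus>\<^bsub>T\<^esub>i\<in>{..<n}. \<Oplus>\<^bsub>T\<^esub>l\<in>{..<n}. \<Oplus>\<^bsub>T\<^esub>j\<in>{..<n}. w i j l \<otimes>\<^bsub>T\<^esub> (\<Oplus>\<^bsub>T\<^esub>m\<in>{..<n}. c j l m \<otimes>\<^bsub>T\<^esub> c i m p))"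
      using p by (intro S_swap) (auto intro!: S_closed simp: cls')
    also have "\<dots> = (\<Oplus>\<^bsub>T\<^esub>i\<in>{..<n}. \<Oplus>\<^bsub>T\<^esub>m\<in>{..<n}. x i \<otimes>\<^bsub>T\<^esub> (y \<otimes>\<^bsub>?A\<^esub> z) m \<otimes>\<^bsub>T\<^esub> c i m p)"
    proof (rule S_cong)
      fix i assume i: "i < n"
      have "(\<Oplus>\<^bsub>T\<^esub>l\<in>{..<n}. \<Oplus>\<^bsub>T\<^esub>j\<in>{..<n}. w i j l \<otimes>\<^bsub>T\<^esub> (\<Oplus>\<^bsub>T\<^esub>m\<in>{..<n}. c j l m \<otimes>\<^bsub>T\<^esub> c i m p))
        = (\<Oplus>\<^bsub>T\<^esub>j\<in>{..<n}. \<Oplus>\<^bsub>T\<^esub>l\<in>{..<n}. w i j l \<otimes>\<^bsub>T\<^esub> (\<Oplus>\<^bsub>T\<^esub>m\<in>{..<n}. c j l m \<otimes>\<^bsub>T\<^esub> c i m p))"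
        using p i by (intro S_swap) (auto intro!: S_closed simp: cls')
      also have "\<dots> = (\<Oplus>\<^bsub>T\<^esub>j\<in>{..<n}. \<Oplus>\<^bsub>T\<^esub>l\<in>{..<n}. \<Oplus>\<^bsub>T\<^esub>m\<in>{..<n}. w i j l \<otimes>\<^bsub>T\<^esub> (c j l m \<otimes>\<^bsub>T\<^esub> c i m p))"
        using p i by (intro S_cong S_rdistr) (auto intro!: S_closed simp: cls')
      also have "\<dots> = (\<Oplus>\<^bsub>T\<^esub>j\<in>{..<n}. \<Oplus>\<^bsub>T\<^esub>m\<in>{..<n}. \<Oplus>\<^bsub>T\<^esub>l\<in>{..<n}. w i j l \<otimes>\<^bsub>T\<^esub> (c j l m \<otimes>\<^bsub>T\<^esub> c i m p))"
        using p i by (intro S_cong S_swap) (auto intro!: S_closed simp: cls')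
      also have "\<dots> = (\<Oplus>\<^bsub>T\<^esub>m\<in>{..<n}. \<Oplus>\<^bsub>T\<^esub>j\<in>{..<n}. \<Oplus>\<^bsub>T\<^esub>l\<in>{..<n}. w i j l \<otimes>\<^bsub>T\<^esub> (c j l m \<otimes>\<^bsub>T\<^esub> c i m p))"
        using p i by (intro S_swap) (auto intro!: S_closed simp: cls')
      also have "\<dots> = (\<Oplus>\<^bsub>T\<^esub>m\<in>{..<n}. x i \<otimes>\<^bsub>T\<^esub> (y \<otimes>\<^bsub>?A\<^esub> z) m \<otimes>\<^bsub>T\<^esub> c i m p)"
      proof (rule S_cong)
        fix m assume m: "m < n"
        have "x i \<otimes>\<^bsub>T\<^esub> (y \<otimes>\<^bsub>?A\<^esub> z) m \<otimes>\<^bsub>T\<^esub> c i m p = (x i \<otimes>\<^bsub>T\<^esub> c i m p) \<otimes>\<^bsub>T\<^esub> (y \<otimes>\<^bsub>?A\<^esub> z) m"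
          using i m p xyz by (simp add: cls m_ac)
        also have "\<dots> = (x i \<otimes>\<^bsub>T\<^esub> c i m p) \<otimes>\<^bsub>T\<^esub> (\<Oplus>\<^bsub>T\<^esub>j\<in>{..<n}. \<Oplus>\<^bsub>T\<^esub>l\<in>{..<n}. y j \<otimes>\<^bsub>T\<^esub> z l \<otimes>\<^bsub>T\<^esub> c j l m)"
          by (simp only: mul[OF m])
        also have "\<dots> = (\<Oplus>\<^bsub>T\<^esub>j\<in>{..<n}. (x i \<otimes>\<^bsub>T\<^esub> c i m p) \<otimes>\<^bsub>T\<^esub> (\<Oplus>\<^bsub>T\<^esub>l\<in>{..<n}. y j \<otimes>\<^bsub>T\<^esub> z l \<otimes>\<^bsub>T\<^esub> c j l m))"
          using i m p xyz by (intro S_rdistr) (auto intro!: S_closed simp: cls)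
        also have "\<dots> = (\<Oplus>\<^bsub>T\<^esub>j\<in>{..<n}. \<Oplus>\<^bsub>T\<^esub>l\<in>{..<n}. w i j l \<otimes>\<^bsub>T\<^esub> (c j l m \<otimes>\<^bsub>T\<^esub> c i m p))"
        proof (rule S_cong)
          fix j assume j: "j < n"
          show "(x i \<otimes>\<^bsub>T\<^esub> c i m p) \<otimes>\<^bsub>T\<^esub> (\<Oplus>\<^bsub>T\<^esub>l\<in>{..<n}. y j \<otimes>\<^bsub>T\<^esub> z l \<otimes>\<^bsub>T\<^esub> c j l m)
            = (\<Oplus>\<^bsub>T\<^esub>l\<in>{..<n}. w i j l \<otimes>\<^bsub>T\<^esub> (c j l m \<otimes>\<^bsub>T\<^esub> c i m p))"
            using i j m p xyz by (subst S_rdistr) (auto intro!: S_cong simp: cls' w_def m_ac)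
        qed (use i m p in \<open>auto intro!: S_closed simp: cls'\<close>)
        finally show "(\<Oplus>\<^bsub>T\<^esub>j\<in>{..<n}. \<Oplus>\<^bsub>T\<^esub>l\<in>{..<n}. w i j l \<otimes>\<^bsub>T\<^esub> (c j l m \<otimes>\<^bsub>T\<^esub> c i m p))
          = x i \<otimes>\<^bsub>T\<^esub> (y \<otimes>\<^bsub>?A\<^esub> z) m \<otimes>\<^bsub>T\<^esub> c i m p" ..
      qed (use i p xyz in \<open>auto intro!: S_closed simp: cls'\<close>)
      finally show "(\<Oplus>\<^bsub>T\<^esub>l\<in>{..<n}. \<Oplus>\<^bsub>T\<^esub>j\<in>{..<n}. w i j l \<otimes>\<^bsub>T\<^esub> (\<Oplus>\<^bsub>T\<^esub>m\<in>{..<n}. c j l m \<otimes>\<^bsub>T\<^esub> c i m p))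
        = (\<Oplus>\<^bsub>T\<^esub>m\<in>{..<n}. x i \<otimes>\<^bsub>T\<^esub> (y \<otimes>\<^bsub>?A\<^esub> z) m \<otimes>\<^bsub>T\<^esub> c i m p)" .
    qed (use p xyz in \<open>auto intro!: S_closed simp: cls\<close>)
    also have "\<dots> = (x \<otimes>\<^bsub>?A\<^esub> (y \<otimes>\<^bsub>?A\<^esub> z)) p" by (rule mul[OF p, symmetric])
    finally show "((x \<otimes>\<^bsub>?A\<^esub> y) \<otimes>\<^bsub>?A\<^esub> z) p = (x \<otimes>\<^bsub>?A\<^esub> (y \<otimes>\<^bsub>?A\<^esub> z)) p" .
  qed (use xyz in \<open>auto simp: cls\<close>)
  have unit': "\<one>\<^bsub>?A\<^esub> \<otimes>\<^bsub>?A\<^esub> y = y" if y: "y \<in> carrier ?A" for y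
  proof (rule ext)
    fix l assume l: "l < n"
    have "(\<one>\<^bsub>?A\<^esub> \<otimes>\<^bsub>?A\<^esub> y) l = (\<Oplus>\<^bsub>T\<^esub>i\<in>{..<n}. \<Oplus>\<^bsub>T\<^esub>j\<in>{..<n}. y j \<otimes>\<^bsub>T\<^esub> (u i \<otimes>\<^bsub>T\<^esub> c i j l))"
      unfolding mul[OF l] using y l
      by (intro S_cong) (auto intro!: S_closed simp: cls one u m_ac)
    also have "\<dots> = (\<Oplus>\<^bsub>T\<^esub>j\<in>{..<n}. \<Oplus>\<^bsub>T\<^esub>i\<in>{..<n}. y j \<otimes>\<^bsub>T\<^esub> (u i \<otimes>\<^bsub>T\<^esub> c i j l))"
      using y l by (intro S_swap) (auto simp: cls u)
    also have "\<dots> = (\<Oplus>\<^bsub>T\<^esub>j\<in>{..<n}. (if j = l then \<one>\<^bsub>T\<^esub> else \<zero>\<^bsub>T\<^esub>) \<otimes>\<^bsub>T\<^esub> y j)"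
    proof (rule S_cong)
      fix j assume j: "j < n"
      have "(\<Oplus>\<^bsub>T\<^esub>i\<in>{..<n}. y j \<otimes>\<^bsub>T\<^esub> (u i \<otimes>\<^bsub>T\<^esub> c i j l)) = y j \<otimes>\<^bsub>T\<^esub> (\<Oplus>\<^bsub>T\<^esub>i\<in>{..<n}. u i \<otimes>\<^bsub>T\<^esub> c i j l)"
        using y l j by (intro S_rdistr[symmetric]) (auto simp: cls u)
      then show "(\<Oplus>\<^bsub>T\<^esub>i\<in>{..<n}. y j \<otimes>\<^bsub>T\<^esub> (u i \<otimes>\<^bsub>T\<^esub> c i j l)) = (if j = l then \<one>\<^bsub>T\<^esub> else \<zero>\<^bsub>T\<^esub>) \<otimes>\<^bsub>T\<^esub> y j"
        using y l j by (simp add: unit cls)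
    qed (use y in \<open>auto simp: cls\<close>)
    also have "\<dots> = y l" using y l by (intro S_delta) (auto simp: cls)
    finally show "(\<one>\<^bsub>?A\<^esub> \<otimes>\<^bsub>?A\<^esub> y) l = y l" .
  qed (use y in \<open>auto simp: cls\<close>)
  have distr: "(x \<oplus>\<^bsub>?A\<^esub> y) \<otimes>\<^bsub>?A\<^esub> z = x \<otimes>\<^bsub>?A\<^esub> z \<oplus>\<^bsub>?A\<^esub> y \<otimes>\<^bsub>?A\<^esub> z"
    if xyz: "x \<in> carrier ?A" "y \<in> carrier ?A" "z \<in> carrier ?A" for x y z
  proof (rule ext)
    fix l assume l: "l < n"
    have "((x \<oplus>\<^bsub>?A\<^esub> y) \<otimes>\<^bsub>?A\<^esub> z) l = (\<Oplus>\<^bsub>T\<^esub>i\<in>{..<n}. (\<Oplus>\<^bsub>T\<^esub>j\<in>{..<n}. x i \<otimes>\<^bsub>T\<^esub> z j \<otimes>\<^bsub>T\<^esub> c i j l) \<oplus>\<^bsub>T\<^esub> (\<Oplus>\<^bsub>T\<^esub>j\<in>{..<n}. y i \<otimes>\<^bsub>T\<^esub> z j \<otimes>\<^bsub>T\<^esub> c i j l))"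
      unfolding mul[OF l]
    proof (rule S_cong)
      fix i assume i: "i < n"
      have "(\<Oplus>\<^bsub>T\<^esub>j\<in>{..<n}. (x \<oplus>\<^bsub>?A\<^esub> y) i \<otimes>\<^bsub>T\<^esub> z j \<otimes>\<^bsub>T\<^esub> c i j l)
        = (\<Oplus>\<^bsub>T\<^esub>j\<in>{..<n}. x i \<otimes>\<^bsub>T\<^esub> z j \<otimes>\<^bsub>T\<^esub> c i j l \<oplus>\<^bsub>T\<^esub> y i \<otimes>\<^bsub>T\<^esub> z j \<otimes>\<^bsub>T\<^esub> c i j l)"
        using xyz l i by (intro S_cong) (auto simp: cls add l_distr)
      also have "\<dots> = (\<Oplus>\<^bsub>T\<^esub>j\<in>{..<n}. x i \<otimes>\<^bsub>T\<^esub> z j \<otimes>\<^bsub>T\<^esub> c i j l) \<oplus>\<^bsub>T\<^esub> (\<Oplus>\<^bsub>T\<^esub>j\<in>{..<n}. y i \<otimes>\<^bsub>T\<^esub> z j \<otimes>\<^bsub>T\<^esub> c i j l)"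
        using xyz l i by (intro S_add) (auto simp: cls)
      finally show "(\<Oplus>\<^bsub>T\<^esub>j\<in>{..<n}. (x \<oplus>\<^bsub>?A\<^esub> y) i \<otimes>\<^bsub>T\<^esub> z j \<otimes>\<^bsub>T\<^esub> c i j l)
        = (\<Oplus>\<^bsub>T\<^esub>j\<in>{..<n}. x i \<otimes>\<^bsub>T\<^esub> z j \<otimes>\<^bsub>T\<^esub> c i j l) \<oplus>\<^bsub>T\<^esub> (\<Oplus>\<^bsub>T\<^esub>j\<in>{..<n}. y i \<otimes>\<^bsub>T\<^esub> z j \<otimes>\<^bsub>T\<^esub> c i j l)" .
    qed (use xyz l in \<open>auto intro!: S_closed simp: cls\<close>)
    also have "\<dots> = (x \<otimes>\<^bsub>?A\<^esub> z \<oplus>\<^bsub>?A\<^esub> y \<otimes>\<^bsub>?A\<^esub> z) l"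
      unfolding add[OF l] mul[OF l] using xyz l by (intro S_add) (auto intro!: S_closed simp: cls)
    finally show "((x \<oplus>\<^bsub>?A\<^esub> y) \<otimes>\<^bsub>?A\<^esub> z) l = (x \<otimes>\<^bsub>?A\<^esub> z \<oplus>\<^bsub>?A\<^esub> y \<otimes>\<^bsub>?A\<^esub> z) l" .
  qed (use xyz in \<open>auto simp: cls\<close>)
  have smult2: "(t \<odot>\<^bsub>?A\<^esub> x) \<otimes>\<^bsub>?A\<^esub> y = t \<odot>\<^bsub>?A\<^esub> (x \<otimes>\<^bsub>?A\<^esub> y)"
    if txy: "t \<in> carrier T" "x \<in> carrier ?A" "y \<in> carrier ?A" for t x y
  proof (rule ext)
    fix l assume l: "l < n"
    have "((t \<odot>\<^bsub>?A\<^esub> x) \<otimes>\<^bsub>?A\<^esub> y) l = (\<Oplus>\<^bsub>T\<^esub>i\<in>{..<n}. t \<otimes>\<^bsub>T\<^esub> (\<Oplus>\<^bsub>T\<^esub>j\<in>{..<n}. x i \<otimes>\<^bsub>T\<^esub> y j \<otimes>\<^bsub>T\<^esub> c i j l))"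
      unfolding mul[OF l]
    proof (rule S_cong)
      fix i assume i: "i < n"
      have "(\<Oplus>\<^bsub>T\<^esub>j\<in>{..<n}. (t \<odot>\<^bsub>?A\<^esub> x) i \<otimes>\<^bsub>T\<^esub> y j \<otimes>\<^bsub>T\<^esub> c i j l)
        = (\<Oplus>\<^bsub>T\<^esub>j\<in>{..<n}. t \<otimes>\<^bsub>T\<^esub> (x i \<otimes>\<^bsub>T\<^esub> y j \<otimes>\<^bsub>T\<^esub> c i j l))"
        using txy l i by (intro S_cong) (auto simp: cls sm m_assoc)
      also have "\<dots> = t \<otimes>\<^bsub>T\<^esub> (\<Oplus>\<^bsub>T\<^esub>j\<in>{..<n}. x i \<otimes>\<^bsub>T\<^esub> y j \<otimes>\<^bsub>T\<^esub> c i j l)"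
        using txy l i by (intro S_rdistr[symmetric]) (auto simp: cls)
      finally show "(\<Oplus>\<^bsub>T\<^esub>j\<in>{..<n}. (t \<odot>\<^bsub>?A\<^esub> x) i \<otimes>\<^bsub>T\<^esub> y j \<otimes>\<^bsub>T\<^esub> c i j l)
        = t \<otimes>\<^bsub>T\<^esub> (\<Oplus>\<^bsub>T\<^esub>j\<in>{..<n}. x i \<otimes>\<^bsub>T\<^esub> y j \<otimes>\<^bsub>T\<^esub> c i j l)" .
    qed (use txy l in \<open>auto intro!: S_closed simp: cls\<close>)
    also have "\<dots> = (t \<odot>\<^bsub>?A\<^esub> (x \<otimes>\<^bsub>?A\<^esub> y)) l"
      unfolding sm[OF l] mul[OF l] using txy l by (intro S_rdistr[symmetric]) (auto intro!: S_closed simp: cls)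
    finally show "((t \<odot>\<^bsub>?A\<^esub> x) \<otimes>\<^bsub>?A\<^esub> y) l = (t \<odot>\<^bsub>?A\<^esub> (x \<otimes>\<^bsub>?A\<^esub> y)) l" .
  qed (use txy in \<open>auto simp: cls\<close>)
  have "abelian_group ?A"
  proof (rule abelian_groupI)
    fix x assume x: "x \<in> carrier ?A"
    show "\<exists>y\<in>carrier ?A. y \<oplus>\<^bsub>?A\<^esub> x = \<zero>\<^bsub>?A\<^esub>"
    proof
      show neg: "(\<lambda>l\<in>{..<n}. \<ominus>\<^bsub>T\<^esub> x l) \<in> carrier ?A" using x by (intro mem) (simp add: cls)
      show "(\<lambda>l\<in>{..<n}. \<ominus>\<^bsub>T\<^esub> x l) \<oplus>\<^bsub>?A\<^esub> x = \<zero>\<^bsub>?A\<^esub>"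
        using x neg by (intro ext) (auto simp: cls add zer l_neg)
    qed
  next
    fix x y z assume xyz: "x \<in> carrier ?A" "y \<in> carrier ?A" "z \<in> carrier ?A"
    show "x \<oplus>\<^bsub>?A\<^esub> y \<oplus>\<^bsub>?A\<^esub> z = x \<oplus>\<^bsub>?A\<^esub> (y \<oplus>\<^bsub>?A\<^esub> z)"
      using xyz by (intro ext) (auto simp: cls add a_assoc)
  next
    fix x y assume xy: "x \<in> carrier ?A" "y \<in> carrier ?A"
    show "x \<oplus>\<^bsub>?A\<^esub> y = y \<oplus>\<^bsub>?A\<^esub> x" using xy by (intro ext) (auto simp: cls add a_comm)
  next
    fix x assume x: "x \<in> carrier ?A"
    show "\<zero>\<^bsub>?A\<^esub> \<oplus>\<^bsub>?A\<^esub> x = x" using x by (intro ext) (auto simp: cls add zer)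
  qed (auto simp: cls)
  moreover have "Group.comm_monoid ?A"
    by (rule comm_monoidI) (auto simp: mulc oc assoc' unit' intro: comm')
  ultimately have A: "cring ?A" by (intro cringI) (auto simp: distr)
  show ?thesis
  proof (rule algebraI[OF T A])
    fix t x assume "t \<in> carrier T" "x \<in> carrier ?A"
    then show "t \<odot>\<^bsub>?A\<^esub> x \<in> carrier ?A" by (rule smc)
  next
    fix s t x assume h: "s \<in> carrier T" "t \<in> carrier T" "x \<in> carrier ?A"
    show "(s \<oplus>\<^bsub>T\<^esub> t) \<odot>\<^bsub>?A\<^esub> x = s \<odot>\<^bsub>?A\<^esub> x \<oplus>\<^bsub>?A\<^esub> t \<odot>\<^bsub>?A\<^esub> x"
      using h by (intro ext) (auto simp: cls add sm l_distr)
    show "(s \<otimes>\<^bsub>T\<^esub> t) \<odot>\<^bsub>?A\<^esub> x = s \<odot>\<^bsub>?A\<^esub> (t \<odot>\<^bsub>?A\<^esub> x)"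
      using h by (intro ext) (auto simp: cls sm m_assoc)
  next
    fix t x y assume h: "t \<in> carrier T" "x \<in> carrier ?A" "y \<in> carrier ?A"
    show "t \<odot>\<^bsub>?A\<^esub> (x \<oplus>\<^bsub>?A\<^esub> y) = t \<odot>\<^bsub>?A\<^esub> x \<oplus>\<^bsub>?A\<^esub> t \<odot>\<^bsub>?A\<^esub> y"
      using h by (intro ext) (auto simp: cls add sm r_distr)
    show "t \<odot>\<^bsub>?A\<^esub> x \<otimes>\<^bsub>?A\<^esub> y = t \<odot>\<^bsub>?A\<^esub> (x \<otimes>\<^bsub>?A\<^esub> y)" by (rule smult2[OF h])
  next
    fix x assume x: "x \<in> carrier ?A"
    show "\<one>\<^bsub>T\<^esub> \<odot>\<^bsub>?A\<^esub> x = x" using x by (intro ext) (auto simp: cls sm)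
  qed
qed

lemma based_table_alg:
  assumes T: "cring T" and tab: "is_table n T c u"
  shows "based_algebra n T (table_alg n T c u) (\<lambda>x. x)"
  using algebra_table_alg[OF assms]
  by (auto simp: based_algebra_def table_alg_def bij_betw_def)

lemma struct_const_table_alg:
  assumes T: "cring T" and tab: "is_table n T c u" and "i < n" "j < n" "l < n"
  shows "struct_const n T (table_alg n T c u) (\<lambda>x. x) i j l = c i j l"
proof -
  interpret cring T by (rule T)
  have c: "\<And>i j l. i < n \<Longrightarrow> j < n \<Longrightarrow> l < n \<Longrightarrow> c i j l \<in> carrier T"
    using is_tableD(1)[OF tab] .
  have "unit_vec n T i \<in> carrier (table_alg n T c u)" for i
    by (auto simp: table_alg_def unit_vec_def)
  then have b: "basis_elt n T (table_alg n T c u) (\<lambda>x. x) i = unit_vec n T i" for i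
    unfolding basis_elt_def by (intro inv_into_f_f[where f = "\<lambda>x. x"]) auto
  have "struct_const n T (table_alg n T c u) (\<lambda>x. x) i j l
    = (\<Oplus>\<^bsub>T\<^esub>i'\<in>{..<n}. \<Oplus>\<^bsub>T\<^esub>j'\<in>{..<n}. unit_vec n T i i' \<otimes>\<^bsub>T\<^esub> unit_vec n T j j' \<otimes>\<^bsub>T\<^esub> c i' j' l)"
    using assms by (simp add: struct_const_def b) (simp add: table_alg_def)
  also have "\<dots> = (\<Oplus>\<^bsub>T\<^esub>i'\<in>{..<n}. (if i' = i then \<one>\<^bsub>T\<^esub> else \<zero>\<^bsub>T\<^esub>) \<otimes>\<^bsub>T\<^esub> c i' j l)"
  proof (rule S_cong)
    fix i' assume i': "i' < n"
    have "(\<Oplus>\<^bsub>T\<^esub>j'\<in>{..<n}. unit_vec n T i i' \<otimes>\<^bsub>T\<^esub> unit_vec n T j j' \<otimes>\<^bsub>T\<^esub> c i' j' l)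
      = (\<Oplus>\<^bsub>T\<^esub>j'\<in>{..<n}. (if j' = j then \<one>\<^bsub>T\<^esub> else \<zero>\<^bsub>T\<^esub>) \<otimes>\<^bsub>T\<^esub> ((if i' = i then \<one>\<^bsub>T\<^esub> else \<zero>\<^bsub>T\<^esub>) \<otimes>\<^bsub>T\<^esub> c i' j' l))"
      using i' assms by (intro S_cong) (auto simp: unit_vec_def c)
    also have "\<dots> = (if i' = i then \<one>\<^bsub>T\<^esub> else \<zero>\<^bsub>T\<^esub>) \<otimes>\<^bsub>T\<^esub> c i' j l"
      using i' assms by (intro S_delta) (auto simp: c)
    finally show "(\<Oplus>\<^bsub>T\<^esub>j'\<in>{..<n}. unit_vec n T i i' \<otimes>\<^bsub>T\<^esub> unit_vec n T j j' \<otimes>\<^bsub>T\<^esub> c i' j' l)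
      = (if i' = i then \<one>\<^bsub>T\<^esub> else \<zero>\<^bsub>T\<^esub>) \<otimes>\<^bsub>T\<^esub> c i' j l" .
  qed (use assms in \<open>auto simp: c\<close>)
  also have "\<dots> = c i j l" using assms by (intro S_delta) (auto simp: c)
  finally show ?thesis .
qed

lemma one_table_alg: "i < n \<Longrightarrow> \<one>\<^bsub>table_alg n T c u\<^esub> i = u i"
  by (simp add: table_alg_def)


section \<open>The schemes of based algebras\<close>

text \<open>\<open>SC i j l\<close> is the coefficient at \<open>e\<^sub>l\<close> of \<open>e\<^sub>i \<cdot> e\<^sub>j\<close>, and \<open>UC i\<close> is the coefficient
  of the unit element at \<open>e\<^sub>i\<close>; basis vectors are numbered from \<open>0\<close>.  Since the unit of an
  algebra is unique, adding its coordinates does not add data; it makes the functor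
  representable by an affine scheme (\<open>B_represents\<close> below).\<close>

datatype coord = SC nat nat nat | UC nat

definition B_vars :: "nat \<Rightarrow> coord set" where
  "B_vars n = {SC i j l | i j l. i < n \<and> j < n \<and> l < n} \<union> {UC i | i. i < n}"

definition comm_eq :: "nat \<Rightarrow> nat \<Rightarrow> nat \<Rightarrow> (coord, int) mpoly" where
  "comm_eq i j l = Var (SC i j l) - Var (SC j i l)"

definition assoc_eq :: "nat \<Rightarrow> nat \<Rightarrow> nat \<Rightarrow> nat \<Rightarrow> nat \<Rightarrow> (coord, int) mpoly" where
  "assoc_eq n i j l p = (\<Sum>m<n. Var (SC i j m) * Var (SC m l p)) - (\<Sum>m<n. Var (SC j l m) * Var (SC i m p))"

definition unit_eq :: "nat \<Rightarrow> nat \<Rightarrow> nat \<Rightarrow> (coord, int) mpoly" where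
  "unit_eq n j l = (\<Sum>i<n. Var (UC i) * Var (SC i j l)) - (if j = l then 1 else 0)"

definition B_eqs :: "nat \<Rightarrow> (coord, int) mpoly set" where
  "B_eqs n = {comm_eq i j l | i j l. i < n \<and> j < n \<and> l < n}
     \<union> {assoc_eq n i j l p | i j l p. i < n \<and> j < n \<and> l < n \<and> p < n}
     \<union> {unit_eq n j l | j l. j < n \<and> l < n}"

text \<open>For \<open>n = 0\<close> there are no additional equations.\<close>

definition B1_eqs :: "nat \<Rightarrow> (coord, int) mpoly set" where
  "B1_eqs n = B_eqs n \<union> {Var (UC i) - (if i = 0 then 1 else 0) | i. i < n}"

text \<open>Coordinate rings of \<open>\<BB>\<^sub>n\<^sub>,\<^sub>k\<close> and \<open>\<BB>\<^sup>1\<^sub>n\<^sub>,\<^sub>k\<close>; for \<open>k = \<int>\<close> these are \<open>\<BB>\<^sub>n\<close> and \<open>\<BB>\<^sup>1\<^sub>n\<close> themselves.\<close>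

definition B_ring :: "nat \<Rightarrow> (coord, 'k::comm_ring_1) mpoly set ring" where
  "B_ring n = coord_ring (B_vars n) (base_change (B_eqs n))"

definition B1_ring :: "nat \<Rightarrow> (coord, 'k::comm_ring_1) mpoly set ring" where
  "B1_ring n = coord_ring (B_vars n) (base_change (B1_eqs n))"


section \<open>Representability\<close>

lemma (in cring) diff_eq_zero_iff: "x \<in> carrier R \<Longrightarrow> y \<in> carrier R \<Longrightarrow> x \<ominus> y = \<zero> \<longleftrightarrow> x = y"
  by (metis a_minus_def add.inv_closed add.inv_equality minus_minus r_neg)

lemma B1_eqs_closed: "B1_eqs n \<subseteq> carrier (mpoly_ring (B_vars n))"
proof -
  have SC: "i < n \<Longrightarrow> j < n \<Longrightarrow> l < n \<Longrightarrow> Var (SC i j l) \<in> carrier (mpoly_ring (B_vars n) :: (coord, int) mpoly ring)" for i j l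
    by (rule Var_closed) (auto simp: B_vars_def)
  have UC: "i < n \<Longrightarrow> Var (UC i) \<in> carrier (mpoly_ring (B_vars n) :: (coord, int) mpoly ring)" for i
    by (rule Var_closed) (auto simp: B_vars_def)
  show ?thesis
    by (auto simp: B1_eqs_def B_eqs_def comm_eq_def assoc_eq_def unit_eq_def
        intro!: mpoly_diff_closed mpoly_sum_closed mpoly_mult_closed SC UC one_closed' zero_closed')
qed

lemma B_eqs_closed: "B_eqs n \<subseteq> carrier (mpoly_ring (B_vars n))"
  using B1_eqs_closed[of n] by (auto simp: B1_eqs_def)

lemma ev_B_eqs_iff:
  fixes T (structure)
  assumes "evaluation T h (a :: coord \<Rightarrow> 'a)"
  shows "(\<forall>e\<in>B_eqs n. evaluation.ev T h a e = \<zero>) \<longleftrightarrow> is_table n T (\<lambda>i j l. a (SC i j l)) (\<lambda>i. a (UC i))"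
proof -
  interpret evaluation T h a by fact
  note a [simp]
  have c: "ev (comm_eq i j l) = \<zero> \<longleftrightarrow> a (SC i j l) = a (SC j i l)" for i j l
    by (simp add: comm_eq_def ev_diff ev_Var diff_eq_zero_iff)
  have s: "ev (assoc_eq n i j l p) = \<zero> \<longleftrightarrow>
      (\<Oplus>m\<in>{..<n}. a (SC i j m) \<otimes> a (SC m l p)) = (\<Oplus>m\<in>{..<n}. a (SC j l m) \<otimes> a (SC i m p))" for i j l p
    by (simp add: assoc_eq_def ev_diff ev_sum ev_mult ev_Var diff_eq_zero_iff S_closed)
  have u: "ev (unit_eq n j l) = \<zero> \<longleftrightarrow>
      (\<Oplus>i\<in>{..<n}. a (UC i) \<otimes> a (SC i j l)) = (if j = l then \<one> else \<zero>)" for j l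
    by (auto simp: unit_eq_def ev_diff ev_sum ev_mult ev_Var diff_eq_zero_iff S_closed ev_1 ev_0)
  have "(\<forall>e\<in>B_eqs n. ev e = \<zero>) \<longleftrightarrow> (\<forall>i<n. \<forall>j<n. \<forall>l<n. ev (comm_eq i j l) = \<zero>)
      \<and> (\<forall>i<n. \<forall>j<n. \<forall>l<n. \<forall>p<n. ev (assoc_eq n i j l p) = \<zero>)
      \<and> (\<forall>j<n. \<forall>l<n. ev (unit_eq n j l) = \<zero>)"
  proof -
    have 3: "(\<forall>e\<in>{F i j l | i j l. i < n \<and> j < n \<and> l < n}. Q e) \<longleftrightarrow> (\<forall>i<n. \<forall>j<n. \<forall>l<n. Q (F i j l))"
      for F :: "nat \<Rightarrow> nat \<Rightarrow> nat \<Rightarrow> (coord, int) mpoly" and Q by auto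
    have 4: "(\<forall>e\<in>{F i j l p | i j l p. i < n \<and> j < n \<and> l < n \<and> p < n}. Q e) \<longleftrightarrow> (\<forall>i<n. \<forall>j<n. \<forall>l<n. \<forall>p<n. Q (F i j l p))"
      for F :: "nat \<Rightarrow> nat \<Rightarrow> nat \<Rightarrow> nat \<Rightarrow> (coord, int) mpoly" and Q by blast
    have 2: "(\<forall>e\<in>{F j l | j l. j < n \<and> l < n}. Q e) \<longleftrightarrow> (\<forall>j<n. \<forall>l<n. Q (F j l))"
      for F :: "nat \<Rightarrow> nat \<Rightarrow> (coord, int) mpoly" and Q by auto
    show ?thesis unfolding B_eqs_def ball_Un 2 3 4 by (simp only: conj_assoc)
  qed
  then show ?thesis using a by (simp only: c s u is_table_def simp_thms)
qed

text \<open>The based algebra over \<open>k[V]/(E)\<close> whose structure constants are the coordinates.\<close>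

definition universal_alg :: "nat \<Rightarrow> (coord, 'k::comm_ring_1) mpoly set \<Rightarrow> ((coord, 'k) mpoly set, nat \<Rightarrow> (coord, 'k) mpoly set) module" where
  "universal_alg n E = table_alg n (coord_ring (B_vars n) E)
     (\<lambda>i j l. cls (B_vars n) E (Var (SC i j l))) (\<lambda>i. cls (B_vars n) E (Var (UC i)))"

lemma is_table_cong:
  assumes "\<And>i j l. i < n \<Longrightarrow> j < n \<Longrightarrow> l < n \<Longrightarrow> c i j l = c' i j l" "\<And>i. i < n \<Longrightarrow> u i = u' i"
    and T: "cring T" and t: "is_table n T c u"
  shows "is_table n T c' u'"
proof -
  interpret cring T by (rule T)
  note d = is_tableD[OF t]
  have cc: "\<And>i j l. i < n \<Longrightarrow> j < n \<Longrightarrow> l < n \<Longrightarrow> c' i j l \<in> carrier T" "\<And>i. i < n \<Longrightarrow> u' i \<in> carrier T"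
    using d(1,2) assms(1,2) by metis+
  have "(\<Oplus>\<^bsub>T\<^esub>m\<in>{..<n}. c' i j m \<otimes>\<^bsub>T\<^esub> c' m l p) = (\<Oplus>\<^bsub>T\<^esub>m\<in>{..<n}. c i j m \<otimes>\<^bsub>T\<^esub> c m l p)"
    "(\<Oplus>\<^bsub>T\<^esub>m\<in>{..<n}. c' j l m \<otimes>\<^bsub>T\<^esub> c' i m p) = (\<Oplus>\<^bsub>T\<^esub>m\<in>{..<n}. c j l m \<otimes>\<^bsub>T\<^esub> c i m p)"
    "(\<Oplus>\<^bsub>T\<^esub>m\<in>{..<n}. u' m \<otimes>\<^bsub>T\<^esub> c' m j l) = (\<Oplus>\<^bsub>T\<^esub>m\<in>{..<n}. u m \<otimes>\<^bsub>T\<^esub> c m j l)"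
    if "i < n" "j < n" "l < n" "p < n" for i j l p
    using that assms(1,2) d(1,2) by (auto intro!: S_cong)
  note sums = this
  show ?thesis
    unfolding is_table_def
  proof (intro conjI allI impI)
    fix i j l p assume h: "i < n" "j < n" "l < n" "p < n"
    show "(\<Oplus>\<^bsub>T\<^esub>m\<in>{..<n}. c' i j m \<otimes>\<^bsub>T\<^esub> c' m l p) = (\<Oplus>\<^bsub>T\<^esub>m\<in>{..<n}. c' j l m \<otimes>\<^bsub>T\<^esub> c' i m p)"
      unfolding sums(1)[OF h] sums(2)[OF h] by (rule d(4)[OF h])
  next
    fix j l assume h: "j < n" "l < n"
    show "(\<Oplus>\<^bsub>T\<^esub>i\<in>{..<n}. u' i \<otimes>\<^bsub>T\<^esub> c' i j l) = (if j = l then \<one>\<^bsub>T\<^esub> else \<zero>\<^bsub>T\<^esub>)"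
      unfolding sums(3)[OF h(1) h h(1)] by (rule d(5)[OF h])
  next
    fix i j l assume h: "i < n" "j < n" "l < n"
    show "c' i j l = c' j i l"
      using assms(1)[OF h] assms(1)[OF h(2) h(1) h(3)] d(3)[OF h] by simp
  qed (use cc in auto)
qed

lemma universal_table:
  fixes E :: "(coord, int) mpoly set" and n :: nat
  defines "F \<equiv> base_change E :: (coord, 'k::comm_ring_1) mpoly set"
  assumes E: "E \<subseteq> carrier (mpoly_ring (B_vars n))" and BE: "B_eqs n \<subseteq> E"
  shows "is_table n (coord_ring (B_vars n) F)
     (\<lambda>i j l. cls (B_vars n) F (Var (SC i j l))) (\<lambda>i. cls (B_vars n) F (Var (UC i)))"
proof -
  let ?V = "B_vars n"
  let ?R = "coord_ring ?V F"
  have E': "F \<subseteq> carrier (mpoly_ring ?V)" unfolding F_def by (rule base_change_closed[OF E])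
  define a where "a v = (if v \<in> ?V then cls ?V F (Var v) else \<one>\<^bsub>?R\<^esub>)" for v
  interpret R: cring ?R by (rule cring_coord_ring[OF E'])
  interpret K: evaluation ?R "\<lambda>c. cls ?V F (Const c)" a
    by standard (auto simp: a_def cls_Const_ring_hom[OF E'] intro!: cls_closed Var_closed)
  have Z: "evaluation ?R (\<lambda>z::int. cls ?V F (Const (of_int z))) a"
    by (rule K.evaluation_int)
  have K: "cls ?V F p = K.ev p" if "p \<in> carrier (mpoly_ring ?V)" for p
    using that by (intro K.ev_unique[OF cls_ring_hom[OF E']]) (auto simp: a_def)
  have "evaluation.ev ?R (\<lambda>z::int. cls ?V F (Const (of_int z))) a e = \<zero>\<^bsub>?R\<^esub>" if e: "e \<in> B_eqs n" for e
  proof -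
    have e': "Poly_Mapping.map of_int e \<in> F" using e BE by (auto simp: F_def base_change_def)
    have "evaluation.ev ?R (\<lambda>z::int. cls ?V F (Const (of_int z))) a e = K.ev (Poly_Mapping.map of_int e)"
      by (rule K.ev_of_int[symmetric])
    also have "\<dots> = cls ?V F (Poly_Mapping.map of_int e)" using K e' E' by blast
    also have "\<dots> = \<zero>\<^bsub>?R\<^esub>" by (rule cls_eq_zero[OF E' e'])
    finally show ?thesis .
  qed
  then have "is_table n ?R (\<lambda>i j l. a (SC i j l)) (\<lambda>i. a (UC i))"
    using ev_B_eqs_iff[OF Z] by blast
  then show ?thesis
    by (rule is_table_cong[OF _ _ R.is_cring, rotated 2]) (auto simp: a_def B_vars_def)
qed

lemma universal_based:
  assumes E: "E \<subseteq> carrier (mpoly_ring (B_vars n))" and BE: "B_eqs n \<subseteq> E"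
  shows "based_algebra n (coord_ring (B_vars n) (base_change E :: (coord, 'k::comm_ring_1) mpoly set))
    (universal_alg n (base_change E)) (\<lambda>x. x)"
  unfolding universal_alg_def
  by (rule based_table_alg[OF cring_coord_ring[OF base_change_closed[OF E]] universal_table[OF E BE]])

lemma universal_classifies:
  fixes E :: "(coord, int) mpoly set" and n :: nat and T :: "('t, 'm) ring_scheme" and h :: "'k::comm_ring_1 \<Rightarrow> 't"
  defines "F \<equiv> base_change E :: (coord, 'k) mpoly set"
  assumes E: "E \<subseteq> carrier (mpoly_ring (B_vars n))" and BE: "B_eqs n \<subseteq> E"
    and T: "cring T" and h: "h \<in> ring_hom type_ring T" and A: "based_algebra n T A \<phi>"
    and van: "\<And>a e. (\<And>v. a v \<in> carrier T) \<Longrightarrow> (\<And>i. i < n \<Longrightarrow> a (UC i) = \<phi> \<one>\<^bsub>A\<^esub> i) \<Longrightarrow> e \<in> E - B_eqs n \<Longrightarrow>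
      evaluation.ev T (\<lambda>z::int. h (of_int z)) a e = \<zero>\<^bsub>T\<^esub>"
  shows "\<exists>!f. f \<in> ring_hom (coord_ring (B_vars n) F) T \<inter> extensional (carrier (coord_ring (B_vars n) F))
    \<and> (\<forall>c. f (cls (B_vars n) F (Const c)) = h c)
    \<and> is_pullback n f (coord_ring (B_vars n) F) (universal_alg n F) (\<lambda>x. x) A \<phi>"
proof -
  interpret cring T by (rule T)
  interpret A: based n T A \<phi> by (rule based.intro[OF A])
  let ?V = "B_vars n"
  let ?R = "coord_ring ?V F"
  let ?P = "\<lambda>f. f \<in> ring_hom ?R T \<inter> extensional (carrier ?R) \<and> (\<forall>c. f (cls ?V F (Const c)) = h c)"
  have E': "F \<subseteq> carrier (mpoly_ring ?V)" unfolding F_def by (rule base_change_closed[OF E])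
  have R: "cring ?R" by (rule cring_coord_ring[OF E'])
  have tab: "is_table n ?R (\<lambda>i j l. cls ?V F (Var (SC i j l))) (\<lambda>i. cls ?V F (Var (UC i)))"
    unfolding F_def by (rule universal_table[OF E BE])
  have ub: "based_algebra n ?R (universal_alg n F) (\<lambda>x. x)"
    unfolding F_def by (rule universal_based[OF E BE])
  define a where "a v = (case v of SC i j l \<Rightarrow> if l < n then A.c i j l else \<one>\<^bsub>T\<^esub>
    | UC i \<Rightarrow> if i < n then \<phi> \<one>\<^bsub>A\<^esub> i else \<one>\<^bsub>T\<^esub>)" for v
  have a_cl: "a v \<in> carrier T" for v
    by (auto simp: a_def A.c_closed A.phi_closed split: coord.split)
  interpret K: evaluation T h a
    by unfold_locales (rule h, rule a_cl)
  have Z: "evaluation T (\<lambda>z::int. h (of_int z)) a" by (rule K.evaluation_int)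
  have "is_table n T (\<lambda>i j l. a (SC i j l)) (\<lambda>i. a (UC i))"
    by (rule is_table_cong[OF _ _ T A.is_table]) (auto simp: a_def)
  then have "evaluation.ev T (\<lambda>z::int. h (of_int z)) a e = \<zero>\<^bsub>T\<^esub>" if "e \<in> E" for e
    using ev_B_eqs_iff[OF Z, of n] van[of a e, OF a_cl] that by (auto simp: a_def)
  then have van': "K.ev e = \<zero>\<^bsub>T\<^esub>" if "e \<in> F" for e
    using that K.ev_of_int by (auto simp: F_def base_change_def)
  have pb: "is_pullback n f ?R (universal_alg n F) (\<lambda>x. x) A \<phi> \<longleftrightarrow> (\<forall>v\<in>?V. f (cls ?V F (Var v)) = a v)"
    if "f \<in> ring_hom ?R T" for f
  proof -
    have "struct_const n ?R (universal_alg n F) (\<lambda>x. x) i j l = cls ?V F (Var (SC i j l))" if "i < n" "j < n" "l < n" for i j l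
      unfolding universal_alg_def by (rule struct_const_table_alg[OF R tab that])
    moreover have "\<one>\<^bsub>universal_alg n F\<^esub> i = cls ?V F (Var (UC i))" if "i < n" for i
      unfolding universal_alg_def by (rule one_table_alg[OF that])
    ultimately show ?thesis
      unfolding pullback_iff[OF ub A that] by (auto simp: B_vars_def a_def)
  qed
  have uniq: "f (cls ?V F p) = K.ev p" if "?P f" "\<forall>v\<in>?V. f (cls ?V F (Var v)) = a v" "p \<in> carrier (mpoly_ring ?V)" for f p
    using that by (intro K.factor_ev[OF E']) auto
  show ?thesis
  proof (rule ex_ex1I)
    from K.factor_ex[OF E' van'] obtain f where f: "f \<in> ring_hom ?R T"
      "\<And>p. p \<in> carrier (mpoly_ring ?V) \<Longrightarrow> f (cls ?V F p) = K.ev p" by blast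
    let ?f = "restrict f (carrier ?R)"
    have r: "?f \<in> ring_hom ?R T"
      using ring.ring_hom_restrict[OF cring.axioms(1)[OF R] f(1), of ?f] by simp
    have rf: "?f (cls ?V F p) = K.ev p" if "p \<in> carrier (mpoly_ring ?V)" for p
      using cls_closed[OF that] f(2)[OF that] by simp
    have "is_pullback n ?f ?R (universal_alg n F) (\<lambda>x. x) A \<phi>"
      unfolding pb[OF r] using rf[OF Var_closed] K.ev_Var by simp
    moreover have "?f (cls ?V F (Const c)) = h c" for c
      using rf[OF Const_closed] K.ev_Const by simp
    ultimately show "\<exists>f. f \<in> ring_hom ?R T \<inter> extensional (carrier ?R) \<and> (\<forall>c. f (cls ?V F (Const c)) = h c)
        \<and> is_pullback n f ?R (universal_alg n F) (\<lambda>x. x) A \<phi>"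
      using r restrict_extensional[of f "carrier ?R"] by blast
  next
    fix f1 f2
    assume f1: "f1 \<in> ring_hom ?R T \<inter> extensional (carrier ?R) \<and> (\<forall>c. f1 (cls ?V F (Const c)) = h c)
        \<and> is_pullback n f1 ?R (universal_alg n F) (\<lambda>x. x) A \<phi>"
      and f2: "f2 \<in> ring_hom ?R T \<inter> extensional (carrier ?R) \<and> (\<forall>c. f2 (cls ?V F (Const c)) = h c)
        \<and> is_pullback n f2 ?R (universal_alg n F) (\<lambda>x. x) A \<phi>"
    have v1: "\<forall>v\<in>?V. f1 (cls ?V F (Var v)) = a v" using f1 pb[of f1] by blast
    have v2: "\<forall>v\<in>?V. f2 (cls ?V F (Var v)) = a v" using f2 pb[of f2] by blast
    have "f1 X = f2 X" if "X \<in> carrier ?R" for X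
    proof -
      from that obtain p where p: "p \<in> carrier (mpoly_ring ?V)" "X = cls ?V F p" by (rule coord_ring_cases)
      show ?thesis using uniq[of f1 p] uniq[of f2 p] f1 f2 v1 v2 p by auto
    qed
    then show "f1 = f2" using f1 f2 extensionalityI[of f1 "carrier ?R" f2] by blast
  qed
qed

text \<open>\<open>B_represents\<close>: for every ring homomorphism \<open>h : k \<rightarrow> T\<close>, every based algebra over \<open>T\<close> is the
  pullback of the universal one along exactly one \<open>f\<close> that extends \<open>h\<close>.  Together with
  \<open>pullback_exists\<close> and \<open>pullback_unique\<close>, the \<open>k\<close>-algebra homomorphisms to \<open>T\<close> thus
  correspond to the isomorphism classes of based algebras over \<open>T\<close>.  Here \<open>k\<close> may be any
  commutative ring; \<open>k = \<int>\<close> is the case of \<open>\<BB>\<^sub>n\<close> (see \<open>base_change_int\<close>).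
  Affine test schemes suffice: both sides are Zariski sheaves, as based algebras have no
  nontrivial automorphisms.\<close>

abbreviation B_scalar :: "nat \<Rightarrow> 'k \<Rightarrow> (coord, 'k::comm_ring_1) mpoly set" where
  "B_scalar n c \<equiv> cls (B_vars n) (base_change (B_eqs n)) (Const c)"

abbreviation B_universal :: "nat \<Rightarrow> ((coord, 'k::comm_ring_1) mpoly set, nat \<Rightarrow> (coord, 'k) mpoly set) module" where
  "B_universal n \<equiv> universal_alg n (base_change (B_eqs n))"

theorem B_universal_based: "based_algebra n (B_ring n :: (coord, 'k::comm_ring_1) mpoly set ring) (B_universal n) (\<lambda>x. x)"
  unfolding B_ring_def by (rule universal_based[OF B_eqs_closed]) simp

theorem B_represents:
  fixes h :: "'k::comm_ring_1 \<Rightarrow> 't"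
  assumes "cring T" and "h \<in> ring_hom type_ring T" and "based_algebra n T A \<phi>"
  shows "\<exists>!f. f \<in> ring_hom (B_ring n) T \<inter> extensional (carrier (B_ring n))
    \<and> (\<forall>c. f (B_scalar n c) = h c)
    \<and> is_pullback n f (B_ring n) (B_universal n) (\<lambda>x. x) A \<phi>"
  unfolding B_ring_def by (rule universal_classifies[OF B_eqs_closed _ assms]) auto

abbreviation B1_scalar :: "nat \<Rightarrow> 'k \<Rightarrow> (coord, 'k::comm_ring_1) mpoly set" where
  "B1_scalar n c \<equiv> cls (B_vars n) (base_change (B1_eqs n)) (Const c)"

abbreviation B1_universal :: "nat \<Rightarrow> ((coord, 'k::comm_ring_1) mpoly set, nat \<Rightarrow> (coord, 'k) mpoly set) module" where
  "B1_universal n \<equiv> universal_alg n (base_change (B1_eqs n))"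

definition based_algebra1 ::
  "nat \<Rightarrow> ('t, 'm) ring_scheme \<Rightarrow> ('t, 'a, 'p) module_scheme \<Rightarrow> ('a \<Rightarrow> nat \<Rightarrow> 't) \<Rightarrow> bool" where
  "based_algebra1 n T A \<phi> \<longleftrightarrow> based_algebra n T A \<phi> \<and> (n \<ge> 1 \<longrightarrow> \<phi> \<one>\<^bsub>A\<^esub> = unit_vec n T 0)"

theorem B1_universal_based:
  "based_algebra1 n (B1_ring n :: (coord, 'k::comm_ring_1) mpoly set ring) (B1_universal n) (\<lambda>x. x)"
proof -
  let ?V = "B_vars n" and ?F = "base_change (B1_eqs n) :: (coord, 'k) mpoly set"
  let ?R = "coord_ring ?V ?F"
  note E' = base_change_closed[OF B1_eqs_closed]
  have uc: "cls ?V ?F (Var (UC i)) = (if i = 0 then \<one>\<^bsub>?R\<^esub> else \<zero>\<^bsub>?R\<^esub>)" if "i < n" for i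
  proof -
    interpret R: cring ?R by (rule cring_coord_ring[OF E'])
    define a where "a v = (if v \<in> ?V then cls ?V ?F (Var v) else \<one>\<^bsub>?R\<^esub>)" for v
    interpret K: evaluation ?R "\<lambda>c. cls ?V ?F (Const c)" a
      by standard (auto simp: a_def cls_Const_ring_hom[OF E'] intro!: cls_closed Var_closed)
    interpret Z: evaluation ?R "\<lambda>z::int. cls ?V ?F (Const (of_int z))" a
      by (rule K.evaluation_int)
    have K: "cls ?V ?F p = K.ev p" if "p \<in> carrier (mpoly_ring ?V)" for p
      using that by (intro K.ev_unique[OF cls_ring_hom[OF E']]) (auto simp: a_def)
    define e :: "(coord, int) mpoly" where "e = Var (UC i) - (if i = 0 then 1 else 0)"
    have "e \<in> B1_eqs n" using that unfolding B1_eqs_def e_def by blast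
    then have e': "Poly_Mapping.map of_int e \<in> ?F" unfolding base_change_def by blast
    have "Z.ev e = K.ev (Poly_Mapping.map of_int e)" by (rule K.ev_of_int[symmetric])
    also have "\<dots> = cls ?V ?F (Poly_Mapping.map of_int e)" using K e' E' by blast
    also have "\<dots> = \<zero>\<^bsub>?R\<^esub>" by (rule cls_eq_zero[OF E' e'])
    finally have "a (UC i) = (if i = 0 then \<one>\<^bsub>?R\<^esub> else \<zero>\<^bsub>?R\<^esub>)"
      using Z.a[of "UC i"] by (auto simp: e_def Z.ev_diff Z.ev_Var Z.ev_1 Z.ev_0 R.diff_eq_zero_iff split: if_splits)
    then show ?thesis using that by (auto simp: a_def B_vars_def)
  qed
  have sub: "B_eqs n \<subseteq> B1_eqs n" unfolding B1_eqs_def by (rule Un_upper1)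
  have "\<one>\<^bsub>universal_alg n ?F\<^esub> = unit_vec n ?R 0"
    using uc by (auto simp: universal_alg_def table_alg_def unit_vec_def restrict_def fun_eq_iff)
  then show ?thesis
    unfolding based_algebra1_def B1_ring_def
    using universal_based[OF B1_eqs_closed sub] by simp
qed

theorem B1_represents:
  fixes h :: "'k::comm_ring_1 \<Rightarrow> 't" and T :: "('t, 'm) ring_scheme"
  assumes T: "cring T" and h: "h \<in> ring_hom type_ring T" and A: "based_algebra1 n T A \<phi>"
  shows "\<exists>!f. f \<in> ring_hom (B1_ring n) T \<inter> extensional (carrier (B1_ring n))
    \<and> (\<forall>c. f (B1_scalar n c) = h c)
    \<and> is_pullback n f (B1_ring n) (B1_universal n) (\<lambda>x. x) A \<phi>"
  unfolding B1_ring_def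
proof (rule universal_classifies[OF B1_eqs_closed _ T h])
  interpret cring T by (rule T)
  show "B_eqs n \<subseteq> B1_eqs n" by (auto simp: B1_eqs_def)
  show "based_algebra n T A \<phi>" using A by (simp add: based_algebra1_def)
  fix a :: "coord \<Rightarrow> 't" and e
  assume a: "\<And>v. a v \<in> carrier T" and u: "\<And>i. i < n \<Longrightarrow> a (UC i) = \<phi> \<one>\<^bsub>A\<^esub> i" and e: "e \<in> B1_eqs n - B_eqs n"
  interpret K: evaluation T h a by unfold_locales (rule h, rule a)
  interpret Z: evaluation T "\<lambda>z::int. h (of_int z)" a by (rule K.evaluation_int)
  from e obtain i where i: "i < n" "e = Var (UC i) - (if i = 0 then 1 else 0)"
    by (auto simp: B1_eqs_def)
  have "a (UC i) = (if i = 0 then \<one>\<^bsub>T\<^esub> else \<zero>\<^bsub>T\<^esub>)"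
    using u[OF i(1)] A i(1) by (simp add: based_algebra1_def unit_vec_def)
  then show "Z.ev e = \<zero>\<^bsub>T\<^esub>"
    using i by (simp add: Z.ev_diff Z.ev_Var Z.ev_1 Z.ev_0 diff_eq_zero_iff)
qed


text \<open>Pullbacks of based algebras exist and are unique up to isomorphism.\<close>

lemma pullback_exists:
  assumes A: "based_algebra n T A \<phi>" and T': "cring T'" and f: "f \<in> ring_hom T T'"
  shows "\<exists>(A' :: ('s, nat \<Rightarrow> 's) module) \<phi>'. based_algebra n T' A' \<phi>' \<and> is_pullback n f T A \<phi> A' \<phi>'"
proof -
  interpret A: based n T A \<phi> by (rule based.intro[OF A])
  interpret T': cring T' by (rule T')
  interpret F: ring_hom_cring T T' f
    using f A.alg.R.cring_axioms T' by (simp add: ring_hom_cring_def ring_hom_cring_axioms_def)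
  let ?c = "\<lambda>i j l. f (A.c i j l)" and ?u = "\<lambda>i. f (\<phi> \<one>\<^bsub>A\<^esub> i)"
  note d = is_tableD[OF A.is_table]
  have sum: "(\<Oplus>\<^bsub>T'\<^esub>m\<in>{..<n}. f (x m) \<otimes>\<^bsub>T'\<^esub> f (y m)) = f (\<Oplus>\<^bsub>T\<^esub>m\<in>{..<n}. x m \<otimes>\<^bsub>T\<^esub> y m)"
    if "\<And>m. m < n \<Longrightarrow> x m \<in> carrier T" "\<And>m. m < n \<Longrightarrow> y m \<in> carrier T" for x y
  proof -
    have "f (\<Oplus>\<^bsub>T\<^esub>m\<in>{..<n}. x m \<otimes>\<^bsub>T\<^esub> y m) = (\<Oplus>\<^bsub>T'\<^esub>m\<in>{..<n}. f (x m \<otimes>\<^bsub>T\<^esub> y m))"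
      using that by (subst F.hom_finsum) (auto simp: comp_def)
    also have "\<dots> = (\<Oplus>\<^bsub>T'\<^esub>m\<in>{..<n}. f (x m) \<otimes>\<^bsub>T'\<^esub> f (y m))"
      using that by (intro T'.S_cong) auto
    finally show ?thesis ..
  qed
  have tab: "is_table n T' ?c ?u"
    unfolding is_table_def
  proof (intro conjI allI impI)
    fix i j l p assume "i < n" "j < n" "l < n" "p < n"
    then show "(\<Oplus>\<^bsub>T'\<^esub>m\<in>{..<n}. ?c i j m \<otimes>\<^bsub>T'\<^esub> ?c m l p) = (\<Oplus>\<^bsub>T'\<^esub>m\<in>{..<n}. ?c j l m \<otimes>\<^bsub>T'\<^esub> ?c i m p)"
      using d(4)[of i j l p] by (simp add: sum A.c_closed)
  next
    fix j l assume "j < n" "l < n"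
    then show "(\<Oplus>\<^bsub>T'\<^esub>i\<in>{..<n}. ?u i \<otimes>\<^bsub>T'\<^esub> ?c i j l) = (if j = l then \<one>\<^bsub>T'\<^esub> else \<zero>\<^bsub>T'\<^esub>)"
      using d(5)[of j l] by (simp add: sum A.c_closed A.phi_closed)
  next
    fix i j l show "?c i j l = ?c j i l" by (simp only: A.c_comm[of i j])
  qed (auto simp: A.c_closed A.phi_closed)
  note b = based_table_alg[OF T' tab]
  have "is_pullback n f T A \<phi> (table_alg n T' ?c ?u) (\<lambda>x. x)"
    unfolding pullback_iff[OF A b f]
    by (auto simp: one_table_alg struct_const_table_alg[OF T' tab])
  with b show ?thesis by blast
qed

lemma pullback_unique:
  assumes A: "based_algebra n T A \<phi>" and f: "f \<in> ring_hom T T'"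
    and B: "based_algebra n T' B \<psi>" and B': "based_algebra n T' B' \<psi>'"
    and p: "is_pullback n f T A \<phi> B \<psi>"
  shows "is_pullback n f T A \<phi> B' \<psi>' \<longleftrightarrow> based_iso T' B \<psi> B' \<psi>'"
proof -
  have "(\<lambda>t. t) \<in> ring_hom T' T'" by (rule ring_hom_memI) auto
  then show ?thesis
    using p unfolding based_iso_iff[OF B B'] pullback_iff[OF A B f] pullback_iff[OF A B' f] 
    by (auto simp: pullback_iff[OF B B'])
qed


section \<open>The spectra are nonempty\<close>

text \<open>\<^const>\<open>connected_space\<close> holds of the empty space; the lemmas below show that no choice of
  convention is involved for the spectra at hand.\<close>

lemma finsum_type_ring: "finsum (type_ring :: 'k::comm_ring_1 ring) F I = sum F I"
proof -
  interpret cring "type_ring :: 'k ring" by (rule cring_type_ring)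
  show ?thesis by (induction I rule: infinite_finite_induct) auto
qed

lemma kernel_prime:
  assumes R: "cring R" and f: "f \<in> ring_hom R (type_ring :: 'k::field ring)"
  shows "primeideal (a_kernel R (type_ring :: 'k ring) f) R"
proof -
  interpret F: ring_hom_cring R "type_ring :: 'k ring" f
    using assms cring_type_ring by (simp add: ring_hom_cring_def ring_hom_cring_axioms_def)
  have k: "x \<in> a_kernel R (type_ring :: 'k ring) f \<longleftrightarrow> x \<in> carrier R \<and> f x = 0" for x
    unfolding a_kernel_def' by simp
  show ?thesis
  proof (rule primeidealI)
    show "ideal (a_kernel R (type_ring :: 'k ring) f) R" 
      using ring_hom_ring.kernel_is_ideal[OF ring_hom_ringI2[OF F.R.ring_axioms F.S.ring_axioms f]] .
    show "carrier R \<noteq> a_kernel R (type_ring :: 'k ring) f"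
      using k[of "\<one>\<^bsub>R\<^esub>"] F.hom_one by auto
    fix x y assume "x \<in> carrier R" "y \<in> carrier R" "x \<otimes>\<^bsub>R\<^esub> y \<in> a_kernel R (type_ring :: 'k ring) f"
    then show "x \<in> a_kernel R (type_ring :: 'k ring) f \<or> y \<in> a_kernel R (type_ring :: 'k ring) f"
      unfolding k using F.hom_mult[of x y] by auto
  qed (rule R)
qed

lemma trivial_based_algebra1:
  "\<exists>(A :: ('k::field, nat \<Rightarrow> 'k) module) \<phi>. based_algebra1 n type_ring A \<phi>"
proof -
  define c :: "nat \<Rightarrow> nat \<Rightarrow> nat \<Rightarrow> 'k" where
    "c i j l = (if i = 0 then (if l = j then 1 else 0) else if j = 0 then (if l = i then 1 else 0) else 0)" for i j l
  define u :: "nat \<Rightarrow> 'k" where "u i = (if i = 0 then 1 else 0)" for i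
  have "(\<Sum>m<n. c i j m * c m l p) = (\<Sum>m<n. c j l m * c i m p)" if "i < n" "j < n" "l < n" "p < n" for i j l p
  proof -
    have "(\<Sum>m<n. (if m = k then 1 else 0) * g m) = g k" "(\<Sum>m<n. g m * (if m = k then 1 else 0)) = g k"
      if "k < n" for k and g :: "nat \<Rightarrow> 'k"
      using that by (simp_all add: if_distrib[of "\<lambda>x. x * _"] if_distrib[of "\<lambda>x. _ * x"] sum.delta cong: if_cong)
    then show ?thesis using that
      by (cases "i = 0"; cases "j = 0"; cases "l = 0") (simp_all add: c_def)
  qed
  moreover have "(\<Sum>i<n. u i * c i j l) = (if j = l then 1 else 0)" if "j < n" "l < n" for j l
  proof -
    have "(\<Sum>i<n. u i * c i j l) = (\<Sum>i<n. if i = 0 then c 0 j l else 0)"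
      by (rule sum.cong) (auto simp: u_def)
    also have "\<dots> = c 0 j l" using that by (simp add: sum.delta)
    finally show ?thesis by (simp add: c_def)
  qed
  ultimately have tab: "is_table n type_ring c u"
    unfolding is_table_def by (auto simp: finsum_type_ring c_def[of _ _ _])
  have "based_algebra1 n type_ring (table_alg n type_ring c u) (\<lambda>x. x)"
    using based_table_alg[OF cring_type_ring tab]
    by (auto simp: based_algebra1_def table_alg_def unit_vec_def u_def restrict_def fun_eq_iff)
  then show ?thesis by blast
qed

lemma Spec_B1_nonempty: "topspace (Spec (B1_ring n :: (coord, 'k::field) mpoly set ring)) \<noteq> {}"
  and Spec_B_nonempty: "topspace (Spec (B_ring n :: (coord, 'k) mpoly set ring)) \<noteq> {}"
proof -
  obtain A :: "('k, nat \<Rightarrow> 'k) module" and \<phi> where A: "based_algebra1 n type_ring A \<phi>"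
    using trivial_based_algebra1 by blast
  have id: "(\<lambda>x. x) \<in> ring_hom (type_ring :: 'k ring) type_ring" by (rule ring_hom_memI) auto
  have "\<exists>f. f \<in> ring_hom (B1_ring n :: (coord, 'k) mpoly set ring) (type_ring :: 'k ring)"
    using B1_represents[OF cring_type_ring id A] by blast
  moreover have "cring (B1_ring n :: (coord, 'k) mpoly set ring)"
    unfolding B1_ring_def by (rule cring_coord_ring[OF base_change_closed[OF B1_eqs_closed]])
  ultimately show "topspace (Spec (B1_ring n :: (coord, 'k) mpoly set ring)) \<noteq> {}"
    using kernel_prime by (auto simp: topspace_Spec)
  have "\<exists>f. f \<in> ring_hom (B_ring n :: (coord, 'k) mpoly set ring) (type_ring :: 'k ring)"
    using B_represents[OF cring_type_ring id] A unfolding based_algebra1_def by blast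
  moreover have "cring (B_ring n :: (coord, 'k) mpoly set ring)"
    unfolding B_ring_def by (rule cring_coord_ring[OF base_change_closed[OF B_eqs_closed]])
  ultimately show "topspace (Spec (B_ring n :: (coord, 'k) mpoly set ring)) \<noteq> {}"
    using kernel_prime by (auto simp: topspace_Spec)
qed

end

theory Submission
  imports Defs "HOL-Algebra.UnivPoly" "HOL-Algebra.Ring_Divisibility"
    "HOL-Computational_Algebra.Polynomial_Factorial"
begin

text \<open>Nested primes lie in the same clopen sets, and the kernel of a homomorphism from the
  coordinate ring to \<open>D[t]\<close>, \<open>D\<close> a domain, is contained in the kernels of its specialisations at all
  values of \<open>t\<close>.  So a family of based algebras over \<open>D[t]\<close> ties its members at \<open>t = 0\<close> and
  \<open>t = 1\<close> together.  If the first basis vector is \<open>1\<close>, multiplying the others by \<open>t\<close> contracts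
  every algebra to the one with \<open>e\<^sub>i e\<^sub>j = 0\<close> for \<open>i, j > 0\<close>.  In the general case one
  specialises to a maximal ideal; over its residue field, for \<open>n \<ge> 2\<close>, at most two shears
  \<open>x \<mapsto> x + t \<lambda>(x) v\<close> with \<open>\<lambda>(v) = 0\<close> bring the coordinates of the unit to \<open>(1, 0, \<dots>, 0)\<close>.
  These have polynomial inverses, so no localisation of \<open>D[t]\<close> is needed.  Shears are trivial
  for \<open>n = 1\<close>, where the scheme is the irreducible multiplicative group.\<close>

section \<open>Points of a spectrum that no clopen set separates\<close>

text \<open>Membership in a common quasi-component. Being an equivalence relation, it lets
  inclusions between primes be chained in either direction.\<close>

definition linked :: "'a topology \<Rightarrow> 'a \<Rightarrow> 'a \<Rightarrow> bool" where
  "linked X x y \<longleftrightarrow> (\<forall>U. openin X U \<and> closedin X U \<longrightarrow> (x \<in> U \<longleftrightarrow> y \<in> U))"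

lemma linked_sym: "linked X x y \<Longrightarrow> linked X y x"
  by (auto simp: linked_def)

lemma linked_trans: "linked X x y \<Longrightarrow> linked X y z \<Longrightarrow> linked X x z"
  by (auto simp: linked_def)

lemma connected_space_if_linked:
  assumes "\<And>x. x \<in> topspace X \<Longrightarrow> linked X x m"
  shows "connected_space X"
  unfolding connected_space_clopen_in
proof (intro allI impI)
  fix U assume U: "openin X U \<and> closedin X U"
  then have "x \<in> U \<longleftrightarrow> m \<in> U" if "x \<in> topspace X" for x
    using assms[OF that] by (simp add: linked_def)
  then show "U = {} \<or> U = topspace X"
    using openin_subset[of X U] U by blast
qed

text \<open>\<open>Q\<close> lies in the closure of \<open>P\<close>, so every open set containing
  \<open>Q\<close> contains \<open>P\<close>. For a clopen set the same applies to its
  complement.\<close>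

lemma linked_Spec_subset:
  assumes P: "primeideal P R" and Q: "primeideal Q R" and "P \<subseteq> Q"
  shows "linked (Spec R) P Q"
proof -
  have gen: "P \<in> U" if "openin (Spec R) U" "Q \<in> U" for U
    using that assms by (auto simp: openin_Spec)
  show ?thesis
    unfolding linked_def
  proof (intro allI impI iffI)
    fix U assume U: "openin (Spec R) U \<and> closedin (Spec R) U"
    then have "openin (Spec R) (topspace (Spec R) - U)" by blast
    then show "P \<in> U \<Longrightarrow> Q \<in> U" using gen[of "topspace (Spec R) - U"] Q by (auto simp: topspace_Spec)
    show "Q \<in> U \<Longrightarrow> P \<in> U" using gen U by blast
  qed
qed

text \<open>Zorn's lemma for the ideals above \<open>I\<close> that omit \<open>\<one>\<close>; in
  this form properness visibly survives unions of nonempty chains.\<close>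

lemma (in cring) exists_maximalideal:
  assumes I: "ideal I R" "\<one> \<notin> I"
  shows "\<exists>M. maximalideal M R \<and> I \<subseteq> M"
proof -
  define S where "S = {J. ideal J R \<and> \<one> \<notin> J \<and> I \<subseteq> J}"
  have "\<exists>M\<in>S. \<forall>J\<in>S. M \<subseteq> J \<longrightarrow> J = M"
  proof (rule subset_Zorn)
    fix C assume C: "subset.chain S C"
    show "\<exists>U\<in>S. \<forall>J\<in>C. J \<subseteq> U"
    proof (cases "C = {}")
      case True
      then show ?thesis using I by (auto simp: S_def)
    next
      case False
      have "subset.chain {J. ideal J R} C"
        using C by (auto simp: pred_on.chain_def S_def)
      then have "ideal (\<Union>C) R" using chain_Union_is_ideal[of C] False by simp
      moreover have "C \<subseteq> S" using C by (simp add: pred_on.chain_def)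
      ultimately have "\<Union>C \<in> S" using False by (auto simp: S_def)
      then show ?thesis by blast
    qed
  qed
  then obtain M where M: "M \<in> S" "\<And>J. J \<in> S \<Longrightarrow> M \<subseteq> J \<Longrightarrow> J = M" by blast
  have "maximalideal M R"
  proof (rule maximalidealI)
    show "ideal M R" "carrier R \<noteq> M" using M(1) one_closed by (auto simp: S_def)
    fix J assume J: "ideal J R" "M \<subseteq> J" "J \<subseteq> carrier R"
    show "J = M \<or> J = carrier R"
    proof (cases "\<one> \<in> J")
      case True
      then show ?thesis using ideal.one_imp_carrier[OF J(1)] by blast
    next
      case False
      then have "J \<in> S" using J M(1) by (auto simp: S_def)
      then show ?thesis using M(2) J(2) by blast
    qed
  qed
  then show ?thesis using M(1) by (auto simp: S_def)
qed

section \<open>Points with values in a domain\<close>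

text \<open>For a solution \<open>a\<close> this is the kernel of the induced homomorphism from
  \<open>coord_ring V E\<close> to \<open>T\<close>, i.e. the place in the spectrum of a
  \<open>T\<close>-valued point. Listing classes of polynomials avoids choosing that
  homomorphism.\<close>

definition point ::
  "'v set \<Rightarrow> ('v, 'k::comm_ring_1) mpoly set \<Rightarrow> ('t, 'm) ring_scheme \<Rightarrow> ('k \<Rightarrow> 't) \<Rightarrow> ('v \<Rightarrow> 't) \<Rightarrow> ('v, 'k) mpoly set set"
  where "point V E T h a = {cls V E p | p. p \<in> carrier (mpoly_ring V) \<and> evaluation.ev T h a p = \<zero>\<^bsub>T\<^esub>}"

text \<open>A \<open>T\<close>-valued point in coordinates: \<open>h\<close> makes \<open>T\<close>
  an algebra over the coefficients, and \<open>a\<close> gives the values of the variables.\<close>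

definition solution ::
  "('v, 'k::comm_ring_1) mpoly set \<Rightarrow> ('t, 'm) ring_scheme \<Rightarrow> ('k \<Rightarrow> 't) \<Rightarrow> ('v \<Rightarrow> 't) \<Rightarrow> bool"
  where "solution E T h a \<longleftrightarrow> evaluation T h a \<and> (\<forall>e\<in>E. evaluation.ev T h a e = \<zero>\<^bsub>T\<^esub>)"

text \<open>The evaluation factors through \<open>coord_ring V E\<close>, and the kernel of a
  homomorphism into a domain is prime.\<close>

lemma primeideal_point:
  assumes E: "E \<subseteq> carrier (mpoly_ring V)" and T: "domain T" and sol: "solution E T h a"
  shows "primeideal (point V E T h a) (coord_ring V E)"
proof -
  interpret T: "domain" T by (rule T)
  interpret evaluation T h a using sol by (simp add: solution_def)
  let ?S = "coord_ring V E"
  obtain f where f: "f \<in> ring_hom ?S T" "\<And>p. p \<in> carrier (mpoly_ring V) \<Longrightarrow> f (cls V E p) = ev p"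
    using factor_ex[OF E] sol unfolding solution_def by blast
  interpret S: cring ?S by (rule cring_coord_ring[OF E])
  interpret F: ring_hom_cring ?S T f
    using f T.is_cring S.is_cring by (simp add: ring_hom_cring_def ring_hom_cring_axioms_def)
  have pt: "point V E T h a = {x \<in> carrier ?S. f x = \<zero>\<^bsub>T\<^esub>}"
    using f(2) by (auto simp: point_def cls_closed elim!: coord_ring_cases)
  have "a_kernel ?S T f = {x \<in> carrier ?S. f x = \<zero>\<^bsub>T\<^esub>}"
    unfolding a_kernel_def' by blast
  then have pk: "point V E T h a = a_kernel ?S T f" using pt by simp
  show ?thesis
  proof (rule primeidealI)
    show "ideal (point V E T h a) ?S"
      unfolding pk using ring_hom_ring.kernel_is_ideal[OF ring_hom_ringI2[OF S.ring_axioms T.ring_axioms f(1)]] .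
    show "carrier ?S \<noteq> point V E T h a"
      using F.hom_one S.one_closed unfolding pt by force
    show "x \<in> point V E T h a \<or> y \<in> point V E T h a"
      if "x \<in> carrier ?S" "y \<in> carrier ?S" "x \<otimes>\<^bsub>?S\<^esub> y \<in> point V E T h a" for x y
      using that T.integral[of "f x" "f y"] F.hom_closed by (auto simp: pt)
  qed (rule S.is_cring)
qed

text \<open>Applying a homomorphism to the coordinates can only enlarge the kernel, so the second
  point lies in the closure of the first. The map \<open>f\<close> will be an evaluation of
  \<open>t\<close>, the inclusion of constants, or the structure map of an algebra.\<close>

locale specialisation = source: evaluation T h a + target: evaluation T' h' a'
  for T :: "('t, 'm) ring_scheme" and h :: "'k::comm_ring_1 \<Rightarrow> 't" and a :: "'v \<Rightarrow> 't"
    and T' :: "('s, 'l) ring_scheme" and h' :: "'k \<Rightarrow> 's" and a' :: "'v \<Rightarrow> 's" +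
  fixes f :: "'t \<Rightarrow> 's" and V :: "'v set"
  assumes hom: "f \<in> ring_hom T T'" and scalar: "f (h x) = h' x" and coords: "v \<in> V \<Longrightarrow> f (a v) = a' v"
begin

lemma ev_eq: "p \<in> carrier (mpoly_ring V) \<Longrightarrow> target.ev p = f (source.ev p)"
  using target.ev_unique[OF ring_hom_trans[OF source.ev_ring_hom hom], of V p]
  by (simp add: source.ev_Const source.ev_Var scalar coords)

lemma hom_zero: "f \<zero>\<^bsub>T\<^esub> = \<zero>\<^bsub>T'\<^esub>"
  using ring_hom_zero[OF hom source.ring_axioms target.ring_axioms] .

lemma solution_image:
  assumes "E \<subseteq> carrier (mpoly_ring V)" "solution E T h a"
  shows "solution E T' h' a'"
  using assms ev_eq hom_zero target.evaluation_axioms by (auto simp: solution_def subset_iff)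

lemma point_mono: "point V E T h a \<subseteq> point V E T' h' a'"
  using ev_eq hom_zero by (auto simp: point_def)

text \<open>An injective \<open>f\<close> leaves the kernel unchanged, so a point does not depend on
  how large a ring its coordinates are read in.\<close>

lemma point_eq:
  assumes "\<And>x. x \<in> carrier T \<Longrightarrow> f x = \<zero>\<^bsub>T'\<^esub> \<Longrightarrow> x = \<zero>\<^bsub>T\<^esub>"
  shows "point V E T h a = point V E T' h' a'"
  using ev_eq hom_zero assms[OF source.ev_closed] by (fastforce simp: point_def)

lemma linked_points:
  assumes "E \<subseteq> carrier (mpoly_ring V)" "solution E T h a" "domain T" "domain T'"
  shows "linked (Spec (coord_ring V E)) (point V E T h a) (point V E T' h' a')"
  using assms by (intro linked_Spec_subset primeideal_point solution_image point_mono)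

end

text \<open>A prime is the kernel of the projection to its own quotient; its coordinates are the
  classes of the variables. Questions about arbitrary points thereby become questions about
  solutions over a domain.\<close>

lemma primeideal_is_point:
  fixes E :: "('v, 'k::comm_ring_1) mpoly set"
  assumes E: "E \<subseteq> carrier (mpoly_ring V)" and P: "primeideal P (coord_ring V E)"
  defines "T \<equiv> coord_ring V E Quot P"
  shows "\<exists>h a. solution E T h a \<and> point V E T h a = P"
proof -
  let ?S = "coord_ring V E"
  interpret P: primeideal P ?S by (rule P)
  interpret T: cring T unfolding T_def by (rule P.quotient_is_cring[OF P.is_cring])
  let ?q = "\<lambda>x. P +>\<^bsub>?S\<^esub> x"
  define h :: "'k \<Rightarrow> ('v, 'k) mpoly set set" where "h c = ?q (cls V E (Const c))" for c
  \<comment> \<open>\<open>evaluation\<close> wants a total assignment; zero is the filler outside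
    \<open>V\<close>.\<close>
  define a :: "'v \<Rightarrow> ('v, 'k) mpoly set set" where "a v = (if v \<in> V then ?q (cls V E (Var v)) else \<zero>\<^bsub>T\<^esub>)" for v
  have q: "?q \<in> ring_hom ?S T" unfolding T_def by (rule P.rcos_ring_hom)
  interpret evaluation T h a
  proof
    show "h \<in> ring_hom type_ring T"
      using ring_hom_trans[OF cls_Const_ring_hom[OF E] q] by (simp add: comp_def h_def[abs_def])
    show "a v \<in> carrier T" for v
      using ring_hom_closed[OF q cls_closed[OF Var_closed]] by (simp add: a_def)
  qed
  have ev: "ev p = ?q (cls V E p)" if "p \<in> carrier (mpoly_ring V)" for p
    using ev_unique[OF ring_hom_trans[OF cls_ring_hom[OF E] q] _ _ that] by (simp add: h_def a_def)
  have zero: "\<zero>\<^bsub>T\<^esub> = P" by (simp add: T_def FactRing_def)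
  have ev0: "ev p = \<zero>\<^bsub>T\<^esub> \<longleftrightarrow> cls V E p \<in> P" if "p \<in> carrier (mpoly_ring V)" for p
    using P.a_rcos_const P.a_rcos_self[OF cls_closed[OF that]] by (auto simp: ev[OF that] zero)
  have lift: "\<exists>p \<in> carrier (mpoly_ring V). X = cls V E p" if "X \<in> P" for X
    using that P.a_subset by (meson coord_ring_cases subsetD)
  have "solution E T h a"
    unfolding solution_def
  proof (intro conjI ballI)
    fix e assume e: "e \<in> E"
    show "ev e = \<zero>\<^bsub>T\<^esub>" using ev0[of e] E e by (auto simp: cls_eq_zero)
  qed (rule evaluation_axioms)
  moreover have "X \<in> point V E T h a \<longleftrightarrow> X \<in> P" for X
    using ev0 lift[of X] by (fastforce simp: point_def)
  ultimately show ?thesis by blast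
qed

section \<open>Families of tables over a polynomial ring\<close>

text \<open>The equations have integer coefficients, so they can be evaluated through the integers,
  where \<open>ev_B_eqs_iff\<close> turns them into \<open>is_table\<close>.\<close>

lemma solution_base_change_iff:
  assumes "evaluation T h a"
  shows "solution (base_change E) T h a \<longleftrightarrow>
    (\<forall>e\<in>E. evaluation.ev T (\<lambda>z::int. h (of_int z)) a e = \<zero>\<^bsub>T\<^esub>)"
  using assms evaluation.ev_of_int[OF assms] by (auto simp: solution_def base_change_def)

lemma solution_B_iff:
  assumes "evaluation T h a"
  shows "solution (base_change (B_eqs n)) T h a \<longleftrightarrow> is_table n T (\<lambda>i j l. a (SC i j l)) (\<lambda>i. a (UC i))"
  unfolding solution_base_change_iff[OF assms] by (rule ev_B_eqs_iff[OF evaluation.evaluation_int[OF assms]])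

lemma solution_B1_iff:
  assumes "evaluation T h a"
  shows "solution (base_change (B1_eqs n)) T h a \<longleftrightarrow> is_table n T (\<lambda>i j l. a (SC i j l)) (\<lambda>i. a (UC i))
    \<and> (\<forall>i<n. a (UC i) = (if i = 0 then \<one>\<^bsub>T\<^esub> else \<zero>\<^bsub>T\<^esub>))"
proof -
  interpret Z: evaluation T "\<lambda>z::int. h (of_int z)" a
    by (rule evaluation.evaluation_int[OF assms])
  have "Z.ev (Var (UC i) - (if i = 0 then 1 else 0)) = \<zero>\<^bsub>T\<^esub> \<longleftrightarrow> a (UC i) = (if i = 0 then \<one>\<^bsub>T\<^esub> else \<zero>\<^bsub>T\<^esub>)" for i
    using Z.a[of "UC i"] by (simp add: Z.ev_diff Z.ev_Var Z.ev_1 Z.ev_0 Z.diff_eq_zero_iff)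
  then show ?thesis
    unfolding solution_base_change_iff[OF assms] B1_eqs_def ball_Un ev_B_eqs_iff[OF Z.evaluation_axioms]
    by blast
qed

text \<open>The base of the one-parameter families: \<open>L\<close> is \<open>D[t]\<close>, with
  \<open>t\<close> the monomial of degree one, and \<open>eval D D id s\<close> is the
  specialisation at \<open>t = s\<close>, which fixes constants.\<close>

lemma polynomial_ring:
  assumes "domain D"
  defines "L \<equiv> UP D"
  shows "domain L" and "(\<lambda>r. up_ring.monom L r 0) \<in> ring_hom D L"
    and "up_ring.monom L \<one>\<^bsub>D\<^esub> 1 \<in> carrier L" and "up_ring.monom L \<one>\<^bsub>D\<^esub> 1 \<noteq> \<zero>\<^bsub>L\<^esub>"
    and "\<And>s. s \<in> carrier D \<Longrightarrow> eval D D id s \<in> ring_hom L D"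
    and "\<And>s r. s \<in> carrier D \<Longrightarrow> r \<in> carrier D \<Longrightarrow> eval D D id s (up_ring.monom L r 0) = r"
    and "\<And>s. s \<in> carrier D \<Longrightarrow> eval D D id s (up_ring.monom L \<one>\<^bsub>D\<^esub> 1) = s"
proof -
  interpret UP_domain D L unfolding L_def UP_domain_def using assms(1) .
  interpret U: UP_pre_univ_prop D D id L by unfold_locales (auto intro: ring_hom_memI simp: L_def)
  show "domain L" by (rule UP_domain)
  show "(\<lambda>r. up_ring.monom L r 0) \<in> ring_hom D L" by (rule const_ring_hom)
  show "up_ring.monom L \<one>\<^bsub>D\<^esub> 1 \<in> carrier L" by simp
  show "up_ring.monom L \<one>\<^bsub>D\<^esub> 1 \<noteq> \<zero>\<^bsub>L\<^esub>"
    by (metis coeff_monom coeff_zero R.one_closed R.one_not_zero)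
  show "eval D D id s \<in> ring_hom L D" if "s \<in> carrier D" for s
    by (rule U.eval_ring_hom[OF that])
  show "eval D D id s (up_ring.monom L r 0) = r" if "s \<in> carrier D" "r \<in> carrier D" for s r
    using U.eval_const[OF that] by simp
  show "eval D D id s (up_ring.monom L \<one>\<^bsub>D\<^esub> 1) = s" if "s \<in> carrier D" for s
    by (rule U.eval_monom1[OF that])
qed

text \<open>The \<open>g i\<close> need not be invertible: the rescaled table is that of the vectors \<open>g i \<cdot> e\<^sub>i\<close>, which
  are linearly independent but need not span.\<close>

lemma is_table_rescale:
  assumes "domain T" and tab: "is_table n T c u"
    and g: "\<And>i. i < n \<Longrightarrow> g i \<in> carrier T" "\<And>i. i < n \<Longrightarrow> g i \<noteq> \<zero>\<^bsub>T\<^esub>"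
    and c': "\<And>i j l. i < n \<Longrightarrow> j < n \<Longrightarrow> l < n \<Longrightarrow> c' i j l \<in> carrier T"
    and u': "\<And>i. i < n \<Longrightarrow> u' i \<in> carrier T"
    and cg: "\<And>i j l. i < n \<Longrightarrow> j < n \<Longrightarrow> l < n \<Longrightarrow> c' i j l \<otimes>\<^bsub>T\<^esub> g l = g i \<otimes>\<^bsub>T\<^esub> g j \<otimes>\<^bsub>T\<^esub> c i j l"
    and ug: "\<And>i. i < n \<Longrightarrow> u' i \<otimes>\<^bsub>T\<^esub> g i = u i"
  shows "is_table n T c' u'"
proof -
  interpret "domain" T by (rule assms(1))
  note d = is_tableD[OF tab]
  have cancel: "x = y" if "x \<otimes>\<^bsub>T\<^esub> g i = y \<otimes>\<^bsub>T\<^esub> g i" "i < n" "x \<in> carrier T" "y \<in> carrier T" for x y i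
    using that m_rcancel[OF g(2)[of i] g(1)[of i], of x y] by blast
  have comm: "c' i j l = c' j i l" if h: "i < n" "j < n" "l < n" for i j l
  proof (rule cancel[OF _ h(3)])
    show "c' i j l \<otimes>\<^bsub>T\<^esub> g l = c' j i l \<otimes>\<^bsub>T\<^esub> g l"
      using h d(3)[OF h] m_comm[of "g i" "g j"] by (simp add: cg g)
  qed (use h c' in auto)
  \<comment> \<open>Multiplied by \<open>g p\<close>, an associativity sum of the new table becomes
    a multiple of the corresponding sum of the old one; afterwards \<open>g p\<close> is cancelled
    in the domain.\<close>
  have prod: "(\<Oplus>\<^bsub>T\<^esub>m\<in>{..<n}. c' i j m \<otimes>\<^bsub>T\<^esub> c' m l p) \<otimes>\<^bsub>T\<^esub> g p
      = g i \<otimes>\<^bsub>T\<^esub> g j \<otimes>\<^bsub>T\<^esub> g l \<otimes>\<^bsub>T\<^esub> (\<Oplus>\<^bsub>T\<^esub>m\<in>{..<n}. c i j m \<otimes>\<^bsub>T\<^esub> c m l p)"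
    if h: "i < n" "j < n" "l < n" "p < n" for i j l p
  proof -
    have "c' i j m \<otimes>\<^bsub>T\<^esub> c' m l p \<otimes>\<^bsub>T\<^esub> g p = g i \<otimes>\<^bsub>T\<^esub> g j \<otimes>\<^bsub>T\<^esub> g l \<otimes>\<^bsub>T\<^esub> (c i j m \<otimes>\<^bsub>T\<^esub> c m l p)" if m: "m < n" for m
    proof -
      have "c' i j m \<otimes>\<^bsub>T\<^esub> c' m l p \<otimes>\<^bsub>T\<^esub> g p = c' i j m \<otimes>\<^bsub>T\<^esub> (g m \<otimes>\<^bsub>T\<^esub> g l \<otimes>\<^bsub>T\<^esub> c m l p)"
        using h m by (simp add: m_assoc c' g d(1) cg)
      also have "\<dots> = c' i j m \<otimes>\<^bsub>T\<^esub> g m \<otimes>\<^bsub>T\<^esub> (g l \<otimes>\<^bsub>T\<^esub> c m l p)"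
        using h m by (simp add: m_assoc c' g d(1))
      also have "\<dots> = g i \<otimes>\<^bsub>T\<^esub> g j \<otimes>\<^bsub>T\<^esub> g l \<otimes>\<^bsub>T\<^esub> (c i j m \<otimes>\<^bsub>T\<^esub> c m l p)"
        using h m by (simp add: cg g d(1) m_ac)
      finally show ?thesis .
    qed
    note step = this
    have "(\<Oplus>\<^bsub>T\<^esub>m\<in>{..<n}. c' i j m \<otimes>\<^bsub>T\<^esub> c' m l p) \<otimes>\<^bsub>T\<^esub> g p = (\<Oplus>\<^bsub>T\<^esub>m\<in>{..<n}. c' i j m \<otimes>\<^bsub>T\<^esub> c' m l p \<otimes>\<^bsub>T\<^esub> g p)"
      using h by (intro S_ldistr) (simp_all add: c' g)
    also have "\<dots> = (\<Oplus>\<^bsub>T\<^esub>m\<in>{..<n}. g i \<otimes>\<^bsub>T\<^esub> g j \<otimes>\<^bsub>T\<^esub> g l \<otimes>\<^bsub>T\<^esub> (c i j m \<otimes>\<^bsub>T\<^esub> c m l p))"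
      using h by (intro S_cong step) (simp_all add: d(1) g)
    also have "\<dots> = g i \<otimes>\<^bsub>T\<^esub> g j \<otimes>\<^bsub>T\<^esub> g l \<otimes>\<^bsub>T\<^esub> (\<Oplus>\<^bsub>T\<^esub>m\<in>{..<n}. c i j m \<otimes>\<^bsub>T\<^esub> c m l p)"
      using h by (intro S_rdistr[symmetric]) (simp_all add: d(1) g)
    finally show ?thesis .
  qed
  show ?thesis
    unfolding is_table_def
  proof (intro conjI allI impI)
    fix i j l assume h: "i < n" "j < n" "l < n"
    then show "c' i j l = c' j i l" by (rule comm)
  next
    fix i j l p assume h: "i < n" "j < n" "l < n" "p < n"
    have cyc: "g i \<otimes>\<^bsub>T\<^esub> g j \<otimes>\<^bsub>T\<^esub> g l = g j \<otimes>\<^bsub>T\<^esub> g l \<otimes>\<^bsub>T\<^esub> g i"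
      using h by (simp add: g m_ac)
    \<comment> \<open>Commutativity brings the other side into the shape of \<open>prod\<close> with
      \<open>i\<close>, \<open>j\<close>, \<open>l\<close> rotated, and the factor
      \<open>g i g j g l\<close> is invariant under rotation.\<close>
    have c1: "(\<Oplus>\<^bsub>T\<^esub>m\<in>{..<n}. c' j l m \<otimes>\<^bsub>T\<^esub> c' i m p) = (\<Oplus>\<^bsub>T\<^esub>m\<in>{..<n}. c' j l m \<otimes>\<^bsub>T\<^esub> c' m i p)"
      using h comm[of i _ p] c' by (intro S_cong) auto
    have c2: "(\<Oplus>\<^bsub>T\<^esub>m\<in>{..<n}. c j l m \<otimes>\<^bsub>T\<^esub> c m i p) = (\<Oplus>\<^bsub>T\<^esub>m\<in>{..<n}. c i j m \<otimes>\<^bsub>T\<^esub> c m l p)"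
      unfolding d(4)[OF h] using h d(1) d(3)[of i _ p] by (intro S_cong) auto
    have "(\<Oplus>\<^bsub>T\<^esub>m\<in>{..<n}. c' i j m \<otimes>\<^bsub>T\<^esub> c' m l p) \<otimes>\<^bsub>T\<^esub> g p = (\<Oplus>\<^bsub>T\<^esub>m\<in>{..<n}. c' j l m \<otimes>\<^bsub>T\<^esub> c' i m p) \<otimes>\<^bsub>T\<^esub> g p"
      unfolding c1 prod[OF h] prod[OF h(2,3,1,4)] c2 cyc ..
    then show "(\<Oplus>\<^bsub>T\<^esub>m\<in>{..<n}. c' i j m \<otimes>\<^bsub>T\<^esub> c' m l p) = (\<Oplus>\<^bsub>T\<^esub>m\<in>{..<n}. c' j l m \<otimes>\<^bsub>T\<^esub> c' i m p)"
      by (rule cancel[OF _ h(4)]) (auto intro!: S_closed m_closed c' simp: h)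
  next
    fix j l assume h: "j < n" "l < n"
    \<comment> \<open>The factor \<open>g i\<close> produced by \<open>cg\<close> is absorbed by
      \<open>u' i\<close>, which restores \<open>u i\<close>.\<close>
    have "u' i \<otimes>\<^bsub>T\<^esub> c' i j l \<otimes>\<^bsub>T\<^esub> g l = g j \<otimes>\<^bsub>T\<^esub> (u i \<otimes>\<^bsub>T\<^esub> c i j l)" if i: "i < n" for i
    proof -
      have "u' i \<otimes>\<^bsub>T\<^esub> c' i j l \<otimes>\<^bsub>T\<^esub> g l = u' i \<otimes>\<^bsub>T\<^esub> (g i \<otimes>\<^bsub>T\<^esub> g j \<otimes>\<^bsub>T\<^esub> c i j l)"
        using h i by (simp add: m_assoc u' c' g d(1) cg)
      also have "\<dots> = (u' i \<otimes>\<^bsub>T\<^esub> g i) \<otimes>\<^bsub>T\<^esub> (g j \<otimes>\<^bsub>T\<^esub> c i j l)"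
        using h i by (simp add: m_assoc u' c' g d(1))
      also have "\<dots> = g j \<otimes>\<^bsub>T\<^esub> (u i \<otimes>\<^bsub>T\<^esub> c i j l)"
        using h i by (simp add: ug g d(1,2) m_ac)
      finally show ?thesis .
    qed
    note step = this
    have "(\<Oplus>\<^bsub>T\<^esub>i\<in>{..<n}. u' i \<otimes>\<^bsub>T\<^esub> c' i j l) \<otimes>\<^bsub>T\<^esub> g l = (\<Oplus>\<^bsub>T\<^esub>i\<in>{..<n}. u' i \<otimes>\<^bsub>T\<^esub> c' i j l \<otimes>\<^bsub>T\<^esub> g l)"
      using h by (intro S_ldistr) (simp_all add: u' c' g)
    also have "\<dots> = (\<Oplus>\<^bsub>T\<^esub>i\<in>{..<n}. g j \<otimes>\<^bsub>T\<^esub> (u i \<otimes>\<^bsub>T\<^esub> c i j l))"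
      using h by (intro S_cong step) (simp_all add: d(1,2) g)
    also have "\<dots> = g j \<otimes>\<^bsub>T\<^esub> (\<Oplus>\<^bsub>T\<^esub>i\<in>{..<n}. u i \<otimes>\<^bsub>T\<^esub> c i j l)"
      using h by (intro S_rdistr[symmetric]) (simp_all add: d(1,2) g)
    also have "\<dots> = (if j = l then \<one>\<^bsub>T\<^esub> else \<zero>\<^bsub>T\<^esub>) \<otimes>\<^bsub>T\<^esub> g l"
      using h d(5)[OF h] by (simp add: g)
    finally show "(\<Oplus>\<^bsub>T\<^esub>i\<in>{..<n}. u' i \<otimes>\<^bsub>T\<^esub> c' i j l) = (if j = l then \<one>\<^bsub>T\<^esub> else \<zero>\<^bsub>T\<^esub>)"
      by (rule cancel[OF _ h(2)]) (auto intro!: S_closed m_closed u' c' simp: h)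
  qed (auto simp: c' u')
qed

section \<open>Contracting a table whose unit is the first basis vector\<close>

text \<open>The coordinates of the algebra in which all products of the basis vectors other than the
  first, which is the unit, vanish.\<close>

definition origin :: "('t, 'm) ring_scheme \<Rightarrow> coord \<Rightarrow> 't" where
  "origin T v = (case v of
      SC i j l \<Rightarrow> if i = 0 \<and> j = l \<or> j = 0 \<and> i = l then \<one>\<^bsub>T\<^esub> else \<zero>\<^bsub>T\<^esub>
    | UC i \<Rightarrow> if i = 0 then \<one>\<^bsub>T\<^esub> else \<zero>\<^bsub>T\<^esub>)"

text \<open>With the unit at the first basis vector, the sum in the unit law reduces to its term
  \<open>i = 0\<close>.\<close>

lemma is_table_unit_mult:
  assumes "cring T" and tab: "is_table n T c u"
    and u: "\<And>i. i < n \<Longrightarrow> u i = (if i = 0 then \<one>\<^bsub>T\<^esub> else \<zero>\<^bsub>T\<^esub>)" and h: "j < n" "l < n"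
  shows "c 0 j l = (if j = l then \<one>\<^bsub>T\<^esub> else \<zero>\<^bsub>T\<^esub>)"
proof -
  interpret cring T by (rule assms(1))
  note d = is_tableD[OF tab]
  have "c 0 j l = (\<Oplus>\<^bsub>T\<^esub>i\<in>{..<n}. (if i = 0 then \<one>\<^bsub>T\<^esub> else \<zero>\<^bsub>T\<^esub>) \<otimes>\<^bsub>T\<^esub> c i j l)"
    using h d(1) by (intro S_delta[symmetric]) auto
  also have "\<dots> = (\<Oplus>\<^bsub>T\<^esub>i\<in>{..<n}. u i \<otimes>\<^bsub>T\<^esub> c i j l)"
    using h d(1) by (intro S_cong) (auto simp: u)
  also have "\<dots> = (if j = l then \<one>\<^bsub>T\<^esub> else \<zero>\<^bsub>T\<^esub>)" by (rule d(5)[OF h])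
  finally show ?thesis .
qed

lemma ring_hom_field_eq_zero:
  fixes h :: "'k::field \<Rightarrow> 't"
  assumes "domain D" and h: "h \<in> ring_hom type_ring D" and "h x = \<zero>\<^bsub>D\<^esub>"
  shows "x = 0"
proof (rule ccontr)
  interpret "domain" D by (rule assms(1))
  assume "x \<noteq> 0"
  then have "h x \<otimes>\<^bsub>D\<^esub> h (inverse x) = h 1"
    using ring_hom_mult[OF h, of x "inverse x"] by simp
  then show False
    using ring_hom_one[OF h] ring_hom_closed[OF h, of "inverse x"] assms(3) by simp
qed

text \<open>Rescaling all basis vectors but the first by \<open>t\<close> gives a table over
  \<open>D[t]\<close> that is \<open>a\<close> at \<open>t = 1\<close> and \<open>origin D\<close>
  at \<open>t = 0\<close>. The unit stays the first basis vector throughout, so the family lies in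
  either scheme.\<close>

lemma linked_origin:
  fixes h :: "'k::field \<Rightarrow> 't" and E :: "(coord, 'k) mpoly set" and D :: "('t, 'm) ring_scheme"
  assumes E: "E = base_change (B_eqs n) \<or> E = base_change (B1_eqs n)"
    and D: "domain D" and sol: "solution E D h a"
    and u: "\<And>i. i < n \<Longrightarrow> a (UC i) = (if i = 0 then \<one>\<^bsub>D\<^esub> else \<zero>\<^bsub>D\<^esub>)"
  shows "linked (Spec (coord_ring (B_vars n) E)) (point (B_vars n) E D h a)
    (point (B_vars n) E type_ring id (origin type_ring))"
proof -
  interpret D: "domain" D by (rule D)
  interpret S: evaluation D h a using sol by (simp add: solution_def)
  have E': "E \<subseteq> carrier (mpoly_ring (B_vars n))"
    using E base_change_closed[OF B_eqs_closed] base_change_closed[OF B1_eqs_closed] by blast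
  define L where "L = UP D"
  define C where "C r = up_ring.monom L r 0" for r
  define t where "t = up_ring.monom L \<one>\<^bsub>D\<^esub> 1"
  note poly = polynomial_ring[OF D, folded L_def, folded t_def]
  interpret L: "domain" L by (rule poly(1))
  have C: "C \<in> ring_hom D L" using poly(2) by (simp add: C_def[abs_def])
  interpret C: ring_hom_cring D L C
    by (rule ring_hom_cringI[OF D.is_cring L.is_cring C])
  have t: "t \<in> carrier L" "t \<noteq> \<zero>\<^bsub>L\<^esub>" using poly(3,4) by auto
  note a [simp] = S.a
  \<comment> \<open>For \<open>i, j > 0\<close> the product of \<open>t e\<^sub>i\<close> and
    \<open>t e\<^sub>j\<close> has \<open>t\<^sup>2\<close> times the old coefficient at
    \<open>e\<^sub>0\<close>, and \<open>t\<close> times the old coefficient at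
    \<open>t e\<^sub>l\<close>. Products with the unit \<open>e\<^sub>0\<close> keep their
    coefficients.\<close>
  define a' where "a' v = (case v of
      SC i j l \<Rightarrow> if i = 0 \<or> j = 0 then C (a v) else if l = 0 then t \<otimes>\<^bsub>L\<^esub> t \<otimes>\<^bsub>L\<^esub> C (a v) else t \<otimes>\<^bsub>L\<^esub> C (a v)
    | UC i \<Rightarrow> C (a v))" for v
  have hC: "(\<lambda>x. C (h x)) \<in> ring_hom type_ring L"
    using ring_hom_trans[OF S.h C] by (simp add: comp_def)
  interpret LC: evaluation L "\<lambda>x. C (h x)" "\<lambda>v. C (a v)"
    by unfold_locales (rule hC, simp)
  interpret LA: evaluation L "\<lambda>x. C (h x)" a'
    by unfold_locales (rule hC, simp add: a'_def t split: coord.split)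
  interpret DC: specialisation D h a L "\<lambda>x. C (h x)" "\<lambda>v. C (a v)" C "B_vars n"
    by unfold_locales (auto intro: C)
  have solC: "solution E L (\<lambda>x. C (h x)) (\<lambda>v. C (a v))"
    by (rule DC.solution_image[OF E' sol])
  have tab: "is_table n D (\<lambda>i j l. a (SC i j l)) (\<lambda>i. a (UC i))"
    using E sol solution_B_iff[OF S.evaluation_axioms, of n] solution_B1_iff[OF S.evaluation_axioms, of n] by blast
  have tabC: "is_table n L (\<lambda>i j l. C (a (SC i j l))) (\<lambda>i. C (a (UC i)))"
    using E solC solution_B_iff[OF LC.evaluation_axioms, of n] solution_B1_iff[OF LC.evaluation_axioms, of n] by blast
  have unit: "a (SC 0 j l) = (if j = l then \<one>\<^bsub>D\<^esub> else \<zero>\<^bsub>D\<^esub>)" if "j < n" "l < n" for j l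
    using is_table_unit_mult[OF D.is_cring tab u that] .
  have unit': "a (SC i 0 l) = (if i = l then \<one>\<^bsub>D\<^esub> else \<zero>\<^bsub>D\<^esub>)" if "i < n" "l < n" for i l
    using unit[OF that] is_tableD(3)[OF tab, of i 0 l] that by simp
  define g where "g i = (if i = 0 then \<one>\<^bsub>L\<^esub> else t)" for i :: nat
  have "is_table n L (\<lambda>i j l. a' (SC i j l)) (\<lambda>i. a' (UC i))"
  proof (rule is_table_rescale[OF L.domain_axioms tabC, of g])
    fix i assume i: "i < n"
    show "g i \<in> carrier L" "g i \<noteq> \<zero>\<^bsub>L\<^esub>" by (auto simp: g_def t)
    show "a' (UC i) \<in> carrier L" by (rule LA.a)
    show "a' (UC i) \<otimes>\<^bsub>L\<^esub> g i = C (a (UC i))"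
      using i by (simp add: a'_def g_def u t)
    fix j l assume jl: "j < n" "l < n"
    show "a' (SC i j l) \<in> carrier L" by (rule LA.a)
    show "a' (SC i j l) \<otimes>\<^bsub>L\<^esub> g l = g i \<otimes>\<^bsub>L\<^esub> g j \<otimes>\<^bsub>L\<^esub> C (a (SC i j l))"
    proof (cases "i = 0 \<or> j = 0")
      case True
      then show ?thesis using i jl by (auto simp: a'_def g_def t unit unit')
    next
      case False
      then show ?thesis using i jl t by (simp add: a'_def g_def L.m_ac)
    qed
  qed
  moreover have "a' (UC i) = (if i = 0 then \<one>\<^bsub>L\<^esub> else \<zero>\<^bsub>L\<^esub>)" if "i < n" for i
    using that by (simp add: a'_def u)
  ultimately have sol': "solution E L (\<lambda>x. C (h x)) a'"
    using E solution_B_iff[OF LA.evaluation_axioms, of n] solution_B1_iff[OF LA.evaluation_axioms, of n] by blast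
  have ev: "eval D D id s (C r) = r" if "s \<in> carrier D" "r \<in> carrier D" for s r
    using poly(6)[OF that] by (simp add: C_def)
  let ?P = "point (B_vars n) E"
  have link1: "linked (Spec (coord_ring (B_vars n) E)) (?P L (\<lambda>x. C (h x)) a') (?P D h a)"
  proof -
    interpret e: ring_hom_cring L D "eval D D id \<one>\<^bsub>D\<^esub>"
      by (rule ring_hom_cringI[OF L.is_cring D.is_cring poly(5)]) simp
    interpret specialisation L "\<lambda>x. C (h x)" a' D h a "eval D D id \<one>\<^bsub>D\<^esub>" "B_vars n"
      by unfold_locales (auto simp: ev a'_def t poly(7) split: coord.split)
    show ?thesis by (rule linked_points[OF E' sol' L.domain_axioms D])
  qed
  have link0: "linked (Spec (coord_ring (B_vars n) E)) (?P L (\<lambda>x. C (h x)) a') (?P D h (origin D))"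
  proof -
    interpret e: ring_hom_cring L D "eval D D id \<zero>\<^bsub>D\<^esub>"
      by (rule ring_hom_cringI[OF L.is_cring D.is_cring poly(5)]) simp
    interpret specialisation L "\<lambda>x. C (h x)" a' D h "origin D" "eval D D id \<zero>\<^bsub>D\<^esub>" "B_vars n"
      by unfold_locales
        (auto simp: S.h ev a'_def origin_def t poly(7) B_vars_def u unit unit' split: coord.split)
    show ?thesis by (rule linked_points[OF E' sol' L.domain_axioms D])
  qed
  \<comment> \<open>The target must be the same for every \<open>D\<close>: its coordinates are 0
    and 1, and the field \<open>k\<close> embeds in \<open>D\<close>, so it is already a point over
    \<open>k\<close>.\<close>
  have eq: "?P type_ring id (origin type_ring) = ?P D h (origin D)"
  proof -
    interpret k: cring "type_ring :: 'k ring" by (rule cring_type_ring)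
    interpret h: ring_hom_cring "type_ring :: 'k ring" D h
      by (rule ring_hom_cringI[OF k.is_cring D.is_cring S.h])
    have h01: "h 0 = \<zero>\<^bsub>D\<^esub>" "h 1 = \<one>\<^bsub>D\<^esub>" by simp_all
    interpret specialisation "type_ring :: 'k ring" id "origin type_ring" D h "origin D" h "B_vars n"
      by unfold_locales (auto simp: S.h h01 origin_def intro!: ring_hom_memI split: coord.split)
    show ?thesis
      by (rule point_eq) (simp add: ring_hom_field_eq_zero[OF D S.h])
  qed
  show ?thesis unfolding eq by (rule linked_trans[OF linked_sym[OF link1] link0])
qed

text \<open>The additional equations put the unit of every point at the first basis vector, so the
  contraction applies over the quotient by any prime.\<close>

theorem connected_B1:
  "connected_space (Spec (B1_ring n :: (coord, 'k::field) mpoly set ring))"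
proof (rule connected_space_if_linked)
  let ?E = "base_change (B1_eqs n) :: (coord, 'k) mpoly set"
  fix P assume "P \<in> topspace (Spec (B1_ring n :: (coord, 'k) mpoly set ring))"
  then have P: "primeideal P (coord_ring (B_vars n) ?E)" by (simp add: topspace_Spec B1_ring_def)
  note E = base_change_closed[OF B1_eqs_closed]
  let ?D = "coord_ring (B_vars n) ?E Quot P"
  from primeideal_is_point[OF E P] obtain h a
    where a: "solution ?E ?D h a" "point (B_vars n) ?E ?D h a = P" by blast
  have "evaluation ?D h a" using a by (simp add: solution_def)
  from solution_B1_iff[OF this] a(1)
  have u: "\<And>i. i < n \<Longrightarrow> a (UC i) = (if i = 0 then \<one>\<^bsub>?D\<^esub> else \<zero>\<^bsub>?D\<^esub>)" by blast
  show "linked (Spec (B1_ring n)) P (point (B_vars n) ?E type_ring id (origin type_ring))"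
    using linked_origin[where n = n, OF _ primeideal.quotient_is_domain[OF P] a(1) u] a(2) by (simp add: B1_ring_def)
qed

section \<open>Moving the unit by shears\<close>

text \<open>A linear form that vanishes on \<open>(v, w)\<close> is constant along that direction.
  This makes shears compose additively in their parameter.\<close>

lemma (in cring) functional_shear:
  assumes "\<alpha> \<in> carrier R" "\<beta> \<in> carrier R" "x \<in> carrier R" "y \<in> carrier R" "v \<in> carrier R" "w \<in> carrier R" "s \<in> carrier R"
    and "\<alpha> \<otimes> v \<oplus> \<beta> \<otimes> w = \<zero>"
  shows "\<alpha> \<otimes> (x \<oplus> s \<otimes> v) \<oplus> \<beta> \<otimes> (y \<oplus> s \<otimes> w) = \<alpha> \<otimes> x \<oplus> \<beta> \<otimes> y"
proof -
  have "\<alpha> \<otimes> (x \<oplus> s \<otimes> v) \<oplus> \<beta> \<otimes> (y \<oplus> s \<otimes> w) = \<alpha> \<otimes> x \<oplus> \<beta> \<otimes> y \<oplus> s \<otimes> (\<alpha> \<otimes> v \<oplus> \<beta> \<otimes> w)"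
    using assms(1-7) by (simp add: r_distr a_ac m_ac)
  then show ?thesis using assms by simp
qed

text \<open>The algebra stays fixed and only its coordinates change. With \<lambda>(x) = \<alpha>
  \<open>x\<^sub>0\<close> + \<beta> \<open>x\<^sub>j\<close> and \<lambda>(v) = 0, the shear with
  parameter -s is the inverse, over any commutative ring.\<close>

lemma based_algebra_shear:
  assumes T: "cring T" and tab: "is_table n T c u" and j: "j < n" "0 < n"
    and cl: "\<alpha> \<in> carrier T" "\<beta> \<in> carrier T" "s \<in> carrier T" "\<And>i. v i \<in> carrier T"
    and v: "\<alpha> \<otimes>\<^bsub>T\<^esub> v 0 \<oplus>\<^bsub>T\<^esub> \<beta> \<otimes>\<^bsub>T\<^esub> v j = \<zero>\<^bsub>T\<^esub>"
  shows "based_algebra n T (table_alg n T c u)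
    (\<lambda>x. \<lambda>i\<in>{..<n}. x i \<oplus>\<^bsub>T\<^esub> s \<otimes>\<^bsub>T\<^esub> (\<alpha> \<otimes>\<^bsub>T\<^esub> x 0 \<oplus>\<^bsub>T\<^esub> \<beta> \<otimes>\<^bsub>T\<^esub> x j) \<otimes>\<^bsub>T\<^esub> v i)"
proof -
  interpret cring T by (rule T)
  let ?A = "table_alg n T c u"
  define lam where "lam x = \<alpha> \<otimes>\<^bsub>T\<^esub> x 0 \<oplus>\<^bsub>T\<^esub> \<beta> \<otimes>\<^bsub>T\<^esub> x j" for x :: "nat \<Rightarrow> _"
  define \<phi> where "\<phi> r x = (\<lambda>i\<in>{..<n}. x i \<oplus>\<^bsub>T\<^esub> r \<otimes>\<^bsub>T\<^esub> lam x \<otimes>\<^bsub>T\<^esub> v i)" for r x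
  have car: "carrier ?A = {..<n} \<rightarrow>\<^sub>E carrier T" by (simp add: table_alg_def)
  have x: "x i \<in> carrier T" if "x \<in> carrier ?A" "i < n" for x i using that by (auto simp: car)
  have lam: "lam x \<in> carrier T" if "x \<in> carrier ?A" for x
    using that j by (simp add: lam_def cl x)
  have \<phi>: "\<phi> r x \<in> carrier ?A" if "x \<in> carrier ?A" "r \<in> carrier T" for r x
    unfolding car \<phi>_def restrict_PiE_iff using that by (simp add: x lam cl)
  have lam\<phi>: "lam (\<phi> r x) = lam x" if "x \<in> carrier ?A" "r \<in> carrier T" for r x
    using that j v functional_shear[of \<alpha> \<beta> "x 0" "x j" "v 0" "v j" "r \<otimes>\<^bsub>T\<^esub> lam x"]
    by (simp add: lam_def \<phi>_def cl x)
  \<comment> \<open>The parameters add up because \<open>lam\<close> has the same value before and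
    after a shear. Allowing any \<open>q\<close> and \<open>r\<close> of sum zero covers both orders
    of composition.\<close>
  have inv: "\<phi> r (\<phi> q x) = x" if "x \<in> carrier ?A" "r \<in> carrier T" "q \<in> carrier T" "q \<oplus>\<^bsub>T\<^esub> r = \<zero>\<^bsub>T\<^esub>" for r q x
  proof (rule PiE_ext)
    show "\<phi> r (\<phi> q x) \<in> {..<n} \<rightarrow>\<^sub>E carrier T" "x \<in> {..<n} \<rightarrow>\<^sub>E carrier T"
      using that \<phi> car by auto
    fix i assume "i \<in> {..<n}"
    then have i: "i < n" by simp
    have "\<phi> r (\<phi> q x) i = x i \<oplus>\<^bsub>T\<^esub> q \<otimes>\<^bsub>T\<^esub> lam x \<otimes>\<^bsub>T\<^esub> v i \<oplus>\<^bsub>T\<^esub> r \<otimes>\<^bsub>T\<^esub> lam x \<otimes>\<^bsub>T\<^esub> v i"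
      using i that lam\<phi>[of x q] by (simp add: \<phi>_def[of r]) (simp add: \<phi>_def)
    also have "\<dots> = x i \<oplus>\<^bsub>T\<^esub> (q \<oplus>\<^bsub>T\<^esub> r) \<otimes>\<^bsub>T\<^esub> (lam x \<otimes>\<^bsub>T\<^esub> v i)"
      using i that(1-3) by (simp add: l_distr m_assoc a_assoc x lam cl)
    also have "\<dots> = x i" using i that by (simp add: x lam cl)
    finally show "\<phi> r (\<phi> q x) i = x i" .
  qed
  have "bij_betw (\<phi> s) (carrier ?A) ({..<n} \<rightarrow>\<^sub>E carrier T)"
    unfolding car[symmetric] using \<phi>[of _ s] \<phi>[of _ "\<ominus>\<^bsub>T\<^esub> s"] cl
    by (intro bij_betw_byWitness[where f' = "\<phi> (\<ominus>\<^bsub>T\<^esub> s)"])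
      (auto simp: inv l_neg r_neg)
  moreover have "\<phi> s (x \<oplus>\<^bsub>?A\<^esub> y) i = \<phi> s x i \<oplus>\<^bsub>T\<^esub> \<phi> s y i"
    if xy: "x \<in> carrier ?A" "y \<in> carrier ?A" and i: "i < n" for x y i
  proof -
    have add: "(x \<oplus>\<^bsub>?A\<^esub> y) m = x m \<oplus>\<^bsub>T\<^esub> y m" if "m < n" for m
      using that by (simp add: table_alg_def)
    have "lam (x \<oplus>\<^bsub>?A\<^esub> y) = lam x \<oplus>\<^bsub>T\<^esub> lam y"
      using j xy by (simp add: lam_def add x cl r_distr a_ac)
    then show ?thesis
      using i xy by (simp add: \<phi>_def add x lam cl r_distr l_distr a_ac)
  qed
  moreover have "\<phi> s (r \<odot>\<^bsub>?A\<^esub> x) i = r \<otimes>\<^bsub>T\<^esub> \<phi> s x i"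
    if r: "r \<in> carrier T" and xc: "x \<in> carrier ?A" and i: "i < n" for r x i
  proof -
    have sm: "(r \<odot>\<^bsub>?A\<^esub> x) m = r \<otimes>\<^bsub>T\<^esub> x m" if "m < n" for m
      using that by (simp add: table_alg_def)
    have "lam (r \<odot>\<^bsub>?A\<^esub> x) = r \<otimes>\<^bsub>T\<^esub> lam x"
      using j xc r by (simp add: lam_def sm x cl r_distr m_ac)
    then show ?thesis
      using i xc r by (simp add: \<phi>_def sm x lam cl r_distr m_ac)
  qed
  ultimately have "based_algebra n T ?A (\<phi> s)"
    using algebra_table_alg[OF T tab] by (simp add: based_algebra_def)
  then show ?thesis by (simp add: \<phi>_def[abs_def] lam_def)
qed

text \<open>Over \<open>K[t]\<close> the shear with parameter \<open>t\<close> moves the coordinates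
  of one constant algebra, from the original ones at \<open>t = 0\<close> to the sheared ones at
  \<open>t = 1\<close>. The unit coordinates of the new table are those of the old unit after the
  shear.\<close>

lemma solution_shear:
  fixes h :: "'k::comm_ring_1 \<Rightarrow> 't" and K :: "('t, 'm) ring_scheme" and n :: nat
  defines "E \<equiv> base_change (B_eqs n) :: (coord, 'k) mpoly set"
  assumes K: "domain K" and sol: "solution E K h a" and j: "j < n" "0 < n"
    and cl: "\<alpha> \<in> carrier K" "\<beta> \<in> carrier K" "\<And>i. v i \<in> carrier K"
    and v: "\<alpha> \<otimes>\<^bsub>K\<^esub> v 0 \<oplus>\<^bsub>K\<^esub> \<beta> \<otimes>\<^bsub>K\<^esub> v j = \<zero>\<^bsub>K\<^esub>"
  shows "\<exists>a'. solution E K h a'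
    \<and> linked (Spec (coord_ring (B_vars n) E)) (point (B_vars n) E K h a) (point (B_vars n) E K h a')
    \<and> (\<forall>i<n. a' (UC i) = a (UC i) \<oplus>\<^bsub>K\<^esub> (\<alpha> \<otimes>\<^bsub>K\<^esub> a (UC 0) \<oplus>\<^bsub>K\<^esub> \<beta> \<otimes>\<^bsub>K\<^esub> a (UC j)) \<otimes>\<^bsub>K\<^esub> v i)"
proof -
  interpret K: "domain" K by (rule K)
  interpret S: evaluation K h a using sol by (simp add: solution_def)
  have E': "E \<subseteq> carrier (mpoly_ring (B_vars n))"
    unfolding E_def by (rule base_change_closed[OF B_eqs_closed])
  define L where "L = UP K"
  define C where "C r = up_ring.monom L r 0" for r
  define t where "t = up_ring.monom L \<one>\<^bsub>K\<^esub> 1"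
  define e where "e s = eval K K id s" for s
  note poly = polynomial_ring[OF K, folded L_def, folded t_def e_def]
  interpret L: "domain" L by (rule poly(1))
  have C: "C \<in> ring_hom K L" using poly(2) by (simp add: C_def[abs_def])
  interpret C: ring_hom_cring K L C
    by (rule ring_hom_cringI[OF K.is_cring L.is_cring C])
  have t: "t \<in> carrier L" using poly(3) by simp
  have ev: "e s (C r) = r" if "s \<in> carrier K" "r \<in> carrier K" for s r
    using poly(6)[OF that] by (simp add: C_def)
  note a [simp] = S.a
  have hC: "(\<lambda>x. C (h x)) \<in> ring_hom type_ring L"
    using ring_hom_trans[OF S.h C] by (simp add: comp_def)
  interpret LC: evaluation L "\<lambda>x. C (h x)" "\<lambda>v. C (a v)"
    by unfold_locales (rule hC, simp)
  interpret KC: specialisation K h a L "\<lambda>x. C (h x)" "\<lambda>v. C (a v)" C "B_vars n"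
    by unfold_locales (auto intro: C)
  let ?c = "\<lambda>i j l. a (SC i j l)" and ?u = "\<lambda>i. a (UC i)"
  let ?cL = "\<lambda>i j l. C (a (SC i j l))" and ?uL = "\<lambda>i. C (a (UC i))"
  have tab: "is_table n K ?c ?u"
    using sol solution_B_iff[OF S.evaluation_axioms, of n] by (simp add: E_def)
  have tabL: "is_table n L ?cL ?uL"
    using KC.solution_image[OF E' sol] solution_B_iff[OF LC.evaluation_axioms, of n] by (simp add: E_def)
  let ?B = "table_alg n K ?c ?u" and ?A = "table_alg n L ?cL ?uL"
  define \<phi> where "\<phi> x = (\<lambda>i\<in>{..<n}. x i \<oplus>\<^bsub>L\<^esub> t \<otimes>\<^bsub>L\<^esub> (C \<alpha> \<otimes>\<^bsub>L\<^esub> x 0 \<oplus>\<^bsub>L\<^esub> C \<beta> \<otimes>\<^bsub>L\<^esub> x j) \<otimes>\<^bsub>L\<^esub> C (v i))" for x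
  have "C \<alpha> \<otimes>\<^bsub>L\<^esub> C (v 0) \<oplus>\<^bsub>L\<^esub> C \<beta> \<otimes>\<^bsub>L\<^esub> C (v j) = C (\<alpha> \<otimes>\<^bsub>K\<^esub> v 0 \<oplus>\<^bsub>K\<^esub> \<beta> \<otimes>\<^bsub>K\<^esub> v j)"
    by (simp add: cl)
  then have "based_algebra n L ?A \<phi>"
    unfolding \<phi>_def[abs_def] by (intro based_algebra_shear L.is_cring tabL) (simp_all add: j cl t v)
  then interpret A: based n L ?A \<phi> by (rule based.intro)
  \<comment> \<open>The structure constants over \<open>K[t]\<close> in sheared coordinates; zero
    fills the indices out of range so that every value lies in \<open>L\<close>.\<close>
  define b where "b w = (case w of SC i j l \<Rightarrow> if l < n then A.c i j l else \<zero>\<^bsub>L\<^esub>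
    | UC i \<Rightarrow> if i < n then \<phi> \<one>\<^bsub>?A\<^esub> i else \<zero>\<^bsub>L\<^esub>)" for w
  have b: "b w \<in> carrier L" for w
    by (simp add: b_def A.c_closed A.phi_closed split: coord.split)
  interpret LB: evaluation L "\<lambda>x. C (h x)" b
    by unfold_locales (rule hC, rule b)
  have "is_table n L (\<lambda>i j l. b (SC i j l)) (\<lambda>i. b (UC i))"
    by (rule is_table_cong[OF _ _ L.is_cring A.is_table]) (auto simp: b_def)
  then have solL: "solution E L (\<lambda>x. C (h x)) b"
    unfolding E_def solution_B_iff[OF LB.evaluation_axioms] .
  have one: "\<one>\<^bsub>?A\<^esub> i = C (a (UC i))" if "i < n" for i
    using that by (rule one_table_alg)
  interpret e0: ring_hom_cring L K "e \<zero>\<^bsub>K\<^esub>"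
    by (rule ring_hom_cringI[OF L.is_cring K.is_cring poly(5)]) simp
  interpret e1: ring_hom_cring L K "e \<one>\<^bsub>K\<^esub>"
    by (rule ring_hom_cringI[OF L.is_cring K.is_cring poly(5)]) simp
  note bA = based_table_alg[OF L.is_cring tabL] and bB = based_table_alg[OF K.is_cring tab]
  \<comment> \<open>The reduction at \<open>t = 0\<close> is first built in the original
    coordinates. The resulting \<open>g\<close> also serves for \<open>\<phi>\<close>, since the two
    coordinate maps agree at \<open>t = 0\<close>.\<close>
  have "is_pullback n (e \<zero>\<^bsub>K\<^esub>) L ?A (\<lambda>x. x) ?B (\<lambda>x. x)"
    unfolding pullback_iff[OF bA bB e0.homh]
    by (simp add: struct_const_table_alg[OF K.is_cring tab] struct_const_table_alg[OF L.is_cring tabL]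
        one_table_alg ev)
  then obtain g where g: "g \<in> ring_hom ?A ?B"
    "\<And>r x. r \<in> carrier L \<Longrightarrow> x \<in> carrier ?A \<Longrightarrow> g (r \<odot>\<^bsub>?A\<^esub> x) = e \<zero>\<^bsub>K\<^esub> r \<odot>\<^bsub>?B\<^esub> g x"
    "\<And>x i. x \<in> carrier ?A \<Longrightarrow> i < n \<Longrightarrow> g x i = e \<zero>\<^bsub>K\<^esub> (x i)"
    unfolding is_pullback_def by blast
  have "e \<zero>\<^bsub>K\<^esub> (\<phi> x i) = e \<zero>\<^bsub>K\<^esub> (x i)" if x: "x \<in> carrier ?A" and i: "i < n" for x i
  proof -
    have "x m \<in> carrier L" if "m < n" for m using x that by (auto simp: table_alg_def)
    then show ?thesis using i j t cl by (simp add: \<phi>_def poly(7))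
  qed
  then have "is_pullback n (e \<zero>\<^bsub>K\<^esub>) L ?A \<phi> ?B (\<lambda>x. x)"
    unfolding is_pullback_def using g by (intro bexI[of _ g]) auto
  then have e0b: "e \<zero>\<^bsub>K\<^esub> (b w) = a w" if "w \<in> B_vars n" for w
    using that unfolding pullback_iff[OF A.based bB e0.homh]
    by (auto simp: b_def B_vars_def struct_const_table_alg[OF K.is_cring tab] one_table_alg)
  \<comment> \<open>The fibre at \<open>t = 1\<close> is defined as the image of \<open>b\<close>;
    only its unit coordinates are computed.\<close>
  define a' where "a' w = e \<one>\<^bsub>K\<^esub> (b w)" for w
  interpret S0: specialisation L "\<lambda>x. C (h x)" b K h a "e \<zero>\<^bsub>K\<^esub>" "B_vars n"
    by unfold_locales (auto simp: ev e0b)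
  interpret S1: specialisation L "\<lambda>x. C (h x)" b K h a' "e \<one>\<^bsub>K\<^esub>" "B_vars n"
    by unfold_locales (auto simp: ev a'_def S.h b)
  have "a' (UC i) = a (UC i) \<oplus>\<^bsub>K\<^esub> (\<alpha> \<otimes>\<^bsub>K\<^esub> a (UC 0) \<oplus>\<^bsub>K\<^esub> \<beta> \<otimes>\<^bsub>K\<^esub> a (UC j)) \<otimes>\<^bsub>K\<^esub> v i"
    if "i < n" for i
    using that j t cl by (simp add: a'_def b_def \<phi>_def one ev poly(7))
  moreover have "linked (Spec (coord_ring (B_vars n) E)) (point (B_vars n) E K h a) (point (B_vars n) E K h a')"
    using linked_trans[OF linked_sym[OF S0.linked_points[OF E' solL L.domain_axioms K]]
        S1.linked_points[OF E' solL L.domain_axioms K]] .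
  ultimately show ?thesis using S1.solution_image[OF E' solL] by blast
qed

section \<open>Bringing the unit to the first basis vector\<close>

lemma is_table_unit_nonzero:
  assumes "domain T" and tab: "is_table n T c u" and "0 < n"
  shows "\<exists>i<n. u i \<noteq> \<zero>\<^bsub>T\<^esub>"
proof (rule ccontr)
  interpret "domain" T by (rule assms(1))
  note d = is_tableD[OF tab]
  assume "\<not> (\<exists>i<n. u i \<noteq> \<zero>\<^bsub>T\<^esub>)"
  then have "(\<Oplus>\<^bsub>T\<^esub>i\<in>{..<n}. u i \<otimes>\<^bsub>T\<^esub> c i 0 0) = (\<Oplus>\<^bsub>T\<^esub>i\<in>{..<n}. \<zero>\<^bsub>T\<^esub>)"
    using d(1) assms(3) by (intro S_cong) auto
  then show False using d(5)[OF assms(3) assms(3)] by simp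
qed

text \<open>If \<lambda> takes the value 1 on both the unit u and \<open>e\<^sub>0\<close>, then v =
  \<open>e\<^sub>0\<close> - u satisfies \<lambda>(v) = 0, and the shear sends u to u + v =
  \<open>e\<^sub>0\<close>. Such a \<lambda> is found when u has a nonzero coordinate beyond the
  first; otherwise a preliminary shear creates one.\<close>

lemma linked_unit_first:
  fixes h :: "'k::comm_ring_1 \<Rightarrow> 't" and K :: "('t, 'm) ring_scheme" and n :: nat
  defines "E \<equiv> base_change (B_eqs n) :: (coord, 'k) mpoly set"
  assumes K: "field K" and sol: "solution E K h a" and n: "2 \<le> n"
  shows "\<exists>a'. solution E K h a'
    \<and> linked (Spec (coord_ring (B_vars n) E)) (point (B_vars n) E K h a) (point (B_vars n) E K h a')
    \<and> (\<forall>i<n. a' (UC i) = (if i = 0 then \<one>\<^bsub>K\<^esub> else \<zero>\<^bsub>K\<^esub>))"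
proof -
  interpret K: field K by (rule K)
  note shear = solution_shear[OF K.domain_axioms, of n h, folded E_def]
  let ?S = "Spec (coord_ring (B_vars n) E)" and ?P = "point (B_vars n) E K h"
  have direct: "\<exists>a'. solution E K h a' \<and> linked ?S (?P a) (?P a')
      \<and> (\<forall>i<n. a' (UC i) = (if i = 0 then \<one>\<^bsub>K\<^esub> else \<zero>\<^bsub>K\<^esub>))"
    if sol: "solution E K h a" and j: "0 < j" "j < n" "a (UC j) \<noteq> \<zero>\<^bsub>K\<^esub>" for a j
  proof -
    interpret evaluation K h a using sol by (simp add: solution_def)
    note a [simp]
    \<comment> \<open>Chosen so that \<lambda>(x) = \<open>x\<^sub>0\<close> + \<beta>
      \<open>x\<^sub>j\<close> is 1 on the unit; the division is where the field enters.\<close>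
    define \<beta> where "\<beta> = (\<one>\<^bsub>K\<^esub> \<ominus>\<^bsub>K\<^esub> a (UC 0)) \<otimes>\<^bsub>K\<^esub> inv\<^bsub>K\<^esub> a (UC j)"
    define v where "v i = (if i = 0 then \<one>\<^bsub>K\<^esub> else \<zero>\<^bsub>K\<^esub>) \<ominus>\<^bsub>K\<^esub> a (UC i)" for i
    have unit: "a (UC j) \<in> Units K" using j by (simp add: K.field_Units)
    have cl: "\<beta> \<in> carrier K" "v i \<in> carrier K" for i
      using unit by (auto simp: \<beta>_def v_def)
    have \<beta>: "\<beta> \<otimes>\<^bsub>K\<^esub> a (UC j) = \<one>\<^bsub>K\<^esub> \<ominus>\<^bsub>K\<^esub> a (UC 0)"
      using unit by (simp add: \<beta>_def K.m_assoc)
    have "\<beta> \<otimes>\<^bsub>K\<^esub> v j = \<ominus>\<^bsub>K\<^esub> (\<beta> \<otimes>\<^bsub>K\<^esub> a (UC j))"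
      using j cl(1) by (simp add: v_def a_minus_def K.r_minus)
    then have "\<one>\<^bsub>K\<^esub> \<otimes>\<^bsub>K\<^esub> v 0 \<oplus>\<^bsub>K\<^esub> \<beta> \<otimes>\<^bsub>K\<^esub> v j = \<zero>\<^bsub>K\<^esub>"
      by (simp add: \<beta> v_def a_minus_def K.r_neg)
    from shear[OF sol _ _ _ cl(1) _ this] j cl obtain a' where a': "solution E K h a'"
      "linked ?S (?P a) (?P a')"
      "\<And>i. i < n \<Longrightarrow> a' (UC i) = a (UC i) \<oplus>\<^bsub>K\<^esub> (\<one>\<^bsub>K\<^esub> \<otimes>\<^bsub>K\<^esub> a (UC 0) \<oplus>\<^bsub>K\<^esub> \<beta> \<otimes>\<^bsub>K\<^esub> a (UC j)) \<otimes>\<^bsub>K\<^esub> v i"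
      by auto
    have "\<one>\<^bsub>K\<^esub> \<otimes>\<^bsub>K\<^esub> a (UC 0) \<oplus>\<^bsub>K\<^esub> \<beta> \<otimes>\<^bsub>K\<^esub> a (UC j) = \<one>\<^bsub>K\<^esub>"
      unfolding \<beta> by (simp add: a_minus_def K.a_lcomm K.r_neg)
    moreover have "a (UC i) \<oplus>\<^bsub>K\<^esub> \<one>\<^bsub>K\<^esub> \<otimes>\<^bsub>K\<^esub> v i = (if i = 0 then \<one>\<^bsub>K\<^esub> else \<zero>\<^bsub>K\<^esub>)" for i
      using cl by (simp add: v_def a_minus_def K.a_lcomm K.r_neg)
    ultimately show ?thesis using a' by (intro exI[of _ a']) simp
  qed
  show ?thesis
  proof (cases "\<exists>j. 0 < j \<and> j < n \<and> a (UC j) \<noteq> \<zero>\<^bsub>K\<^esub>")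
    case True
    then show ?thesis using direct[OF sol] by blast
  next
    case False
    interpret evaluation K h a using sol by (simp add: solution_def)
    have tab: "is_table n K (\<lambda>i j l. a (SC i j l)) (\<lambda>i. a (UC i))"
      using sol solution_B_iff[OF evaluation_axioms, of n] by (simp add: E_def)
    have u0: "a (UC 0) \<noteq> \<zero>\<^bsub>K\<^esub>"
      using is_table_unit_nonzero[OF K.domain_axioms tab] n False by (metis gr0I le_zero_eq zero_neq_numeral)
    have "0 < (1::nat)" "1 < n" using n by auto
    then have u1: "a (UC 1) = \<zero>\<^bsub>K\<^esub>" using False by blast
    \<comment> \<open>Here the unit is a multiple of \<open>e\<^sub>0\<close>. Shearing along
      \<open>e\<^sub>1\<close> with \<lambda>(x) = \<open>x\<^sub>0\<close> makes its coordinate at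
      index 1 equal to \<open>a (UC 0)\<close>, which is nonzero; \<open>2 \<le> n\<close> supplies
      \<open>e\<^sub>1\<close>.\<close>
    define v where "v i = (if i = 1 then \<one>\<^bsub>K\<^esub> else \<zero>\<^bsub>K\<^esub>)" for i :: nat
    have v: "\<one>\<^bsub>K\<^esub> \<otimes>\<^bsub>K\<^esub> v 0 \<oplus>\<^bsub>K\<^esub> \<zero>\<^bsub>K\<^esub> \<otimes>\<^bsub>K\<^esub> v 1 = \<zero>\<^bsub>K\<^esub>" by (simp add: v_def)
    have "\<And>i. v i \<in> carrier K" by (simp add: v_def)
    from shear[OF sol \<open>1 < n\<close> _ K.one_closed K.zero_closed this v] n obtain a' where a': "solution E K h a'" "linked ?S (?P a) (?P a')"
      "\<And>i. i < n \<Longrightarrow> a' (UC i) = a (UC i) \<oplus>\<^bsub>K\<^esub> (\<one>\<^bsub>K\<^esub> \<otimes>\<^bsub>K\<^esub> a (UC 0) \<oplus>\<^bsub>K\<^esub> \<zero>\<^bsub>K\<^esub> \<otimes>\<^bsub>K\<^esub> a (UC 1)) \<otimes>\<^bsub>K\<^esub> v i"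
      by auto
    have "a' (UC 1) \<noteq> \<zero>\<^bsub>K\<^esub>" using a'(3)[of 1] n u0 u1 a by (simp add: v_def)
    then show ?thesis using direct[OF a'(1), of 1] n linked_trans[OF a'(2)] by fastforce
  qed
qed

text \<open>A prime is linked to any maximal ideal above it, and the quotient by the latter is a
  field, as the shears require. After them the unit is in first position and the contraction
  applies.\<close>

lemma connected_B_ge_2:
  assumes "2 \<le> n"
  shows "connected_space (Spec (B_ring n :: (coord, 'k::field) mpoly set ring))"
proof (rule connected_space_if_linked)
  let ?E = "base_change (B_eqs n) :: (coord, 'k) mpoly set"
  let ?R = "coord_ring (B_vars n) ?E"
  fix P assume "P \<in> topspace (Spec (B_ring n :: (coord, 'k) mpoly set ring))"
  then have P: "primeideal P ?R" by (simp add: topspace_Spec B_ring_def)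
  then interpret P: primeideal P ?R .
  note E = base_change_closed[OF B_eqs_closed]
  have "\<one>\<^bsub>?R\<^esub> \<notin> P" using P.I_notcarr P.one_imp_carrier by blast
  then obtain M where "maximalideal M ?R" and PM: "P \<subseteq> M"
    using P.exists_maximalideal[OF P.ideal_axioms] by blast
  then interpret M: maximalideal M ?R by simp
  have M: "primeideal M ?R" by (rule P.maximalideal_prime[OF M.maximalideal_axioms])
  let ?K = "?R Quot M"
  have K: "field ?K" by (rule M.quotient_is_field[OF P.is_cring])
  interpret K: field ?K by (rule K)
  from primeideal_is_point[OF E M] obtain h a
    where a: "solution ?E ?K h a" "point (B_vars n) ?E ?K h a = M" by blast
  from linked_unit_first[OF K a(1) assms] a(2) obtain a' where a': "solution ?E ?K h a'"
    "linked (Spec ?R) M (point (B_vars n) ?E ?K h a')"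
    "\<And>i. i < n \<Longrightarrow> a' (UC i) = (if i = 0 then \<one>\<^bsub>?K\<^esub> else \<zero>\<^bsub>?K\<^esub>)"
    by auto
  have "linked (Spec ?R) (point (B_vars n) ?E ?K h a') (point (B_vars n) ?E type_ring id (origin type_ring))"
    using a' by (intro linked_origin K.domain_axioms) auto
  then show "linked (Spec (B_ring n)) P (point (B_vars n) ?E type_ring id (origin type_ring))"
    using linked_trans[OF linked_trans[OF linked_Spec_subset[OF P M PM] a'(2)]] by (simp add: B_ring_def)
qed

section \<open>Rank one\<close>

text \<open>\<^term>\<open>B_ring 1\<close> is the ring of Laurent polynomials, so that its generic point lies in
  every nonempty open set; it is realised here as the kernel of the map to \<open>k(x)\<close>.\<close>

definition mpoly_of_poly :: "'k::comm_ring_1 poly \<Rightarrow> (coord, 'k) mpoly" where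
  "mpoly_of_poly q = poly (map_poly Const q) (Var (SC 0 0 0))"

lemma Const_0: "Const 0 = 0"
  by (simp add: Const_def)

lemma Const_add: "Const (c + d) = Const c + Const d"
  by (simp add: Const_def single_add)

lemma mpoly_of_poly_0 [simp]: "mpoly_of_poly 0 = 0"
  by (simp add: mpoly_of_poly_def)

lemma mpoly_of_poly_pCons [simp]:
  "mpoly_of_poly (pCons c q) = Const c + Var (SC 0 0 0) * mpoly_of_poly q"
  by (simp add: mpoly_of_poly_def map_poly_pCons Const_0)

lemma mpoly_of_poly_add: "mpoly_of_poly (p + q) = mpoly_of_poly p + mpoly_of_poly q"
  by (induction p q rule: poly_induct2) (simp_all add: Const_add algebra_simps)

lemma mpoly_of_poly_shift:
  "mpoly_of_poly ((pCons 0 ^^ m) q) = Var (SC 0 0 0) ^ m * mpoly_of_poly q"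
  by (induction m) (simp_all add: Const_0 algebra_simps)

text \<open>Write x for \<open>Var (SC 0 0 0)\<close> and u for \<open>Var (UC 0)\<close>. Modulo u
  x - 1, u acts as 1/x, so a power of x clears it. Stating this as an identity of polynomials allows
  evaluating it in two different rings.\<close>

lemma clear_denominator:
  fixes p :: "(coord, 'k::comm_ring_1) mpoly"
  assumes "p \<in> carrier (mpoly_ring (B_vars 1))"
  shows "\<exists>m q r. Var (SC 0 0 0) ^ m * p = mpoly_of_poly q + (Var (UC 0) * Var (SC 0 0 0) - 1) * r"
  using assms
proof (induction p rule: mpoly_induct)
  case (Const c)
  have "Var (SC 0 0 0) ^ 0 * Const c = mpoly_of_poly [:c:] + (Var (UC 0) * Var (SC 0 0 0) - 1) * 0"
    by simp
  then show ?case by blast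
next
  case (add p p')
  let ?X = "Var (SC 0 0 0) :: (coord, 'k) mpoly" and ?e = "Var (UC 0) * Var (SC 0 0 0) - 1 :: (coord, 'k) mpoly"
  obtain m q r where 1: "?X ^ m * p = mpoly_of_poly q + ?e * r" using add by blast
  obtain m' q' r' where 2: "?X ^ m' * p' = mpoly_of_poly q' + ?e * r'" using add by blast
  have "?X ^ (m + m') * (p + p') = ?X ^ m' * (?X ^ m * p) + ?X ^ m * (?X ^ m' * p')"
    by (simp add: power_add algebra_simps)
  also have "\<dots> = mpoly_of_poly ((pCons 0 ^^ m') q + (pCons 0 ^^ m) q') + ?e * (?X ^ m' * r + ?X ^ m * r')"
    unfolding 1 2 mpoly_of_poly_add mpoly_of_poly_shift by (simp add: distrib_left mult.left_commute add_ac)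
  finally show ?case by blast
next
  case (Var p v)
  let ?X = "Var (SC 0 0 0) :: (coord, 'k) mpoly" and ?e = "Var (UC 0) * Var (SC 0 0 0) - 1 :: (coord, 'k) mpoly"
  obtain m q r where 1: "?X ^ m * p = mpoly_of_poly q + ?e * r" using Var by blast
  have "v = SC 0 0 0 \<or> v = UC 0" using Var(2) by (auto simp: B_vars_def)
  then show ?case
  proof
    assume v: "v = SC 0 0 0"
    have "?X ^ m * (p * Var v) = (?X ^ m * p) * ?X" by (simp add: v mult_ac)
    also have "\<dots> = mpoly_of_poly (pCons 0 q) + ?e * (r * ?X)"
      unfolding 1 by (simp add: Const_0 distrib_left distrib_right mult_ac)
    finally show ?thesis by blast
  next
    assume v: "v = UC 0"
    \<comment> \<open>One more power of x meets the new factor u, and u x is 1 + (u x - 1).\<close>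
    have "?X ^ Suc m * (p * Var v) = ?X ^ m * p + ?e * (?X ^ m * p)"
      by (simp add: v algebra_simps)
    also have "\<dots> = mpoly_of_poly q + ?e * (r + ?X ^ m * p)"
      using 1 by (simp add: distrib_left)
    finally show ?thesis by blast
  qed
qed

lemma domain_type_ring: "domain (type_ring :: 'a::idom ring)"
proof -
  interpret cring "type_ring :: 'a ring" by (rule cring_type_ring)
  show ?thesis by unfold_locales auto
qed

text \<open>In rank one commutativity and associativity are automatic. The unit law remains, which
  is the equation of the multiplicative group.\<close>

lemma is_table_1_iff:
  assumes "cring T"
  shows "is_table 1 T c u \<longleftrightarrow> c 0 0 0 \<in> carrier T \<and> u 0 \<in> carrier T \<and> u 0 \<otimes>\<^bsub>T\<^esub> c 0 0 0 = \<one>\<^bsub>T\<^esub>"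
proof -
  interpret cring T by (rule assms)
  show ?thesis by (auto simp: is_table_def lessThan_Suc)
qed

text \<open>The generic point is the kernel of the map to k(x) that sends the structure constant to
  x and the unit coordinate to its inverse. It is contained in every prime, hence linked to
  it.\<close>

lemma connected_B_1:
  "connected_space (Spec (B_ring 1 :: (coord, 'k::field) mpoly set ring))"
proof (rule connected_space_if_linked)
  let ?E = "base_change (B_eqs 1) :: (coord, 'k) mpoly set" and ?V = "B_vars 1"
  let ?X = "Var (SC 0 0 0) :: (coord, 'k) mpoly"
  note E = base_change_closed[OF B_eqs_closed]
  define T where "T = (type_ring :: 'k poly fract ring)"
  define x where "x = to_fract [:0, 1 :: 'k:]"
  define h where "h c = to_fract [:c :: 'k:]" for c
  define a where "a v = (case v of SC i j l \<Rightarrow> x | UC i \<Rightarrow> inverse x)" for v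
  have T: "domain T" unfolding T_def by (rule domain_type_ring)
  interpret T: "domain" T by (rule T)
  interpret X: evaluation T h a
    by unfold_locales (auto simp: T_def h_def a_def pCons_one simp flip: to_fract_add to_fract_mult intro!: ring_hom_memI)
  have "x \<noteq> 0" by (simp add: x_def)
  then have sol: "solution ?E T h a"
    unfolding solution_B_iff[OF X.evaluation_axioms] is_table_1_iff[OF T.is_cring] by (simp add: T_def a_def)
  have ev_poly: "X.ev (mpoly_of_poly q) = to_fract q" for q
  proof (induction q)
    case 0
    then show ?case by (simp add: X.ev_0) (simp add: T_def)
  next
    case (pCons c q)
    have "to_fract (pCons c q) = h c + x * to_fract q"
      by (simp add: h_def x_def flip: to_fract_add to_fract_mult)
    then show ?case
      using pCons by (simp add: X.ev_add X.ev_mult X.ev_Const X.ev_Var) (simp add: T_def a_def)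
  qed
  fix P assume "P \<in> topspace (Spec (B_ring 1 :: (coord, 'k) mpoly set ring))"
  then have P: "primeideal P (coord_ring ?V ?E)" by (simp add: topspace_Spec B_ring_def)
  define D where "D = coord_ring ?V ?E Quot P"
  interpret D: "domain" D unfolding D_def by (rule primeideal.quotient_is_domain[OF P])
  from primeideal_is_point[OF E P, folded D_def] obtain g b
    where b: "solution ?E D g b" "point ?V ?E D g b = P" by blast
  interpret Y: evaluation D g b using b by (simp add: solution_def)
  have unit: "b (UC 0) \<otimes>\<^bsub>D\<^esub> b (SC 0 0 0) = \<one>\<^bsub>D\<^esub>"
    using b(1) unfolding solution_B_iff[OF Y.evaluation_axioms] is_table_1_iff[OF D.is_cring] by blast
  \<comment> \<open>A polynomial that vanishes generically vanishes at \<open>P\<close>: after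
    clearing denominators its part \<open>q\<close> is zero, as k[x] embeds in k(x), and the rest is
    a multiple of an equation that holds at \<open>P\<close>.\<close>
  have "Y.ev p = \<zero>\<^bsub>D\<^esub>" if p: "p \<in> carrier (mpoly_ring ?V)" "X.ev p = \<zero>\<^bsub>T\<^esub>" for p
  proof -
    from clear_denominator[OF p(1)] obtain m q r
      where eq: "?X ^ m * p = mpoly_of_poly q + (Var (UC 0) * ?X - 1) * r" by blast
    have "X.ev (Var (UC 0) * ?X - 1) = \<zero>\<^bsub>T\<^esub>"
      using sol unfolding solution_B_iff[OF X.evaluation_axioms] is_table_1_iff[OF T.is_cring]
      by (simp add: X.ev_diff X.ev_mult X.ev_Var X.ev_1 T.diff_eq_zero_iff)
    then have "X.ev (?X ^ m * p) = X.ev (mpoly_of_poly q)"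
      unfolding eq by (simp add: X.ev_add X.ev_mult)
    then have "to_fract q = 0" using p(2) by (simp add: X.ev_mult ev_poly) (simp add: T_def)
    moreover have "Y.ev (Var (UC 0) * ?X - 1) = \<zero>\<^bsub>D\<^esub>"
      using Y.a unit by (simp add: Y.ev_diff Y.ev_mult Y.ev_Var Y.ev_1 D.diff_eq_zero_iff)
    ultimately have X0: "Y.ev (?X ^ m) \<otimes>\<^bsub>D\<^esub> Y.ev p = \<zero>\<^bsub>D\<^esub>"
      using arg_cong[OF eq, of Y.ev] by (simp add: Y.ev_add Y.ev_mult Y.ev_0)
    \<comment> \<open>The structure constant is invertible at \<open>P\<close>, so its powers can be
      cancelled in the domain \<open>D\<close>.\<close>
    have "b (SC 0 0 0) \<noteq> \<zero>\<^bsub>D\<^esub>" using unit Y.a[of "UC 0"] by auto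
    then have "Y.ev (?X ^ m) \<noteq> \<zero>\<^bsub>D\<^esub>"
    proof (induction m)
      case (Suc m)
      then show ?case using D.integral[of "b (SC 0 0 0)" "Y.ev (?X ^ m)"] Y.a
        by (auto simp: Y.ev_mult Y.ev_Var)
    qed (simp add: Y.ev_1)
    then show ?thesis using X0 D.integral[of "Y.ev (?X ^ m)" "Y.ev p"] by simp
  qed
  then have "point ?V ?E T h a \<subseteq> P" unfolding b(2)[symmetric] by (auto simp: point_def)
  then have "linked (Spec (coord_ring ?V ?E)) (point ?V ?E T h a) P"
    by (rule linked_Spec_subset[OF primeideal_point[OF E T sol] P])
  then show "linked (Spec (B_ring 1)) P (point ?V ?E T h a)"
    by (simp add: linked_sym B_ring_def)
qed

section \<open>All ranks\<close>

theorem theorem7p6: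
  fixes n :: nat
  shows "connected_space (Spec (B1_ring n :: (coord, 'k::field) mpoly set ring)) \<and>
    connected_space (Spec (B_ring n :: (coord, 'k) mpoly set ring))"
proof
  show "connected_space (Spec (B1_ring n :: (coord, 'k) mpoly set ring))"
    by (rule connected_B1)
  consider "n = 0" | "n = 1" | "2 \<le> n" by linarith
  then show "connected_space (Spec (B_ring n :: (coord, 'k) mpoly set ring))"
  proof cases
    case 1
    \<comment> \<open>In rank zero there are no unit coordinates to fix, so both schemes have the
      same equations.\<close>
    then show ?thesis using connected_B1[of 0] by (simp add: B_ring_def B1_ring_def B1_eqs_def)
  qed (simp_all add: connected_B_1 connected_B_ge_2 del: One_nat_def)
qed

end
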